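(* Fix a Tutte cut-cycle property with bad isthmus set $X$ and bad loop set $Y$. Let $\mathbb{G}=(G,\mathcal{O}_{\mathrm{ref}},<)$ be an ordered, oriented graph whose underlying (connected) graph $G$ has $n$ vertices and cyclomatic number $g=|E(G)|-n+1$, and let $T_G(x,y)$ be the Tutte polynomial of $G$. For a fourientation $\mathcal{O}$, let $\mathcal{O}^{o},\mathcal{O}^{u},\mathcal{O}^{b}$ denote the sets of edges that are oriented, unoriented, bioriented in $\mathcal{O}$, respectively. Then $$\sum_{\mathcal{O}} k^{|\mathcal{O}^{o}|}\, l^{|\mathcal{O}^{u}|}\, m^{|\mathcal{O}^{b}|} = (k+m)^{n-1}(k+l)^{g}\; T_G\!\left(\frac{x_0}{k+m},\frac{y_0}{k+l}\right),$$ where the sum is over all good fourientations $\mathcal{O}$ of $\mathbb{G}$ (with respect to the given property), and $$x_0 := \delta(\{+\}\notin X)\,k+\delta(\{-\}\notin X)\,k+\delta(\emptyset\notin X)\,l+m,$$ $$y_0 := \delta(\{+\}\notin Y)\,k+\delta(\{-\}\notin Y)\,k+l+\delta(\{+,-\}\notin Y)\,m,$$ with $\delta(P)=1$ if $P$ is true and $\delta(P)=0$ otherwise. In other words, for nonnegative integers $k,l,m$ the number of good $(k,l,m)$-fourientations of $\mathbb{G}$ is given by this expression. (The identity is between polynomials in $k,l,m$, the right-hand side being a polynomial after clearing denominators.)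
   Context: Graphs are finite, undirected and connected; loops and multiple edges are allowed. A reference orientation $\mathcal{O}_{\mathrm{ref}}$ of $G$ assigns to each edge $e=\{u,v\}$ one of the ordered pairs $(u,v),(v,u)$. Every edge $e$ has two formal orientations $e^+$ and $e^-$ (treated as distinct even if $e$ is a loop): $e^+$ is directed as $\mathcal{O}_{\mathrm{ref}}(e)$ and $e^-$ is directed oppositely; $e^{\varepsilon}=(u,v)$ means $e^\varepsilon$ is directed from $u$ to $v$. Let $\mathbb{E}(G)=\{e^+,e^-: e\in E(G)\}$. An ordered, oriented graph is a triple $\mathbb{G}=(G,\mathcal{O}_{\mathrm{ref}},<)$ with $<$ a total order on $E(G)$. A fourientation of $\mathbb{G}$ is a subset $\mathcal{O}\subseteq\mathbb{E}(G)$; $e$ is oriented, unoriented, bioriented in $\mathcal{O}$ if exactly one, none, both of $e^+,e^-$ lie in $\mathcal{O}$. A cut is a partition $Cu=\{U,U^c\}$ of $V(G)$ into two nonempty parts, $E(Cu)$ is the set of edges with one endpoint in each part; it is simple if the induced subgraphs on $U$ and $U^c$ are connected. A directed cut is an ordered pair $\overrightarrow{Cu}=(U,U^c)$; $\mathbb{E}(\overrightarrow{Cu})$ is the set of edge orientations directed from $U$ to $U^c$. A cycle is a cyclic list $v_1,e_1,\dots,v_k,e_k$ ($k\ge 1$) with distinct edges $e_i=\{v_i,v_{i+1}\}$ (indices mod $k$), up to rotation and reflection; it is simple if the $v_i$ are distinct. A directed cycle $\overrightarrow{Cy}=v_1,e_1^{\delta_1},\dots,v_k,e_k^{\delta_k}$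 additionally has $e_i^{\delta_i}=(v_i,v_{i+1})$, up to rotation; $\mathbb{E}(\overrightarrow{Cy})=\{e_i^{\delta_i}\}$. An isthmus is an edge $e$ with $E(Cu)=\{e\}$ for some cut; a loop is an edge joining a vertex to itself. $\overrightarrow{Cu}$ is a potential cut of $\mathcal{O}$ if $e^{\varepsilon}\in\mathbb{E}(\overrightarrow{Cu})$ implies $e^{-\varepsilon}\notin\mathcal{O}$; $\overrightarrow{Cy}$ is a potential cycle of $\mathcal{O}$ if $\mathbb{E}(\overrightarrow{Cy})\subseteq\mathcal{O}$. $\mathbb{G}\setminus e$ and $\mathbb{G}/e$ denote deletion and contraction with induced reference orientation and order. A fourientation $\mathcal{O}$ of $\mathbb{G}\setminus e$ or $\mathbb{G}/e$ is also regarded as the fourientation of $\mathbb{G}$ in which $e$ is unoriented. For a simple cut $Cu$, $\mathbb{G}_{Cu}$ is obtained by contracting all edges not in $E(Cu)$; for a simple cycle $Cy$, $\mathbb{G}_{Cy}$ is obtained by deleting all edges not in $E(Cy)$ and removing isolated vertices; $\mathcal{O}_{C}$ is the fourientation of $\mathbb{G}_C$ induced by $\mathcal{O}$. A fourientation property is a map from pairs $(\mathbb{G},\mathcal{O})$ ($\mathcal{O}$ a fourientation of $\mathbb{G}$) to $\{\mathrm{good},\mathrm{bad}\}$, invariant under isomorphism (bijections of vertices and edges compatible with incidence, reference orientation, edge order and $\mathcal{O}$). It is a cut (cycle) property if $\mathcal{O}$ is good for $\mathbb{G}$ if and only if $\mathcal{O}_C$ is good for $\mathbb{G}_C$ for every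 simple cut (cycle) $C$. A cut (cycle) property is a Tutte cut (cycle) property if for all $\mathbb{G}$ (statements for cycle properties in parentheses): T1: $\mathcal{O}$ is bad for $\mathbb{G}$ only if $\mathcal{O}$ has a potential cut (cycle). T2: if the maximum edge $e$ of $\mathbb{G}$ is neither an isthmus nor a loop, then for every fourientation $\mathcal{O}$ of $\mathbb{G}\setminus e$ ($\mathbb{G}/e$): (a) if $\mathcal{O}$ is good for $\mathbb{G}\setminus e$ ($\mathbb{G}/e$), then $\mathcal{O}\cup\{e^+\}$ and $\mathcal{O}\cup\{e^-\}$ are both good for $\mathbb{G}$; (b) if $\mathcal{O}$ is bad for $\mathbb{G}\setminus e$ ($\mathbb{G}/e$) but $\mathcal{O}\cup\{e^+,e^-\}$ ($\mathcal{O}$) is good for $\mathbb{G}$, then exactly one of $\mathcal{O}\cup\{e^+\}$, $\mathcal{O}\cup\{e^-\}$ is good for $\mathbb{G}$; (c) $\mathcal{O}$ is good for $\mathbb{G}\setminus e$ ($\mathbb{G}/e$) if and only if $\mathcal{O}$ ($\mathcal{O}\cup\{e^+,e^-\}$) is good for $\mathbb{G}$. A Tutte cut-cycle property is the intersection of a Tutte cut property with a Tutte cycle property (good means good for both). The bad isthmus set $X\subseteq\{\emptyset,\{-\},\{+\}\}$ of a Tutte cut property is the set of $S$ such that $\{e^{\varepsilon}:\varepsilon\in S\}$ is bad for the ordered, oriented graph with two vertices and a single edge $e$ joining them. The bad loop set $Y\subseteq\{\{-\},\{+\},\{-,+\}\}$ of a Tutte cycle property is the set of $S$ such that $\{e^\varepsilon:\varepsilon\in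 S\}$ is bad for the graph with one vertex and one loop $e$. For a Tutte cut-cycle property these are those of the underlying cut and cycle properties. A $(k,l,m)$-fourientation is a fourientation together with a choice, for each oriented edge of one of $k$ colors, for each unoriented edge of one of $l$ colors, and for each bioriented edge of one of $m$ colors; it is good if the underlying fourientation is good. *)

theory Defs
  imports
    "Graph_Theory.Digraph_Component"
    "HOL-Library.Disjoint_Sets"
    "HOL-Library.FuncSet"
    "HOL-Library.Infinite_Typeclass"
    "HOL-Computational_Algebra.Polynomial"
begin

section \<open>Ordered, oriented graphs\<close>

text \<open>
  A finite multigraph (loops allowed) together with a reference orientation is a finite
  \<open>pre_digraph\<close>: the edges are its arcs, and each edge \<open>e\<close> is directed by the reference
  orientation from \<open>tail G e\<close> to \<open>head G e\<close>.  \<open>Digraph_Component.connected\<close> ignores the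
  direction of the arcs and requires at least one vertex.  The total order on the edges is given
  by a strict order relation.
\<close>

definition ordered_oriented_graph :: "('v, 'e) pre_digraph \<Rightarrow> 'e rel \<Rightarrow> bool" where
  "ordered_oriented_graph G r \<longleftrightarrow>
     fin_digraph G \<and> Digraph_Component.connected G \<and>
     r \<subseteq> arcs G \<times> arcs G \<and> trans r \<and> irrefl r \<and> total_on (arcs G) r"

datatype sign = Plus | Minus

fun opp :: "sign \<Rightarrow> sign" where
  "opp Plus = Minus"
| "opp Minus = Plus"

fun source :: "('v, 'e) pre_digraph \<Rightarrow> 'e \<times> sign \<Rightarrow> 'v" where
  "source G (e, Plus) = tail G e"
| "source G (e, Minus) = head G e"

fun target :: "('v, 'e) pre_digraph \<Rightarrow> 'e \<times> sign \<Rightarrow> 'v" where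
  "target G (e, Plus) = head G e"
| "target G (e, Minus) = tail G e"

definition edge_orientations :: "('v, 'e) pre_digraph \<Rightarrow> ('e \<times> sign) set" where
  "edge_orientations G = arcs G \<times> UNIV"

definition fourientations :: "('v, 'e) pre_digraph \<Rightarrow> ('e \<times> sign) set set" where
  "fourientations G = Pow (edge_orientations G)"

definition oriented_edges :: "('v, 'e) pre_digraph \<Rightarrow> ('e \<times> sign) set \<Rightarrow> 'e set" where
  "oriented_edges G \<O> = {e \<in> arcs G. ((e, Plus) \<in> \<O>) \<noteq> ((e, Minus) \<in> \<O>)}"

definition unoriented_edges :: "('v, 'e) pre_digraph \<Rightarrow> ('e \<times> sign) set \<Rightarrow> 'e set" where
  "unoriented_edges G \<O> = {e \<in> arcs G. (e, Plus) \<notin> \<O> \<and> (e, Minus) \<notin> \<O>}"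

definition bioriented_edges :: "('v, 'e) pre_digraph \<Rightarrow> ('e \<times> sign) set \<Rightarrow> 'e set" where
  "bioriented_edges G \<O> = {e \<in> arcs G. (e, Plus) \<in> \<O> \<and> (e, Minus) \<in> \<O>}"


section \<open>Cuts and cycles\<close>

definition is_cut :: "('v, 'e) pre_digraph \<Rightarrow> 'v set set \<Rightarrow> bool" where
  "is_cut G Cu \<longleftrightarrow> partition_on (verts G) Cu \<and> card Cu = 2"

definition cut_edges :: "('v, 'e) pre_digraph \<Rightarrow> 'v set set \<Rightarrow> 'e set" where
  "cut_edges G Cu = {e \<in> arcs G. \<exists>U\<in>Cu. \<exists>W\<in>Cu. U \<noteq> W \<and> tail G e \<in> U \<and> head G e \<in> W}"

definition simple_cut :: "('v, 'e) pre_digraph \<Rightarrow> 'v set set \<Rightarrow> bool" where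
  "simple_cut G Cu \<longleftrightarrow> is_cut G Cu \<and> (\<forall>U\<in>Cu. Digraph_Component.connected (G \<restriction> U))"

definition directed_cut :: "('v, 'e) pre_digraph \<Rightarrow> 'v set \<times> 'v set \<Rightarrow> bool" where
  "directed_cut G D \<longleftrightarrow> is_cut G {fst D, snd D}"

definition directed_cut_orientations ::
    "('v, 'e) pre_digraph \<Rightarrow> 'v set \<times> 'v set \<Rightarrow> ('e \<times> sign) set" where
  "directed_cut_orientations G D =
     {a \<in> edge_orientations G. source G a \<in> fst D \<and> target G a \<in> snd D}"

definition potential_cut ::
    "('v, 'e) pre_digraph \<Rightarrow> ('e \<times> sign) set \<Rightarrow> 'v set \<times> 'v set \<Rightarrow> bool" where
  "potential_cut G \<O> D \<longleftrightarrow>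
     directed_cut G D \<and> (\<forall>(e, s) \<in> directed_cut_orientations G D. (e, opp s) \<notin> \<O>)"

text \<open>
  A cycle is represented by the list \<open>(v\<^sub>1, e\<^sub>1), \<dots>, (v\<^sub>k, e\<^sub>k)\<close>.  Lists are not
  identified up to rotation and reflection; everything below depends only on the set of edges
  (or edge orientations) of the cycle and on its simplicity.
\<close>

definition is_cycle :: "('v, 'e) pre_digraph \<Rightarrow> ('v \<times> 'e) list \<Rightarrow> bool" where
  "is_cycle G Cy \<longleftrightarrow>
     Cy \<noteq> [] \<and> set (map snd Cy) \<subseteq> arcs G \<and> distinct (map snd Cy) \<and>
     (\<forall>i < length Cy.
        {tail G (snd (Cy ! i)), head G (snd (Cy ! i))} =
        {fst (Cy ! i), fst (Cy ! (Suc i mod length Cy))})"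

definition simple_cycle :: "('v, 'e) pre_digraph \<Rightarrow> ('v \<times> 'e) list \<Rightarrow> bool" where
  "simple_cycle G Cy \<longleftrightarrow> is_cycle G Cy \<and> distinct (map fst Cy)"

definition cycle_edges :: "('v \<times> 'e) list \<Rightarrow> 'e set" where
  "cycle_edges Cy = set (map snd Cy)"

definition directed_cycle :: "('v, 'e) pre_digraph \<Rightarrow> ('v \<times> 'e \<times> sign) list \<Rightarrow> bool" where
  "directed_cycle G D \<longleftrightarrow>
     D \<noteq> [] \<and> set (map snd D) \<subseteq> edge_orientations G \<and> distinct (map (fst \<circ> snd) D) \<and>
     (\<forall>i < length D. source G (snd (D ! i)) = fst (D ! i) \<and>
        target G (snd (D ! i)) = fst (D ! (Suc i mod length D)))"

definition potential_cycle ::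
    "('v, 'e) pre_digraph \<Rightarrow> ('e \<times> sign) set \<Rightarrow> ('v \<times> 'e \<times> sign) list \<Rightarrow> bool" where
  "potential_cycle G \<O> D \<longleftrightarrow> directed_cycle G D \<and> set (map snd D) \<subseteq> \<O>"

definition isthmus :: "('v, 'e) pre_digraph \<Rightarrow> 'e \<Rightarrow> bool" where
  "isthmus G e \<longleftrightarrow> (\<exists>Cu. is_cut G Cu \<and> cut_edges G Cu = {e})"

definition loop :: "('v, 'e) pre_digraph \<Rightarrow> 'e \<Rightarrow> bool" where
  "loop G e \<longleftrightarrow> e \<in> arcs G \<and> tail G e = head G e"


section \<open>Minors\<close>

definition component_of :: "('v, 'e) pre_digraph \<Rightarrow> 'e set \<Rightarrow> 'v \<Rightarrow> 'v set" where
  "component_of G A v = {w. v \<rightarrow>\<^sup>*\<^bsub>mk_symmetric (G\<lparr>arcs := A\<rparr>)\<^esub> w}"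

text \<open>
  To keep the vertex type, contracting the edges in \<open>A\<close> replaces each connected component of the
  spanning subgraph with edge set \<open>A\<close> by a chosen representative; the choice is immaterial
  because fourientation properties are invariant under isomorphism.
\<close>

definition representative :: "('v, 'e) pre_digraph \<Rightarrow> 'e set \<Rightarrow> 'v \<Rightarrow> 'v" where
  "representative G A v = (SOME w. w \<in> component_of G A v)"

definition contract :: "('v, 'e) pre_digraph \<Rightarrow> 'e set \<Rightarrow> ('v, 'e) pre_digraph" where
  "contract G A =
     \<lparr>verts = representative G A ` verts G, arcs = arcs G - A,
      tail = representative G A \<circ> tail G, head = representative G A \<circ> head G\<rparr>"

definition cut_minor :: "('v, 'e) pre_digraph \<Rightarrow> 'v set set \<Rightarrow> ('v, 'e) pre_digraph" where
  "cut_minor G Cu = contract G (arcs G - cut_edges G Cu)"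

definition cycle_minor :: "('v, 'e) pre_digraph \<Rightarrow> ('v \<times> 'e) list \<Rightarrow> ('v, 'e) pre_digraph" where
  "cycle_minor G Cy =
     \<lparr>verts = tail G ` cycle_edges Cy \<union> head G ` cycle_edges Cy, arcs = cycle_edges Cy,
      tail = tail G, head = head G\<rparr>"

definition induced_order :: "('v, 'e) pre_digraph \<Rightarrow> 'e rel \<Rightarrow> 'e rel" where
  "induced_order H r = Restr r (arcs H)"

definition induced_fourientation ::
    "('v, 'e) pre_digraph \<Rightarrow> ('e \<times> sign) set \<Rightarrow> ('e \<times> sign) set" where
  "induced_fourientation H \<O> = \<O> \<inter> edge_orientations H"


section \<open>Tutte cut and cycle properties\<close>

text \<open>
  A property maps \<open>(G, r, \<O>)\<close> to \<open>True\<close> for good and \<open>False\<close> for bad.  Its values outside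
  ordered, oriented graphs and their fourientations play no role.  Only infinite vertex and edge
  types are used, so that every finite graph has an isomorphic copy over these types.
\<close>

type_synonym ('v, 'e) fproperty =
  "('v, 'e) pre_digraph \<Rightarrow> 'e rel \<Rightarrow> ('e \<times> sign) set \<Rightarrow> bool"

definition fourientation_isomorphic ::
    "('v, 'e) pre_digraph \<Rightarrow> 'e rel \<Rightarrow> ('e \<times> sign) set \<Rightarrow>
     ('v, 'e) pre_digraph \<Rightarrow> 'e rel \<Rightarrow> ('e \<times> sign) set \<Rightarrow> bool" where
  "fourientation_isomorphic G r \<O> G' r' \<O>' \<longleftrightarrow>
     (\<exists>f h. bij_betw f (verts G) (verts G') \<and> bij_betw h (arcs G) (arcs G') \<and>
        (\<forall>e\<in>arcs G. tail G' (h e) = f (tail G e) \<and> head G' (h e) = f (head G e)) \<and>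
        (\<forall>e\<in>arcs G. \<forall>e'\<in>arcs G. (e, e') \<in> r \<longleftrightarrow> (h e, h e') \<in> r') \<and>
        (\<forall>e\<in>arcs G. \<forall>s. (e, s) \<in> \<O> \<longleftrightarrow> (h e, s) \<in> \<O>'))"

definition fourientation_property :: "('v::infinite, 'e::infinite) fproperty \<Rightarrow> bool" where
  "fourientation_property P \<longleftrightarrow>
     (\<forall>G r \<O> G' r' \<O>'.
        ordered_oriented_graph G r \<and> \<O> \<in> fourientations G \<and>
        ordered_oriented_graph G' r' \<and> \<O>' \<in> fourientations G' \<and>
        fourientation_isomorphic G r \<O> G' r' \<O>' \<longrightarrow>
        P G r \<O> = P G' r' \<O>')"

definition cut_property :: "('v::infinite, 'e::infinite) fproperty \<Rightarrow> bool" where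
  "cut_property P \<longleftrightarrow> fourientation_property P \<and>
     (\<forall>G r \<O>. ordered_oriented_graph G r \<and> \<O> \<in> fourientations G \<longrightarrow>
        (P G r \<O> \<longleftrightarrow>
          (\<forall>Cu. simple_cut G Cu \<longrightarrow>
             P (cut_minor G Cu) (induced_order (cut_minor G Cu) r)
               (induced_fourientation (cut_minor G Cu) \<O>))))"

definition cycle_property :: "('v::infinite, 'e::infinite) fproperty \<Rightarrow> bool" where
  "cycle_property P \<longleftrightarrow> fourientation_property P \<and>
     (\<forall>G r \<O>. ordered_oriented_graph G r \<and> \<O> \<in> fourientations G \<longrightarrow>
        (P G r \<O> \<longleftrightarrow>
          (\<forall>Cy. simple_cycle G Cy \<longrightarrow>
             P (cycle_minor G Cy) (induced_order (cycle_minor G Cy) r)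
               (induced_fourientation (cycle_minor G Cy) \<O>))))"

definition maximum_edge :: "('v, 'e) pre_digraph \<Rightarrow> 'e rel \<Rightarrow> 'e \<Rightarrow> bool" where
  "maximum_edge G r e \<longleftrightarrow> e \<in> arcs G \<and> (\<forall>e'\<in>arcs G. e' \<noteq> e \<longrightarrow> (e', e) \<in> r)"

definition Tutte_cut_property :: "('v::infinite, 'e::infinite) fproperty \<Rightarrow> bool" where
  "Tutte_cut_property P \<longleftrightarrow> cut_property P \<and>
     (\<forall>G r \<O>. ordered_oriented_graph G r \<and> \<O> \<in> fourientations G \<and> \<not> P G r \<O> \<longrightarrow>
        (\<exists>D. potential_cut G \<O> D)) \<and>
     (\<forall>G r e. ordered_oriented_graph G r \<and> maximum_edge G r e \<and> \<not> isthmus G e \<and> \<not> loop G e \<longrightarrow>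
        (let H = pre_digraph.del_arc G e; r' = induced_order H r in
         \<forall>\<O> \<in> fourientations H.
           (P H r' \<O> \<longrightarrow> P G r (\<O> \<union> {(e, Plus)}) \<and> P G r (\<O> \<union> {(e, Minus)})) \<and>
           (\<not> P H r' \<O> \<and> P G r (\<O> \<union> {(e, Plus), (e, Minus)}) \<longrightarrow>
              P G r (\<O> \<union> {(e, Plus)}) \<noteq> P G r (\<O> \<union> {(e, Minus)})) \<and>
           (P H r' \<O> \<longleftrightarrow> P G r \<O>)))"

definition Tutte_cycle_property :: "('v::infinite, 'e::infinite) fproperty \<Rightarrow> bool" where
  "Tutte_cycle_property P \<longleftrightarrow> cycle_property P \<and>
     (\<forall>G r \<O>. ordered_oriented_graph G r \<and> \<O> \<in> fourientations G \<and> \<not> P G r \<O> \<longrightarrow>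
        (\<exists>D. potential_cycle G \<O> D)) \<and>
     (\<forall>G r e. ordered_oriented_graph G r \<and> maximum_edge G r e \<and> \<not> isthmus G e \<and> \<not> loop G e \<longrightarrow>
        (let H = contract G {e}; r' = induced_order H r in
         \<forall>\<O> \<in> fourientations H.
           (P H r' \<O> \<longrightarrow> P G r (\<O> \<union> {(e, Plus)}) \<and> P G r (\<O> \<union> {(e, Minus)})) \<and>
           (\<not> P H r' \<O> \<and> P G r \<O> \<longrightarrow>
              P G r (\<O> \<union> {(e, Plus)}) \<noteq> P G r (\<O> \<union> {(e, Minus)})) \<and>
           (P H r' \<O> \<longleftrightarrow> P G r (\<O> \<union> {(e, Plus), (e, Minus)}))))"

text \<open>
  The graph with two vertices and a single edge joining them, and the graph with one vertex and a
  single loop, are unique up to isomorphism, so the existential quantifiers below could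
  equivalently be universal.
\<close>

definition bad_isthmus_set :: "('v::infinite, 'e::infinite) fproperty \<Rightarrow> sign set set" where
  "bad_isthmus_set P = {S \<in> {{}, {Minus}, {Plus}}.
     \<exists>G r e. ordered_oriented_graph G r \<and> card (verts G) = 2 \<and> arcs G = {e} \<and>
       \<not> P G r ({e} \<times> S)}"

definition bad_loop_set :: "('v::infinite, 'e::infinite) fproperty \<Rightarrow> sign set set" where
  "bad_loop_set P = {S \<in> {{Minus}, {Plus}, {Minus, Plus}}.
     \<exists>G r e. ordered_oriented_graph G r \<and> card (verts G) = 1 \<and> arcs G = {e} \<and>
       \<not> P G r ({e} \<times> S)}"

definition good_fourientations ::
    "('v, 'e) fproperty \<Rightarrow> ('v, 'e) pre_digraph \<Rightarrow> 'e rel \<Rightarrow> ('e \<times> sign) set set" where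
  "good_fourientations P G r = {\<O> \<in> fourientations G. P G r \<O>}"

definition klm_fourientations ::
    "('v, 'e) pre_digraph \<Rightarrow> nat \<Rightarrow> nat \<Rightarrow> nat \<Rightarrow> (('e \<times> sign) set \<times> ('e \<Rightarrow> nat)) set" where
  "klm_fourientations G k l m =
     (SIGMA \<O> : fourientations G.
        \<Pi>\<^sub>E e\<in>arcs G.
          if e \<in> oriented_edges G \<O> then {..<k}
          else if e \<in> unoriented_edges G \<O> then {..<l}
          else {..<m})"


section \<open>The Tutte polynomial\<close>

definition num_components :: "('v, 'e) pre_digraph \<Rightarrow> 'e set \<Rightarrow> nat" where
  "num_components G A = card (component_of G A ` verts G)"

text \<open>
  The Tutte polynomial in its subset expansion
  \[\sum_{A \subseteq E} (x-1)^{c(A)-c(E)} (y-1)^{c(A)+|A|-|V|},\]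
  where \<open>x\<close> is the outer and \<open>y\<close> the inner variable; so the coefficient of
  $x^i y^j$ is \<open>coeff (coeff T i) j\<close>.  Both truncated subtractions are exact.
\<close>

definition Tutte_polynomial :: "('v, 'e) pre_digraph \<Rightarrow> int poly poly" where
  "Tutte_polynomial G =
     (\<Sum>A\<in>Pow (arcs G).
        (monom 1 1 - 1) ^ (num_components G A - num_components G (arcs G)) *
        ([:monom 1 1:] - 1) ^ (num_components G A + card A - card (verts G)))"

definition eval2 :: "int poly poly \<Rightarrow> 'a::comm_ring_1 \<Rightarrow> 'a \<Rightarrow> 'a" where
  "eval2 T x y = poly (map_poly (\<lambda>q. poly (map_poly of_int q) y) T) x"

text \<open>
  \<open>eval2_cleared a b T x z y w\<close> is $z^a w^b\, T(x/z, y/w)$ with denominators cleared, for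
  polynomials \<open>T\<close> of degree at most \<open>a\<close> in \<open>x\<close> and at most \<open>b\<close> in \<open>y\<close>.  The Tutte polynomial
  of a connected graph has degree at most \<open>|V| - 1\<close> in \<open>x\<close> and at most the
  cyclomatic number in \<open>y\<close>.
\<close>

definition eval2_cleared ::
    "nat \<Rightarrow> nat \<Rightarrow> int poly poly \<Rightarrow> 'a::comm_ring_1 \<Rightarrow> 'a \<Rightarrow> 'a \<Rightarrow> 'a \<Rightarrow> 'a" where
  "eval2_cleared a b T x z y w =
     (\<Sum>i\<le>a. \<Sum>j\<le>b. of_int (coeff (coeff T i) j) * x ^ i * z ^ (a - i) * y ^ j * w ^ (b - j))"

lemma poly_altdef_bound:
  fixes p :: "'a::comm_ring_1 poly"
  assumes "degree p \<le> n"
  shows "poly p x = (\<Sum>i\<le>n. coeff p i * x ^ i)"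
proof -
  have "(\<Sum>i\<le>n. coeff p i * x ^ i) = (\<Sum>i\<le>degree p. coeff p i * x ^ i)"
    using assms by (intro sum.mono_neutral_right) (auto simp: coeff_eq_0)
  then show ?thesis by (simp add: poly_altdef)
qed

lemma eval2_cleared_eq:
  fixes x y z w :: "'a::field"
  assumes "degree T \<le> a" and "\<And>i. degree (coeff T i) \<le> b" and "z \<noteq> 0" and "w \<noteq> 0"
  shows "eval2_cleared a b T x z y w = z ^ a * w ^ b * eval2 T (x / z) (y / w)"
proof -
  have inner: "poly (map_poly of_int q) v = (\<Sum>j\<le>b. of_int (coeff q j) * v ^ j)"
    if "degree q \<le> b" for q and v :: 'a
    using that order_trans[OF map_poly_degree_leq that]
    by (subst poly_altdef_bound[of _ b]) (simp_all add: coeff_map_poly)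
  have expand: "eval2 T u v = (\<Sum>i\<le>a. \<Sum>j\<le>b. of_int (coeff (coeff T i) j) * u ^ i * v ^ j)" for u v :: 'a
  proof -
    have "degree (map_poly (\<lambda>q. poly (map_poly of_int q) v) T) \<le> a"
      using map_poly_degree_leq assms(1) by (rule order_trans)
    then have "eval2 T u v = (\<Sum>i\<le>a. poly (map_poly of_int (coeff T i)) v * u ^ i)"
      unfolding eval2_def by (subst poly_altdef_bound[of _ a]) (simp_all add: coeff_map_poly)
    then show ?thesis
      by (simp add: inner assms(2) sum_distrib_right sum_distrib_left mult_ac)
  qed
  show ?thesis
    unfolding eval2_cleared_def expand sum_distrib_left
    using assms(3,4)
    by (intro sum.cong refl) (simp add: power_diff power_divide field_simps)
qed

definition isthmus_weight :: "sign set set \<Rightarrow> 'a::comm_ring_1 \<Rightarrow> 'a \<Rightarrow> 'a \<Rightarrow> 'a" where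
  "isthmus_weight X k l m =
     of_bool ({Plus} \<notin> X) * k + of_bool ({Minus} \<notin> X) * k + of_bool ({} \<notin> X) * l + m"

definition loop_weight :: "sign set set \<Rightarrow> 'a::comm_ring_1 \<Rightarrow> 'a \<Rightarrow> 'a \<Rightarrow> 'a" where
  "loop_weight Y k l m =
     of_bool ({Plus} \<notin> Y) * k + of_bool ({Minus} \<notin> Y) * k + l + of_bool ({Plus, Minus} \<notin> Y) * m"

definition weight_sum ::
    "('v, 'e) fproperty \<Rightarrow> ('v, 'e) pre_digraph \<Rightarrow> 'e rel \<Rightarrow> 'a::comm_ring_1 \<Rightarrow> 'a \<Rightarrow> 'a \<Rightarrow> 'a" where
  "weight_sum P G r k l m =
     (\<Sum>\<O>\<in>good_fourientations P G r.
        k ^ card (oriented_edges G \<O>) * l ^ card (unoriented_edges G \<O>) *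
        m ^ card (bioriented_edges G \<O>))"

end

theory Submission
  imports Defs
begin

text \<open>
  Induction on the number of edges, removing the maximum edge \<open>e\<close>.  A cut property only sees the
  simple cuts of \<open>G\<close>; those avoiding \<open>e\<close> are the simple cuts of \<open>G/e\<close>, and by T1 a cut through
  \<open>e\<close> is never bad when \<open>e\<close> is bioriented.  So for a fourientation \<open>\<O>\<close> of the remaining edges,
  T2 determines how many of the four extensions of \<open>\<O>\<close> to \<open>e\<close> are good from whether \<open>\<O>\<close> is good
  for \<open>G \ e\<close> and for \<open>G/e\<close>.  The same holds dually for cycle properties.

  When \<open>e\<close> is neither an isthmus nor a loop, the only case that is not immediate is the one in which
  each of the two properties singles out exactly one bad orientation of \<open>e\<close>.  If it were the same
  orientation for both, T1 would provide a potential cycle and a potential cut through \<open>e\<close> that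
  agree on \<open>e\<close>; but the cycle has to return across the cut, which the potential cut forbids.  Hence
  neither orientation is good for both properties, and the weighted count \<open>W\<close> satisfies
  \<open>W(G) = (k + m) W(G/e) + (k + l) W(G \ e)\<close>.  An isthmus contributes the factor \<open>x\<^sub>0\<close> and a loop the
  factor \<open>y\<^sub>0\<close>.
\<close>

section \<open>Coboundaries and connectivity\<close>

text \<open>For a cut property T2 speaks only of deletion, for a cycle property only of contraction.
  The missing minor comes from T1: a cut property sees the contraction in the bioriented state of
  \<open>e\<close>, a cycle property sees the deletion in the unoriented state. Both then follow one
  pattern, unoriented with deletion and bioriented with contraction. Write pC, qC for goodness of
  the contraction and pD, qD for goodness of the deletion under the cut and the cycle property. The
  number of orientations of \<open>e\<close> good for both properties is [pC and qC] + [pD and qD];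
  together with the unoriented and the bioriented state this produces the coefficients of the
  recurrence. A cut is given by one side, an arbitrary set of vertices not confined to those of the
  graph, so that complements and preimages under contraction are again sides. Connectivity,
  components and circuits are all phrased through \<open>coboundary\<close>, which deletion and
  contraction change in a transparent way. Values lie in a commutative ring without division, so the
  induction is run on the evaluation with cleared denominators, and this requires degree bounds for
  the Tutte polynomial.\<close>

definition coboundary :: "('v, 'e) pre_digraph \<Rightarrow> 'v set \<Rightarrow> 'e set" where
  "coboundary G U = {e \<in> arcs G. (tail G e \<in> U) \<noteq> (head G e \<in> U)}"

text \<open>
  \<open>joined G A v w\<close> says that no cut separates \<open>v\<close> from \<open>w\<close> without containing an edge of \<open>A\<close>, that is,
  \<open>w\<close> is reachable from \<open>v\<close> inside \<open>A\<close>; phrased with cuts, it passes to minors without walks.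
\<close>

definition joined :: "('v, 'e) pre_digraph \<Rightarrow> 'e set \<Rightarrow> 'v \<Rightarrow> 'v \<Rightarrow> bool" where
  "joined G A v w \<longleftrightarrow> (\<forall>U. v \<in> U \<and> coboundary G U \<inter> A = {} \<longrightarrow> w \<in> U)"

lemma coboundary_subset: "coboundary G U \<subseteq> arcs G"
  by (auto simp: coboundary_def)

lemma coboundary_Compl: "coboundary G (- U) = coboundary G U"
  by (auto simp: coboundary_def)

lemma joinedD: "joined G A v w \<Longrightarrow> v \<in> U \<Longrightarrow> coboundary G U \<inter> A = {} \<Longrightarrow> w \<in> U"
  by (simp add: joined_def)

lemma joined_refl: "joined G A v v"
  by (simp add: joined_def)

lemma joined_sym: "joined G A v w \<Longrightarrow> joined G A w v"
  unfolding joined_def by (metis coboundary_Compl ComplI ComplD)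

lemma joined_trans: "joined G A u v \<Longrightarrow> joined G A v w \<Longrightarrow> joined G A u w"
  by (auto simp: joined_def)

lemma joined_mono: "joined G A v w \<Longrightarrow> A \<subseteq> B \<Longrightarrow> joined G B v w"
  unfolding joined_def by blast

lemma joined_arc: "e \<in> A \<Longrightarrow> e \<in> arcs G \<Longrightarrow> joined G A (tail G e) (head G e)"
  unfolding joined_def coboundary_def by blast

lemma joined_empty: "joined G {} v w \<longleftrightarrow> v = w"
  unfolding joined_def by auto

text \<open>A walk in \<open>A\<close> never leaves a set whose coboundary avoids \<open>A\<close>;
  conversely the set reached from \<open>v\<close> is itself such a set, so \<open>joined\<close>
  can be tested on it. Only here are walks in the symmetrised graph inspected.\<close>

lemma component_of_iff:
  assumes "wf_digraph G" "A \<subseteq> arcs G"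
  shows "w \<in> component_of G A v \<longleftrightarrow> v \<in> verts G \<and> w \<in> verts G \<and> joined G A v w"
proof -
  interpret wf_digraph G by fact
  let ?S = "mk_symmetric (G\<lparr>arcs := A\<rparr>)"
  have V: "verts (with_proj ?S) = verts G" by simp
  have E: "arcs_ends (with_proj ?S) = (\<Union>e\<in>A. {(tail G e, head G e), (head G e, tail G e)})"
    by (auto simp: parcs_mk_symmetric)
  let ?R = "rtrancl_on (verts G) (\<Union>e\<in>A. {(tail G e, head G e), (head G e, tail G e)})"
  have mem: "w \<in> component_of G A v \<longleftrightarrow> (v, w) \<in> ?R" for w
    unfolding component_of_def mem_Collect_eq reachable_def V E ..
  have "w \<in> U" if R: "(v, w) \<in> ?R" and U: "v \<in> U" "coboundary G U \<inter> A = {}" for U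
    using R
  proof (induction rule: rtrancl_on_induct)
    case base
    then show ?case by (simp add: U)
  next
    case (step y z)
    then obtain e where "e \<in> A" "(y, z) = (tail G e, head G e) \<or> (y, z) = (head G e, tail G e)"
      by auto
    moreover have "tail G e \<in> U \<longleftrightarrow> head G e \<in> U"
      using U(2) \<open>e \<in> A\<close> assms(2) by (auto simp: coboundary_def)
    ultimately show ?case using step.IH by auto
  qed
  moreover have "(v, w) \<in> ?R" if "v \<in> verts G" "joined G A v w"
  proof -
    have "(v, tail G e) \<in> ?R \<longleftrightarrow> (v, head G e) \<in> ?R" if "e \<in> A" for e
    proof
      have e: "(tail G e, head G e) \<in> (\<Union>e\<in>A. {(tail G e, head G e), (head G e, tail G e)})"
        "(head G e, tail G e) \<in> (\<Union>e\<in>A. {(tail G e, head G e), (head G e, tail G e)})"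
        "tail G e \<in> verts G" "head G e \<in> verts G"
        using that assms(2) by auto
      show "(v, head G e) \<in> ?R" if "(v, tail G e) \<in> ?R"
        using that e(1,4) by (rule rtrancl_on_into_rtrancl_on)
      show "(v, tail G e) \<in> ?R" if "(v, head G e) \<in> ?R"
        using that e(2,3) by (rule rtrancl_on_into_rtrancl_on)
    qed
    then have "coboundary G {x. (v, x) \<in> ?R} \<inter> A = {}"
      unfolding coboundary_def by blast
    moreover have "v \<in> {x. (v, x) \<in> ?R}"
      using that(1) by simp
    ultimately have "w \<in> {x. (v, x) \<in> ?R}"
      by (rule joinedD[OF that(2), rotated])
    then show ?thesis by simp
  qed
  ultimately show ?thesis
    unfolding mem joined_def using in_rtrancl_on_in_F[of v w] by blast
qed

lemma component_of_eq_iff: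
  assumes "wf_digraph G" "A \<subseteq> arcs G" "v \<in> verts G" "w \<in> verts G"
  shows "component_of G A v = component_of G A w \<longleftrightarrow> joined G A v w"
proof
  assume "component_of G A v = component_of G A w"
  moreover have "w \<in> component_of G A w"
    by (simp add: component_of_iff[OF assms(1,2)] assms(4) joined_refl)
  ultimately have "w \<in> component_of G A v" by simp
  then show "joined G A v w" by (simp add: component_of_iff[OF assms(1,2)])
next
  assume J: "joined G A v w"
  have "joined G A v x \<longleftrightarrow> joined G A w x" for x
    using joined_trans[OF J, of x] joined_trans[OF joined_sym[OF J], of x] by blast
  then show "component_of G A v = component_of G A w"
    by (simp add: set_eq_iff component_of_iff[OF assms(1,2)] assms(3,4))
qed

lemma connected_iff_joined:
  assumes "wf_digraph G"
  shows "Digraph_Component.connected G \<longleftrightarrow>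
    verts G \<noteq> {} \<and> (\<forall>v\<in>verts G. \<forall>w\<in>verts G. joined G (arcs G) v w)"
proof -
  have "v \<rightarrow>\<^sup>*\<^bsub>mk_symmetric G\<^esub> w \<longleftrightarrow> w \<in> component_of G (arcs G) v" for v w
    by (simp add: component_of_def)
  then show ?thesis
    unfolding connected_def strongly_connected_def
    using component_of_iff[OF assms order_refl] by auto
qed

text \<open>\<open>joined\<close> tests arbitrary sets, connectivity only proper nonempty sets of
  vertices. The gap closes because intersecting a set with the vertices leaves its coboundary
  unchanged.\<close>

lemma connected_iff_coboundary:
  assumes "wf_digraph G"
  shows "Digraph_Component.connected G \<longleftrightarrow>
    verts G \<noteq> {} \<and> (\<forall>U \<subset> verts G. U \<noteq> {} \<longrightarrow> coboundary G U \<noteq> {})"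
proof -
  interpret wf_digraph G by fact
  have sub: "coboundary G U \<inter> arcs G = coboundary G U" for U
    by (auto simp: coboundary_def)
  show ?thesis
  proof (intro iffI conjI allI impI; (elim conjE)?)
    assume "Digraph_Component.connected G"
    then show "verts G \<noteq> {}" using connected_iff_joined[OF assms] by simp
  next
    fix U assume C: "Digraph_Component.connected G" and U: "U \<subset> verts G" "U \<noteq> {}"
    then obtain v w where "v \<in> U" "w \<in> verts G" "w \<notin> U" "v \<in> verts G" by blast
    then have "joined G (arcs G) v w"
      using C connected_iff_joined[OF assms] by blast
    then show "coboundary G U \<noteq> {}"
      unfolding joined_def using \<open>v \<in> U\<close> \<open>w \<notin> U\<close> by blast
  next
    assume ne: "verts G \<noteq> {}"
      and *: "\<forall>U\<subset>verts G. U \<noteq> {} \<longrightarrow> coboundary G U \<noteq> {}"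
    have "joined G (arcs G) v w" if "v \<in> verts G" "w \<in> verts G" for v w
      unfolding joined_def
    proof (intro allI impI, rule ccontr)
      fix U assume U: "v \<in> U \<and> coboundary G U \<inter> arcs G = {}" "w \<notin> U"
      have "U \<inter> verts G \<subset> verts G" "U \<inter> verts G \<noteq> {}" using U that by blast+
      then have "coboundary G (U \<inter> verts G) \<noteq> {}" using * by blast
      moreover have "coboundary G U = coboundary G (U \<inter> verts G)"
        by (auto simp: coboundary_def)
      ultimately show False using U sub[of U] by simp
    qed
    then show "Digraph_Component.connected G"
      using connected_iff_joined[OF assms] ne by blast
  qed
qed

lemma connected_coboundary_nonempty:
  assumes "wf_digraph G" "Digraph_Component.connected G" "v \<in> U" "v \<in> verts G" "w \<notin> U" "w \<in> verts G"
  shows "coboundary G U \<noteq> {}"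
proof
  assume "coboundary G U = {}"
  moreover have "joined G (arcs G) v w"
    using assms connected_iff_joined[OF assms(1)] by simp
  ultimately show False using assms(3,5) by (simp add: joined_def)
qed

text \<open>The vertices for which the right side holds form a set that no edge of
  \<open>insert e A\<close> leaves, so it can serve as the test set of \<open>joined\<close>. This
  replaces the argument that a path uses \<open>e\<close> at most once.\<close>

lemma joined_insert:
  assumes "e \<in> arcs G"
  shows "joined G (insert e A) v w \<longleftrightarrow> joined G A v w \<or>
    (joined G A v (tail G e) \<and> joined G A (head G e) w) \<or>
    (joined G A v (head G e) \<and> joined G A (tail G e) w)" (is "?L \<longleftrightarrow> ?R w")
proof
  assume L: ?L
  define S where "S = {x. ?R x}"
  have S: "x \<in> S \<longleftrightarrow> ?R x" for x by (simp add: S_def)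
  have "f \<notin> coboundary G S" if "f \<in> insert e A" for f
  proof
    assume f: "f \<in> coboundary G S"
    then have fa: "f \<in> arcs G" by (simp add: coboundary_def)
    show False
    proof (cases "f = e")
      case True
      have "tail G e \<in> S \<longleftrightarrow> head G e \<in> S"
        unfolding S using joined_refl joined_sym joined_trans by meson
      then show ?thesis using f True by (simp add: coboundary_def)
    next
      case False
      then have "joined G A (tail G f) (head G f)" "joined G A (head G f) (tail G f)"
        using that fa joined_arc joined_sym by (metis insertE)+
      then have "tail G f \<in> S \<longleftrightarrow> head G f \<in> S"
        unfolding S using joined_trans by meson
      then show ?thesis using f by (simp add: coboundary_def)
    qed
  qed
  moreover have "v \<in> S" by (simp add: S joined_refl)
  ultimately have "w \<in> S"
    using L unfolding joined_def[of G "insert e A"] by blast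
  then show "?R w" unfolding S .
next
  have J: "joined G (insert e A) (tail G e) (head G e)" "joined G (insert e A) (head G e) (tail G e)"
    using assms joined_arc joined_sym by (metis insertI1)+
  note mono = joined_mono[OF _ subset_insertI[of A e]]
  assume "?R w"
  then show ?L
  proof (elim disjE conjE)
    assume "joined G A v (tail G e)" "joined G A (head G e) w"
    then show ?L by (intro joined_trans[OF mono joined_trans[OF J(1) mono]])
  next
    assume "joined G A v (head G e)" "joined G A (tail G e) w"
    then show ?L by (intro joined_trans[OF mono joined_trans[OF J(2) mono]])
  qed (rule mono)
qed

lemma joined_singleton:
  assumes "e \<in> arcs G"
  shows "joined G {e} v w \<longleftrightarrow> v = w \<or> {v, w} = {tail G e, head G e}"
  using joined_insert[OF assms, of "{}" v w] unfolding joined_empty doubleton_eq_iff by metis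

section \<open>Counting components, one edge at a time\<close>

lemma card_image_eq_if_same_kernel:
  assumes "\<And>v w. v \<in> V \<Longrightarrow> w \<in> V \<Longrightarrow> f v = f w \<longleftrightarrow> g v = g w"
  shows "card (f ` V) = card (g ` V)"
proof -
  have "bij_betw (\<lambda>y. g (inv_into V f y)) (f ` V) (g ` V)"
  proof (rule bij_betw_imageI)
    show "inj_on (\<lambda>y. g (inv_into V f y)) (f ` V)"
      by (rule inj_onI) (metis assms f_inv_into_f inv_into_into)
    have "g (inv_into V f (f v)) = g v" if "v \<in> V" for v
      using assms that by (metis f_inv_into_f imageI inv_into_into)
    then show "(\<lambda>y. g (inv_into V f y)) ` f ` V = g ` V"
      by (auto simp: image_image)
  qed
  then show ?thesis by (rule bij_betw_same_card)
qed

text \<open>Component maps for different edge sets have different values, so only their kernels are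
  compared. If \<open>e\<close> links two components, the relabelling \<open>g\<close>, which gives
  the component of the head the name of the component of the tail, has the kernel of the larger edge
  set and loses exactly one value.\<close>

lemma num_components_insert:
  assumes "fin_digraph G" "A \<subseteq> arcs G" "e \<in> arcs G"
  shows "num_components G A =
    num_components G (insert e A) + (if joined G A (tail G e) (head G e) then 0 else 1)"
proof -
  interpret fin_digraph G by fact
  note wf = wf_digraph_axioms
  have A': "insert e A \<subseteq> arcs G" using assms by simp
  let ?t = "tail G e" and ?h = "head G e"
  have th: "?t \<in> verts G" "?h \<in> verts G" using assms by simp_all
  show ?thesis
  proof (cases "joined G A ?t ?h")
    case True
    then have "joined G (insert e A) v w \<longleftrightarrow> joined G A v w" for v w
      using joined_insert[OF assms(3)] joined_sym joined_trans by meson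
    then have "num_components G A = num_components G (insert e A)"
      unfolding num_components_def
      by (intro card_image_eq_if_same_kernel)
        (simp add: component_of_eq_iff[OF wf assms(2)] component_of_eq_iff[OF wf A'])
    then show ?thesis using True by simp
  next
    case False
    let ?c = "component_of G A"
    define g where "g v = (if joined G A v ?h then ?c ?t else ?c v)" for v
    have *: "?c v = ?c w \<longleftrightarrow> joined G A v w" if "v \<in> verts G" "w \<in> verts G" for v w
      using component_of_eq_iff[OF wf assms(2)] that .
    have "num_components G (insert e A) = card (g ` verts G)"
      unfolding num_components_def
    proof (rule card_image_eq_if_same_kernel)
      fix v w assume vw: "v \<in> verts G" "w \<in> verts G"
      have "g v = g w \<longleftrightarrow> joined G A v w \<or>
        (joined G A v ?t \<and> joined G A ?h w) \<or> (joined G A v ?h \<and> joined G A ?t w)"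
        unfolding g_def using * vw th False
        by (auto intro: joined_sym joined_trans)
      then show "component_of G (insert e A) v = component_of G (insert e A) w \<longleftrightarrow> g v = g w"
        unfolding component_of_eq_iff[OF wf A' vw] joined_insert[OF assms(3)] by simp
    qed
    also have "g ` verts G = ?c ` verts G - {?c ?h}"
    proof (intro equalityI subsetI)
      fix y assume "y \<in> g ` verts G"
      then obtain v where v: "v \<in> verts G" "y = g v" by blast
      then show "y \<in> ?c ` verts G - {?c ?h}"
        using * th False by (auto simp: g_def)
    next
      fix y assume "y \<in> ?c ` verts G - {?c ?h}"
      then obtain v where v: "v \<in> verts G" "y = ?c v" "?c v \<noteq> ?c ?h" by blast
      then have "y = g v" using * th by (auto simp: g_def)
      then show "y \<in> g ` verts G" using v by blast
    qed
    also have "card (?c ` verts G - {?c ?h}) = card (?c ` verts G) - 1"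
      using th by simp
    finally have "num_components G (insert e A) = num_components G A - 1"
      by (simp add: num_components_def)
    moreover have "num_components G A > 0"
      using th by (auto simp: num_components_def card_gt_0_iff)
    ultimately show ?thesis using False by simp
  qed
qed

lemma num_components_empty:
  assumes "fin_digraph G"
  shows "num_components G {} = card (verts G)"
proof -
  interpret fin_digraph G by fact
  have "inj_on (component_of G {}) (verts G)"
    using component_of_eq_iff[OF wf_digraph_axioms empty_subsetI] by (simp add: inj_on_def joined_empty)
  then show ?thesis by (simp add: num_components_def card_image)
qed

text \<open>Each edge removes at most one component. It follows that the truncated exponent of the
  inner variable in \<open>Tutte_polynomial\<close> is a true difference.\<close>

lemma card_verts_le_num_components:
  assumes "fin_digraph G" "A \<subseteq> arcs G"
  shows "card (verts G) \<le> num_components G A + card A"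
proof -
  interpret fin_digraph G by fact
  have "finite A" using assms(2) finite_arcs finite_subset by blast
  then show ?thesis using assms(2)
  proof (induction A)
    case empty
    then show ?case by (simp add: num_components_empty[OF assms(1)])
  next
    case (insert e A)
    then show ?case using num_components_insert[OF assms(1), of A e] by (auto split: if_splits)
  qed
qed

lemma num_components_arcs:
  assumes "wf_digraph G" "Digraph_Component.connected G"
  shows "num_components G (arcs G) = 1"
proof -
  obtain v where v: "v \<in> verts G" using connected_iff_joined[OF assms(1)] assms(2) by blast
  have "component_of G (arcs G) w = component_of G (arcs G) v" if "w \<in> verts G" for w
    using component_of_eq_iff[OF assms(1) order_refl that v] connected_iff_joined[OF assms(1)]
      assms(2) that v by blast
  then have "component_of G (arcs G) ` verts G = (\<lambda>_. component_of G (arcs G) v) ` verts G"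
    by (intro image_cong refl)
  also have "\<dots> = {component_of G (arcs G) v}" using v by auto
  finally have "component_of G (arcs G) ` verts G = {component_of G (arcs G) v}" .
  then show ?thesis by (simp add: num_components_def)
qed

lemma num_components_pos:
  assumes "fin_digraph G" "verts G \<noteq> {}"
  shows "num_components G A > 0"
  using assms by (simp add: num_components_def card_gt_0_iff fin_digraph.finite_verts)

section \<open>Contraction of an edge set\<close>

lemma representative:
  assumes "wf_digraph G" "A \<subseteq> arcs G" "v \<in> verts G"
  shows "representative G A v \<in> verts G" "joined G A v (representative G A v)"
proof -
  have "v \<in> component_of G A v"
    by (simp add: component_of_iff[OF assms(1,2)] assms(3) joined_refl)
  then have "representative G A v \<in> component_of G A v"
    unfolding representative_def by (rule someI)
  then show "representative G A v \<in> verts G" "joined G A v (representative G A v)"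
    by (simp_all add: component_of_iff[OF assms(1,2)])
qed

lemma representative_eq_iff:
  assumes "wf_digraph G" "A \<subseteq> arcs G" "v \<in> verts G" "w \<in> verts G"
  shows "representative G A v = representative G A w \<longleftrightarrow> joined G A v w"
proof
  assume "representative G A v = representative G A w"
  then show "joined G A v w"
    using joined_trans[OF representative(2)[OF assms(1,2,3)], of w]
      joined_sym[OF representative(2)[OF assms(1,2,4)]] by simp
next
  assume "joined G A v w"
  then show "representative G A v = representative G A w"
    using component_of_eq_iff[OF assms] by (simp add: representative_def)
qed

lemma contract_simps [simp]:
  "verts (contract G A) = representative G A ` verts G"
  "arcs (contract G A) = arcs G - A"
  "tail (contract G A) e = representative G A (tail G e)"
  "head (contract G A) e = representative G A (head G e)"
  by (simp_all add: contract_def)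

lemma coboundary_contract:
  "coboundary (contract G A) U = coboundary G {v. representative G A v \<in> U} - A"
  by (auto simp: coboundary_def)

lemma coboundary_preimage_representative:
  assumes "wf_digraph G" "A \<subseteq> arcs G"
  shows "coboundary G {v. representative G A v \<in> U} \<inter> A = {}"
proof -
  have "representative G A (tail G e) = representative G A (head G e)" if "e \<in> A" for e
    using that assms representative_eq_iff[OF assms] joined_arc[OF that]
    by (metis subsetD wf_digraph.head_in_verts wf_digraph.tail_in_verts)
  then show ?thesis by (auto simp: coboundary_def)
qed

lemma fin_digraph_contract: "fin_digraph G \<Longrightarrow> fin_digraph (contract G A)"
  by (auto simp: fin_digraph_def fin_digraph_axioms_def wf_digraph_def)

text \<open>Sets whose coboundary avoids \<open>A\<close> are, on the vertices, unions of components
  of \<open>A\<close>. They correspond by image and preimage under \<open>representative G A\<close>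
  to the vertex sets of the contraction, with the same edges of \<open>B\<close> in the
  coboundary.\<close>

lemma joined_contract:
  assumes "wf_digraph G" "A \<subseteq> arcs G" "B \<subseteq> arcs G - A" "v \<in> verts G" "w \<in> verts G"
  shows "joined (contract G A) B (representative G A v) (representative G A w) \<longleftrightarrow>
    joined G (A \<union> B) v w"
proof
  assume L: "joined (contract G A) B (representative G A v) (representative G A w)"
  show "joined G (A \<union> B) v w"
    unfolding joined_def
  proof (intro allI impI, elim conjE)
    fix U assume vU: "v \<in> U" and U: "coboundary G U \<inter> (A \<union> B) = {}"
    let ?p = "\<lambda>x. representative G A x \<in> representative G A ` (U \<inter> verts G)"
    have eq: "?p x \<longleftrightarrow> x \<in> U" if "x \<in> verts G" for x
    proof
      assume "?p x"
      then obtain y where y: "y \<in> U" "y \<in> verts G" "representative G A x = representative G A y"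
        by blast
      then have "joined G A y x"
        using representative_eq_iff[OF assms(1,2)] that by metis
      then show "x \<in> U" using y(1) U unfolding joined_def by blast
    qed (use that in blast)
    have "?p (tail G f) = (tail G f \<in> U)" "?p (head G f) = (head G f \<in> U)" if "f \<in> B" for f
      using eq that assms(1,3) by (simp_all add: subset_iff wf_digraph_def)
    then have "coboundary (contract G A) (representative G A ` (U \<inter> verts G)) \<inter> B = {}"
      using U assms(3) unfolding coboundary_def contract_simps by blast
    moreover have "?p v" using vU assms(4) by blast
    ultimately have "?p w"
      by (rule joinedD[OF L, rotated])
    then show "w \<in> U" using eq[OF assms(5)] by blast
  qed
next
  assume R: "joined G (A \<union> B) v w"
  show "joined (contract G A) B (representative G A v) (representative G A w)"
    unfolding joined_def
  proof (intro allI impI, elim conjE)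
    fix U assume vU: "representative G A v \<in> U" and U: "coboundary (contract G A) U \<inter> B = {}"
    then have "coboundary G {x. representative G A x \<in> U} \<inter> (A \<union> B) = {}"
      using coboundary_preimage_representative[OF assms(1,2)] assms(3)
      unfolding coboundary_contract by blast
    then have "w \<in> {x. representative G A x \<in> U}"
      using vU by (intro joinedD[OF R, of "{x. representative G A x \<in> U}"]) simp_all
    then show "representative G A w \<in> U" by simp
  qed
qed

lemma connected_contract:
  assumes "wf_digraph G" "A \<subseteq> arcs G" "Digraph_Component.connected G"
  shows "Digraph_Component.connected (contract G A)"
proof -
  have "wf_digraph (contract G A)"
    using assms(1) by (auto simp: wf_digraph_def)
  moreover have "joined (contract G A) (arcs G - A) (representative G A v) (representative G A w)"
    if "v \<in> verts G" "w \<in> verts G" for v w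
    using assms connected_iff_joined[OF assms(1)] that joined_contract[OF assms(1,2) order_refl that]
    by (simp add: Un_absorb1)
  ultimately show ?thesis
    using assms(3) connected_iff_joined[OF assms(1)] by (simp add: connected_iff_joined)
qed

lemma num_components_contract:
  assumes "wf_digraph G" "A \<subseteq> arcs G" "B \<subseteq> arcs G - A"
  shows "num_components (contract G A) B = num_components G (A \<union> B)"
proof -
  have wf: "wf_digraph (contract G A)" using assms(1) by (auto simp: wf_digraph_def)
  have B: "B \<subseteq> arcs (contract G A)" "A \<union> B \<subseteq> arcs G" using assms by auto
  show ?thesis
    unfolding num_components_def contract_simps image_image
    by (rule card_image_eq_if_same_kernel)
      (simp add: component_of_eq_iff[OF wf B(1)] component_of_eq_iff[OF assms(1) B(2)]
        joined_contract[OF assms])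
qed

lemma card_verts_contract:
  assumes "fin_digraph G" "A \<subseteq> arcs G"
  shows "card (verts (contract G A)) = num_components G A"
  using num_components_contract[of G A "{}"] num_components_empty[OF fin_digraph_contract[OF assms(1), of A]] assms
  unfolding fin_digraph_def by simp

section \<open>Deletion of one edge\<close>

lemma coboundary_del_arc: "coboundary (pre_digraph.del_arc G e) U = coboundary G U - {e}"
  by (auto simp: coboundary_def pre_digraph.del_arc_simps)

lemma joined_del_arc: "e \<notin> A \<Longrightarrow> joined (pre_digraph.del_arc G e) A v w \<longleftrightarrow> joined G A v w"
  by (simp add: joined_def coboundary_del_arc Int_Diff Diff_Int_distrib2)

lemma fin_digraph_del_arc: "fin_digraph G \<Longrightarrow> fin_digraph (pre_digraph.del_arc G e)"
  by (auto simp: fin_digraph_def fin_digraph_axioms_def wf_digraph_def pre_digraph.del_arc_simps)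

lemma num_components_del_arc:
  assumes "wf_digraph G" "A \<subseteq> arcs G - {e}"
  shows "num_components (pre_digraph.del_arc G e) A = num_components G A"
proof -
  have "component_of (pre_digraph.del_arc G e) A = component_of G A"
    by (simp add: fun_eq_iff component_of_def pre_digraph.del_arc_def mk_symmetric_def)
  then show ?thesis by (simp add: num_components_def pre_digraph.del_arc_simps)
qed

section \<open>Cuts and isthmuses as coboundaries\<close>

lemma is_cut_iff:
  "is_cut G Cu \<longleftrightarrow> (\<exists>U. U \<subset> verts G \<and> U \<noteq> {} \<and> Cu = {U, verts G - U})"
proof
  assume "is_cut G Cu"
  then obtain U W where "Cu = {U, W}" "U \<noteq> W" "partition_on (verts G) {U, W}"
    unfolding is_cut_def card_2_iff by blast
  moreover from this have "U \<union> W = verts G" "U \<inter> W = {}" "U \<noteq> {}" "W \<noteq> {}"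
    by (auto simp: partition_on_def disjoint_def)
  ultimately show "\<exists>U. U \<subset> verts G \<and> U \<noteq> {} \<and> Cu = {U, verts G - U}"
    by (intro exI[of _ U]) auto
next
  assume "\<exists>U. U \<subset> verts G \<and> U \<noteq> {} \<and> Cu = {U, verts G - U}"
  then obtain U where U: "U \<subset> verts G" "U \<noteq> {}" "Cu = {U, verts G - U}" by blast
  then have "U \<noteq> verts G - U" by blast
  then show "is_cut G Cu"
    using U by (auto simp: is_cut_def partition_on_def disjoint_def card_2_iff)
qed

lemma cut_edges_eq_coboundary:
  assumes "wf_digraph G" "U \<subseteq> verts G"
  shows "cut_edges G {U, verts G - U} = coboundary G U"
proof (rule set_eqI)
  fix e
  show "e \<in> cut_edges G {U, verts G - U} \<longleftrightarrow> e \<in> coboundary G U"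
    using assms(2) wf_digraph.tail_in_verts[OF assms(1), of e] wf_digraph.head_in_verts[OF assms(1), of e]
    unfolding cut_edges_def coboundary_def mem_Collect_eq bex_simps by blast
qed

lemma isthmus_iff:
  assumes "wf_digraph G"
  shows "isthmus G e \<longleftrightarrow> (\<exists>U \<subset> verts G. U \<noteq> {} \<and> coboundary G U = {e})"
proof -
  have "cut_edges G {U, verts G - U} = coboundary G U" if "U \<subset> verts G" for U
    using cut_edges_eq_coboundary[OF assms] that by blast
  then show ?thesis
    unfolding isthmus_def is_cut_iff by (intro iffI; elim exE conjE; metis)
qed

lemma connected_del_arc:
  assumes "wf_digraph G" "Digraph_Component.connected G" "\<not> isthmus G e"
  shows "Digraph_Component.connected (pre_digraph.del_arc G e)"
proof -
  have "wf_digraph (pre_digraph.del_arc G e)"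
    using assms(1) by (auto simp: wf_digraph_def pre_digraph.del_arc_simps)
  moreover have "coboundary (pre_digraph.del_arc G e) U \<noteq> {}" if "U \<subset> verts G" "U \<noteq> {}" for U
    using assms(2,3) that isthmus_iff[OF assms(1)] connected_iff_coboundary[OF assms(1)]
    unfolding coboundary_del_arc by (metis Diff_eq_empty_iff subset_singletonD)
  ultimately show ?thesis
    using assms(2) by (simp add: connected_iff_coboundary assms(1) pre_digraph.del_arc_simps)
qed

lemma isthmus_not_loop:
  assumes "wf_digraph G" "isthmus G e"
  shows "\<not> loop G e" "e \<in> arcs G"
proof -
  obtain U where "coboundary G U = {e}" using assms(2) isthmus_iff[OF assms(1)] by metis
  then have "e \<in> coboundary G U" by simp
  then show "\<not> loop G e" "e \<in> arcs G" by (auto simp: coboundary_def loop_def)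
qed

section \<open>Deletion and contraction for the Tutte polynomial\<close>

lemma sum_Pow_insert:
  assumes "finite A" "e \<notin> A"
  shows "sum f (Pow (insert e A)) = (\<Sum>B\<in>Pow A. f B + f (insert e B))"
proof -
  have "inj_on (insert e) (Pow A)"
    using assms(2) by (intro inj_onI) (metis Diff_insert_absorb PowD subsetD)
  moreover have "Pow A \<inter> insert e ` Pow A = {}"
    using assms(2) by auto
  ultimately show ?thesis
    using assms(1) by (simp add: Pow_insert sum.union_disjoint sum.reindex sum.distrib)
qed

section \<open>Induction over minors\<close>

definition ordinary_arc :: "('v, 'e) pre_digraph \<Rightarrow> 'e \<Rightarrow> bool" where
  "ordinary_arc G e \<longleftrightarrow> e \<in> arcs G \<and> \<not> isthmus G e \<and> \<not> loop G e"

lemma ordered_oriented_graphD: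
  assumes "ordered_oriented_graph G r"
  shows "fin_digraph G" "wf_digraph G" "Digraph_Component.connected G" "finite (arcs G)" "finite (verts G)"
  using assms fin_digraph.finite_arcs fin_digraph.finite_verts
  by (auto simp: ordered_oriented_graph_def fin_digraph_def)

lemma ordered_oriented_graph_induced:
  assumes "ordered_oriented_graph G r" "fin_digraph H" "Digraph_Component.connected H" "arcs H \<subseteq> arcs G"
  shows "ordered_oriented_graph H (induced_order H r)"
proof -
  have "trans (induced_order H r)"
    using assms(1) by (auto simp: induced_order_def ordered_oriented_graph_def intro!: trans_Restr)
  then show ?thesis
    using assms unfolding ordered_oriented_graph_def induced_order_def irrefl_def total_on_def
    by blast
qed

lemma ordered_oriented_graph_contract:
  assumes "ordered_oriented_graph G r" "A \<subseteq> arcs G"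
  shows "ordered_oriented_graph (contract G A) (induced_order (contract G A) r)"
  using ordered_oriented_graphD[OF assms(1)] assms
  by (intro ordered_oriented_graph_induced[OF assms(1)] fin_digraph_contract connected_contract) auto

lemma ordered_oriented_graph_del_arc:
  assumes "ordered_oriented_graph G r" "\<not> isthmus G e"
  shows "ordered_oriented_graph (pre_digraph.del_arc G e) (induced_order (pre_digraph.del_arc G e) r)"
  using ordered_oriented_graphD[OF assms(1)] assms
  by (intro ordered_oriented_graph_induced[OF assms(1)] fin_digraph_del_arc connected_del_arc)
    (auto simp: pre_digraph.del_arc_simps)

lemma maximum_edge_exists:
  assumes "ordered_oriented_graph G r" "arcs G \<noteq> {}"
  shows "\<exists>e. maximum_edge G r e"
proof -
  have "finite A \<Longrightarrow> A \<noteq> {} \<Longrightarrow> A \<subseteq> arcs G \<Longrightarrow> \<exists>e\<in>A. \<forall>e'\<in>A. e' \<noteq> e \<longrightarrow> (e', e) \<in> r" for A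
  proof (induction A rule: finite_ne_induct)
    case (insert f A)
    then obtain e where e: "e \<in> A" "\<forall>e'\<in>A. e' \<noteq> e \<longrightarrow> (e', e) \<in> r" by auto
    have "(e, f) \<in> r \<or> (f, e) \<in> r"
      using assms(1) insert.prems e(1) insert.hyps
      by (auto simp: ordered_oriented_graph_def total_on_def)
    moreover have "trans r" using assms(1) by (simp add: ordered_oriented_graph_def)
    ultimately show ?case
      using e by (metis insert_iff transD)
  qed simp
  from this[OF ordered_oriented_graphD(4)[OF assms(1)] assms(2)] show ?thesis
    unfolding maximum_edge_def by blast
qed

text \<open>Serves both the degree bounds of the Tutte polynomial and the weighted count. An isthmus
  is only contracted, since deleting it would disconnect the graph, and a loop only deleted.
  Maximality of \<open>e\<close> is handed to the ordinary case, where T2 is applied.\<close>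

lemma minor_induct [consumes 1, case_names empty isthmus loop ordinary]:
  assumes "ordered_oriented_graph G r"
    and empty: "\<And>G r. ordered_oriented_graph G r \<Longrightarrow> arcs G = {} \<Longrightarrow> \<Phi> G r"
    and isthmus: "\<And>G r e. ordered_oriented_graph G r \<Longrightarrow> isthmus G e \<Longrightarrow>
      \<Phi> (contract G {e}) (induced_order (contract G {e}) r) \<Longrightarrow> \<Phi> G r"
    and loop: "\<And>G r e. ordered_oriented_graph G r \<Longrightarrow> loop G e \<Longrightarrow>
      \<Phi> (pre_digraph.del_arc G e) (induced_order (pre_digraph.del_arc G e) r) \<Longrightarrow> \<Phi> G r"
    and ordinary: "\<And>G r e. ordered_oriented_graph G r \<Longrightarrow> ordinary_arc G e \<Longrightarrow> maximum_edge G r e \<Longrightarrow>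
      \<Phi> (contract G {e}) (induced_order (contract G {e}) r) \<Longrightarrow>
      \<Phi> (pre_digraph.del_arc G e) (induced_order (pre_digraph.del_arc G e) r) \<Longrightarrow> \<Phi> G r"
  shows "\<Phi> G r"
  using assms(1)
proof (induction "card (arcs G)" arbitrary: G r rule: less_induct)
  case less
  note G = ordered_oriented_graphD[OF less.prems]
  show ?case
  proof (cases "arcs G = {}")
    case True
    then show ?thesis using empty less.prems by blast
  next
    case False
    then obtain e where e: "maximum_edge G r e"
      using maximum_edge_exists[OF less.prems] by blast
    then have eG: "e \<in> arcs G" by (simp add: maximum_edge_def)
    have card: "card (arcs G - {e}) < card (arcs G)"
      using eG G(4) by (simp add: card_gt_0_iff False)
    have contr: "\<Phi> (contract G {e}) (induced_order (contract G {e}) r)"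
      using card eG by (intro less.hyps ordered_oriented_graph_contract[OF less.prems]) simp_all
    have del: "\<Phi> (pre_digraph.del_arc G e) (induced_order (pre_digraph.del_arc G e) r)"
      if "\<not> isthmus G e"
      using card by (intro less.hyps ordered_oriented_graph_del_arc[OF less.prems that])
        (simp add: pre_digraph.del_arc_simps)
    consider "isthmus G e" | "loop G e" "\<not> isthmus G e" | "ordinary_arc G e"
      using eG by (auto simp: ordinary_arc_def)
    then show ?thesis
      using isthmus[OF less.prems] loop[OF less.prems] ordinary[OF less.prems _ e] contr del
      by cases (auto simp: ordinary_arc_def)
  qed
qed

section \<open>The subset expansion and its recursion\<close>

lemma card_verts_contract_arc:
  assumes "fin_digraph G" "e \<in> arcs G" "\<not> loop G e"
  shows "card (verts G) = Suc (card (verts (contract G {e})))"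
proof -
  have "\<not> joined G {} (tail G e) (head G e)"
    using assms by (simp add: joined_empty loop_def)
  then show ?thesis
    using num_components_insert[OF assms(1) empty_subsetI assms(2)] assms
    by (simp add: num_components_empty card_verts_contract[OF assms(1)] del: contract_simps)
qed

lemma Tutte_polynomial_connected:
  assumes "fin_digraph G" "Digraph_Component.connected G"
  shows "Tutte_polynomial G =
     (\<Sum>A\<in>Pow (arcs G). (monom 1 1 - 1) ^ (num_components G A - 1) *
        ([:monom 1 1:] - 1) ^ (num_components G A + card A - card (verts G)))"
  using assms by (simp add: Tutte_polynomial_def num_components_arcs fin_digraph_def)

lemma Tutte_polynomial_no_arcs:
  assumes "ordered_oriented_graph G r" "arcs G = {}"
  shows "Tutte_polynomial G = 1" "card (verts G) = 1"
proof -
  note G = ordered_oriented_graphD[OF assms(1)]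
  show "card (verts G) = 1"
    using num_components_arcs[OF G(2,3)] num_components_empty[OF G(1)] assms(2) by simp
  then show "Tutte_polynomial G = 1"
    using num_components_empty[OF G(1)] assms(2) by (simp add: Tutte_polynomial_def)
qed

text \<open>Each \<open>A\<close> avoiding \<open>e\<close> is paired with
  \<open>insert e A\<close>. The first terms of the pairs make up the expansion of the deletion and
  the second terms that of the contraction, whenever these minors are admissible.\<close>

lemma Tutte_polynomial_split:
  assumes "ordered_oriented_graph G r" "e \<in> arcs G"
  shows "Tutte_polynomial G =
     (\<Sum>A\<in>Pow (arcs G - {e}).
        (monom 1 1 - 1) ^ (num_components G A - 1) *
        ([:monom 1 1:] - 1) ^ (num_components G A + card A - card (verts G)) +
        (monom 1 1 - 1) ^ (num_components G (insert e A) - 1) *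
        ([:monom 1 1:] - 1) ^ (num_components G (insert e A) + Suc (card A) - card (verts G)))"
proof -
  note G = ordered_oriented_graphD[OF assms(1)]
  have arcs: "arcs G = insert e (arcs G - {e})" using assms(2) by blast
  have "card (insert e A) = Suc (card A)" if "A \<in> Pow (arcs G - {e})" for A
    using that G(4) finite_subset[of A "arcs G - {e}"] by (subst card_insert_disjoint) auto
  then show ?thesis
    unfolding Tutte_polynomial_connected[OF G(1,3)]
    by (subst arcs, subst sum_Pow_insert) (simp_all add: G(4))
qed

text \<open>Contraction lowers the number of vertices by one while \<open>insert e A\<close> has one
  edge more than \<open>A\<close>; the two changes cancel in the exponent of the inner
  variable.\<close>

lemma Tutte_polynomial_contract_arc:
  assumes "ordered_oriented_graph G r" "e \<in> arcs G" "\<not> loop G e"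
  shows "Tutte_polynomial (contract G {e}) =
     (\<Sum>A\<in>Pow (arcs G - {e}).
        (monom 1 1 - 1) ^ (num_components G (insert e A) - 1) *
        ([:monom 1 1:] - 1) ^ (num_components G (insert e A) + Suc (card A) - card (verts G)))"
proof -
  note G = ordered_oriented_graphD[OF assms(1)]
  note H = ordered_oriented_graphD[OF ordered_oriented_graph_contract[OF assms(1), of "{e}"]]
  have n: "card (verts G) = Suc (card (verts (contract G {e})))"
    using card_verts_contract_arc[OF G(1) assms(2,3)] .
  show ?thesis
    unfolding Tutte_polynomial_connected[OF H(1,3)[simplified, OF assms(2)]] n
    by (simp add: num_components_contract[OF G(2)] assms(2))
qed

lemma Tutte_polynomial_del_arc:
  assumes "ordered_oriented_graph G r" "\<not> isthmus G e"
  shows "Tutte_polynomial (pre_digraph.del_arc G e) =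
     (\<Sum>A\<in>Pow (arcs G - {e}).
        (monom 1 1 - 1) ^ (num_components G A - 1) *
        ([:monom 1 1:] - 1) ^ (num_components G A + card A - card (verts G)))"
proof -
  note G = ordered_oriented_graphD[OF assms(1)]
  note H = ordered_oriented_graphD[OF ordered_oriented_graph_del_arc[OF assms]]
  show ?thesis
    unfolding Tutte_polynomial_connected[OF H(1,3)]
    by (simp add: num_components_del_arc[OF G(2)] pre_digraph.del_arc_simps)
qed

lemma Tutte_polynomial_ordinary:
  assumes "ordered_oriented_graph G r" "ordinary_arc G e"
  shows "Tutte_polynomial G = Tutte_polynomial (contract G {e}) + Tutte_polynomial (pre_digraph.del_arc G e)"
proof -
  have e: "e \<in> arcs G" "\<not> isthmus G e" "\<not> loop G e" using assms(2) by (simp_all add: ordinary_arc_def)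
  show ?thesis
    unfolding Tutte_polynomial_split[OF assms(1) e(1)] Tutte_polynomial_contract_arc[OF assms(1) e(1,3)]
      Tutte_polynomial_del_arc[OF assms(1) e(2)] sum.distrib by (rule add.commute)
qed

text \<open>The cut {e} separates the ends of \<open>e\<close> in every \<open>A\<close> avoiding
  \<open>e\<close>, so removing \<open>e\<close> adds a component and keeps the exponent of the
  inner variable. A pair contributes (x - 1) t + t = x t, where t is its term containing
  \<open>e\<close>.\<close>

lemma Tutte_polynomial_isthmus:
  assumes "ordered_oriented_graph G r" "isthmus G e"
  shows "Tutte_polynomial G = monom 1 1 * Tutte_polynomial (contract G {e})"
proof -
  note G = ordered_oriented_graphD[OF assms(1)]
  note e = isthmus_not_loop[OF G(2) assms(2)]
  obtain U where U: "U \<subset> verts G" "coboundary G U = {e}"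
    using assms(2) isthmus_iff[OF G(2)] by metis
  have nj: "\<not> joined G A (tail G e) (head G e)" if "A \<subseteq> arcs G - {e}" for A
  proof -
    have disj: "coboundary G U \<inter> A = {}" "coboundary G (- U) \<inter> A = {}"
      using that U(2) by (auto simp: coboundary_Compl)
    have "e \<in> coboundary G U" using U(2) by simp
    then show ?thesis
      using joinedD[OF _ _ disj(1), of "tail G e" "head G e"]
        joinedD[OF _ _ disj(2), of "tail G e" "head G e"] by (auto simp: coboundary_def)
  qed
  have *: "num_components G A = Suc (num_components G (insert e A))"
    "num_components G (insert e A) > 0" if "A \<subseteq> arcs G - {e}" for A
    using num_components_insert[OF G(1), of A e] that nj[OF that] e(2)
      num_components_pos[OF G(1)] connected_iff_joined[OF G(2)] G(3) by auto
  have pow: "(x - 1) ^ (Suc n - 1) * y + (x - 1) ^ (n - 1) * y = x * ((x - 1) ^ (n - 1) * y)" if "n > 0"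
    for x y :: "int poly poly" and n
    using that by (cases n) (simp_all add: algebra_simps)
  show ?thesis
    unfolding Tutte_polynomial_split[OF assms(1) e(2)] Tutte_polynomial_contract_arc[OF assms(1) e(2,1)]
      sum_distrib_left
    by (intro sum.cong refl) (simp only: * pow Pow_iff add_Suc add_Suc_right)
qed

text \<open>A loop changes no component, so adding it raises only the exponent of the inner
  variable, by one. A pair contributes t + (y - 1) t = y t, where t is its term without
  \<open>e\<close>.\<close>

lemma Tutte_polynomial_loop:
  assumes "ordered_oriented_graph G r" "loop G e"
  shows "Tutte_polynomial G = [:monom 1 1:] * Tutte_polynomial (pre_digraph.del_arc G e)"
proof -
  note G = ordered_oriented_graphD[OF assms(1)]
  have e: "e \<in> arcs G" "tail G e = head G e" "\<not> isthmus G e"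
    using assms(2) isthmus_not_loop[OF G(2)] by (auto simp: loop_def)
  have *: "num_components G (insert e A) = num_components G A"
    "num_components G A + Suc (card A) - card (verts G) = Suc (num_components G A + card A - card (verts G))"
    if "A \<subseteq> arcs G - {e}" for A
  proof -
    have "A \<subseteq> arcs G" using that by blast
    then show "num_components G (insert e A) = num_components G A"
      "num_components G A + Suc (card A) - card (verts G) = Suc (num_components G A + card A - card (verts G))"
      using num_components_insert[OF G(1), of A e] card_verts_le_num_components[OF G(1), of A] e
      by (simp_all add: joined_refl)
  qed
  have pow: "x * y ^ n + x * y ^ Suc n = (y + 1) * (x * y ^ n)"
    for x y :: "int poly poly" and n
    by (simp add: algebra_simps)
  have one: "z - 1 + 1 = z" for z :: "int poly poly" by simp
  show ?thesis
    unfolding Tutte_polynomial_split[OF assms(1) e(1)] Tutte_polynomial_del_arc[OF assms(1) e(3)]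
      sum_distrib_left
    by (intro sum.cong refl) (simp only: * pow one Pow_iff)
qed

text \<open>\<open>eval2_cleared\<close> would drop every term above its bounds, so the exponents
  used for clearing must bound the degrees. The inequality between vertices and edges is carried
  along because the cyclomatic number is written with truncated subtraction.\<close>

lemma Tutte_polynomial_degrees:
  assumes "ordered_oriented_graph G r"
  shows "card (verts G) \<le> card (arcs G) + 1"
    and "degree (Tutte_polynomial G) \<le> card (verts G) - 1"
    and "degree (coeff (Tutte_polynomial G) i) \<le> card (arcs G) + 1 - card (verts G)"
proof -
  have "card (verts G) \<le> card (arcs G) + 1 \<and> degree (Tutte_polynomial G) \<le> card (verts G) - 1 \<and>
    (\<forall>i. degree (coeff (Tutte_polynomial G) i) \<le> card (arcs G) + 1 - card (verts G))"
    using assms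
  proof (induction rule: minor_induct)
    case (empty G r)
    then show ?case
      using Tutte_polynomial_no_arcs[OF empty] by simp
  next
    case (isthmus G r e)
    note G = ordered_oriented_graphD[OF isthmus(1)]
    note H = ordered_oriented_graphD[OF ordered_oriented_graph_contract[OF isthmus(1), of "{e}"]]
    note e = isthmus_not_loop[OF G(2) isthmus(2)]
    note n = card_verts_contract_arc[OF G(1) e(2,1)]
    have arcs: "card (arcs G) = Suc (card (arcs (contract G {e})))"
      using card_Suc_Diff1[OF G(4) e(2)] by simp
    have "degree (monom 1 1 * Tutte_polynomial (contract G {e})) \<le> 1 + degree (Tutte_polynomial (contract G {e}))"
      by (rule order_trans[OF degree_mult_le]) (simp add: degree_monom_eq)
    moreover have "card (verts (contract G {e})) > 0"
      using H(3,5) e(2) connected_iff_joined[OF H(2)] by (simp add: card_gt_0_iff)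
    ultimately show ?case
      using isthmus(3) unfolding Tutte_polynomial_isthmus[OF isthmus(1,2)] n arcs
      by (auto simp: coeff_monom_mult simp del: contract_simps)
  next
    case (loop G r e)
    note G = ordered_oriented_graphD[OF loop(1)]
    have e: "e \<in> arcs G" using loop(2) by (simp add: loop_def)
    have arcs: "card (arcs G) = Suc (card (arcs (pre_digraph.del_arc G e)))"
      using card_Suc_Diff1[OF G(4) e] by (simp add: pre_digraph.del_arc_simps)
    have n: "card (verts G) = card (verts (pre_digraph.del_arc G e))"
      by (simp add: pre_digraph.del_arc_simps)
    let ?T = "Tutte_polynomial (pre_digraph.del_arc G e)"
    have "degree (monom 1 1 * coeff ?T i) \<le> 1 + degree (coeff ?T i)" for i
      by (rule order_trans[OF degree_mult_le]) (simp add: degree_monom_eq)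
    moreover have "degree (smult (monom 1 1) ?T) \<le> degree ?T" by (rule degree_smult_le)
    ultimately show ?case
      using loop(3) unfolding Tutte_polynomial_loop[OF loop(1,2)] n arcs
      by (auto simp: Suc_diff_le intro: order_trans)
  next
    case (ordinary G r e)
    note G = ordered_oriented_graphD[OF ordinary(1)]
    have e: "e \<in> arcs G" "\<not> loop G e" using ordinary(2) by (simp_all add: ordinary_arc_def)
    note n = card_verts_contract_arc[OF G(1) e]
    have n': "card (verts (pre_digraph.del_arc G e)) = card (verts G)"
      by (simp add: pre_digraph.del_arc_simps)
    have arcs: "card (arcs (contract G {e})) = card (arcs G) - 1"
      "card (arcs (pre_digraph.del_arc G e)) = card (arcs G) - 1" "card (arcs G) > 0"
      using G(4) e by (auto simp: pre_digraph.del_arc_simps card_gt_0_iff)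
    have "degree (coeff (Tutte_polynomial (pre_digraph.del_arc G e)) i) \<le> card (arcs G) + 1 - card (verts G)" for i
    proof -
      have "degree (coeff (Tutte_polynomial (pre_digraph.del_arc G e)) i) \<le> card (arcs G) - 1 + 1 - card (verts G)"
        using ordinary(5) unfolding arcs(1,2) n' by blast
      then show ?thesis by simp
    qed
    then show ?case
      using ordinary(4,5) unfolding Tutte_polynomial_ordinary[OF ordinary(1,2)] arcs(1,2) n'
      using n arcs(3) by (auto intro!: degree_add_le)
  qed
  then show "card (verts G) \<le> card (arcs G) + 1"
    and "degree (Tutte_polynomial G) \<le> card (verts G) - 1"
    and "degree (coeff (Tutte_polynomial G) i) \<le> card (arcs G) + 1 - card (verts G)"
    by blast+
qed

section \<open>Evaluation with cleared denominators\<close>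

lemma eval2_cleared_add:
  "eval2_cleared a b (S + T) x z y w = eval2_cleared a b S x z y w + eval2_cleared a b T x z y w"
  by (simp add: eval2_cleared_def sum.distrib ring_distribs)

lemma eval2_cleared_1: "eval2_cleared 0 0 1 x z y w = 1"
  by (simp add: eval2_cleared_def)

text \<open>The power of \<open>z\<close> in a term is the distance of its index from the bound, so
  raising both by one leaves it unchanged.\<close>

lemma eval2_cleared_mult_x:
  "eval2_cleared (Suc a) b (monom 1 1 * T) x z y w = x * eval2_cleared a b T x z y w"
  unfolding eval2_cleared_def sum.atMost_Suc_shift[of _ a] coeff_monom_mult
  by (simp add: sum_distrib_left mult_ac)

lemma eval2_cleared_mult_y:
  "eval2_cleared a (Suc b) ([:monom 1 1:] * T) x z y w = y * eval2_cleared a b T x z y w"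
proof -
  have "coeff ([:monom 1 1:] * T) i = monom 1 1 * coeff T i" for i
    by simp
  then show ?thesis
    by (simp only: eval2_cleared_def sum.atMost_Suc_shift[of _ b] coeff_monom_mult)
      (simp add: sum_distrib_left mult_ac)
qed

text \<open>A bound one larger than necessary leaves a spare factor \<open>z\<close>. In the
  recurrence this absorbs the coefficient of the contraction, which has one vertex less; the
  analogous lemma for \<open>w\<close> absorbs the coefficient of the deletion.\<close>

lemma eval2_cleared_Suc_left:
  assumes "degree T \<le> a"
  shows "eval2_cleared (Suc a) b T x z y w = z * eval2_cleared a b T x z y w"
  using assms unfolding eval2_cleared_def sum.atMost_Suc
  by (simp add: coeff_eq_0 sum_distrib_left Suc_diff_le mult_ac)

lemma eval2_cleared_Suc_right:
  assumes "\<And>i. degree (coeff T i) \<le> b"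
  shows "eval2_cleared a (Suc b) T x z y w = w * eval2_cleared a b T x z y w"
proof -
  have "coeff (coeff T i) (Suc b) = 0" for i
    using assms[of i] by (simp add: coeff_eq_0)
  then show ?thesis
    unfolding eval2_cleared_def sum.atMost_Suc
    by (simp add: sum_distrib_left Suc_diff_le mult_ac)
qed

section \<open>Cut properties\<close>

definition inner_arcs :: "('v, 'e) pre_digraph \<Rightarrow> 'v set \<Rightarrow> 'e set" where
  "inner_arcs G U = {f \<in> arcs G. tail G f \<in> U \<and> head G f \<in> U}"

text \<open>One side of a simple cut. Every simple cut occurs twice, once for each side, which is
  harmless because sides are always quantified over.\<close>

definition simple_side :: "('v, 'e) pre_digraph \<Rightarrow> 'v set \<Rightarrow> bool" where
  "simple_side G U \<longleftrightarrow> U \<subset> verts G \<and> U \<noteq> {} \<and>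
    Digraph_Component.connected (G \<restriction> U) \<and> Digraph_Component.connected (G \<restriction> (verts G - U))"

text \<open>
  \<open>bond a b G U\<close> is a copy of the cut minor on two fixed vertices, so that the same graph is
  obtained from \<open>G\<close> and from its minors.
\<close>

definition bond :: "'v \<Rightarrow> 'v \<Rightarrow> ('v, 'e) pre_digraph \<Rightarrow> 'v set \<Rightarrow> ('v, 'e) pre_digraph" where
  "bond a b G U = \<lparr>verts = {a, b}, arcs = coboundary G U,
     tail = (\<lambda>f. if f \<in> coboundary G U \<and> tail G f \<in> U then a else b),
     head = (\<lambda>f. if f \<in> coboundary G U \<and> head G f \<in> U then a else b)\<rparr>"

definition bond_good ::
    "('v, 'e) fproperty \<Rightarrow> 'v \<Rightarrow> 'v \<Rightarrow> ('v, 'e) pre_digraph \<Rightarrow> 'e rel \<Rightarrow> ('e \<times> sign) set \<Rightarrow> 'v set \<Rightarrow> bool" where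
  "bond_good P a b G r \<O> U \<longleftrightarrow>
     P (bond a b G U) (induced_order (bond a b G U) r) (induced_fourientation (bond a b G U) \<O>)"

lemma bond_simps [simp]:
  "verts (bond a b G U) = {a, b}"
  "arcs (bond a b G U) = coboundary G U"
  "tail (bond a b G U) f = (if f \<in> coboundary G U \<and> tail G f \<in> U then a else b)"
  "head (bond a b G U) f = (if f \<in> coboundary G U \<and> head G f \<in> U then a else b)"
  by (simp_all add: bond_def)

text \<open>Connectivity of a side is moved into the ambient graph, with \<open>inner_arcs\<close>
  as the edge set, so that \<open>joined_contract\<close> applies to it.\<close>

lemma connected_induce_subgraph_iff:
  assumes "wf_digraph G" "U \<subseteq> verts G"
  shows "Digraph_Component.connected (G \<restriction> U) \<longleftrightarrow>
    U \<noteq> {} \<and> (\<forall>v\<in>U. \<forall>w\<in>U. joined G (inner_arcs G U) v w)"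
proof -
  have wf: "wf_digraph (G \<restriction> U)"
    by (simp add: wf_digraph_def)
  have arcs: "arcs (G \<restriction> U) = inner_arcs G U" by (simp add: inner_arcs_def)
  have "coboundary (G \<restriction> U) S \<inter> inner_arcs G U = coboundary G S \<inter> inner_arcs G U" for S
    by (auto simp: coboundary_def inner_arcs_def)
  then have "joined (G \<restriction> U) (inner_arcs G U) = joined G (inner_arcs G U)"
    by (simp add: joined_def fun_eq_iff)
  then show ?thesis
    unfolding connected_iff_joined[OF wf] arcs by simp
qed

lemma coboundary_Diff_verts:
  assumes "wf_digraph G"
  shows "coboundary G (verts G - U) = coboundary G U"
  using assms by (auto simp: coboundary_def wf_digraph_def)

lemma simple_side_iff:
  assumes "wf_digraph G"
  shows "simple_side G U \<longleftrightarrow> U \<subset> verts G \<and> U \<noteq> {} \<and>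
    (\<forall>v\<in>U. \<forall>w\<in>U. joined G (inner_arcs G U) v w) \<and>
    (\<forall>v\<in>verts G - U. \<forall>w\<in>verts G - U. joined G (inner_arcs G (verts G - U)) v w)"
proof -
  have "Digraph_Component.connected (G \<restriction> U) \<longleftrightarrow> (\<forall>v\<in>U. \<forall>w\<in>U. joined G (inner_arcs G U) v w)"
    "Digraph_Component.connected (G \<restriction> (verts G - U)) \<longleftrightarrow>
      (\<forall>v\<in>verts G - U. \<forall>w\<in>verts G - U. joined G (inner_arcs G (verts G - U)) v w)"
    if "U \<subset> verts G" "U \<noteq> {}"
    using that connected_induce_subgraph_iff[OF assms, of U]
      connected_induce_subgraph_iff[OF assms, of "verts G - U"] by auto
  then show ?thesis unfolding simple_side_def by blast
qed

lemma simple_cut_iff: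
  "simple_cut G Cu \<longleftrightarrow> (\<exists>U. simple_side G U \<and> Cu = {U, verts G - U})"
  unfolding simple_cut_def is_cut_iff simple_side_def by auto

lemma ordered_oriented_graph_bond:
  assumes "ordered_oriented_graph G r" "U \<subset> verts G" "U \<noteq> {}"
  shows "ordered_oriented_graph (bond a b G U) (induced_order (bond a b G U) r)"
proof -
  note G = ordered_oriented_graphD[OF assms(1)]
  have "fin_digraph (bond a b G U)"
    using finite_subset[OF coboundary_subset G(4)]
    by (simp add: fin_digraph_def fin_digraph_axioms_def wf_digraph_def)
  moreover have "Digraph_Component.connected (bond a b G U)"
  proof -
    have "coboundary G U \<noteq> {}"
      using G(3) assms(2,3) connected_iff_coboundary[OF G(2)] by blast
    then obtain f where f: "f \<in> coboundary G U" by blast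
    have "joined (bond a b G U) (coboundary G U) (tail (bond a b G U) f) (head (bond a b G U) f)"
      using f by (intro joined_arc) simp_all
    then have "joined (bond a b G U) (coboundary G U) a b"
      using f joined_sym by (auto simp: coboundary_def split: if_splits)
    moreover have "wf_digraph (bond a b G U)" by (simp add: wf_digraph_def)
    ultimately show ?thesis
      by (simp add: connected_iff_joined joined_refl joined_sym)
  qed
  ultimately show ?thesis
    using assms(1) coboundary_subset[of G U] by (intro ordered_oriented_graph_induced) simp_all
qed

text \<open>Both sides of a simple cut are connected by edges off the cut, and no edge off the cut
  changes sides. Hence the representative of a vertex records exactly its side, and the isomorphism
  sends the two representatives to \<open>a\<close> and \<open>b\<close>.\<close>

lemma cut_minor_isomorphic_bond:
  assumes "wf_digraph G" "simple_side G U" "a \<noteq> b"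
  shows "fourientation_isomorphic (cut_minor G {U, verts G - U})
     (induced_order (cut_minor G {U, verts G - U}) r)
     (induced_fourientation (cut_minor G {U, verts G - U}) \<O>)
     (bond a b G U) (induced_order (bond a b G U) r) (induced_fourientation (bond a b G U) \<O>)"
proof -
  let ?V = "verts G" and ?C = "coboundary G U"
  let ?A = "arcs G - ?C"
  let ?R = "representative G ?A"
  have U: "U \<subset> ?V" "U \<noteq> {}" using assms(2) by (simp_all add: simple_side_def)
  have M: "cut_minor G {U, ?V - U} = contract G ?A"
    using cut_edges_eq_coboundary[OF assms(1)] U(1) by (simp add: cut_minor_def psubset_imp_subset)
  have arcs: "arcs G - ?A = ?C" using coboundary_subset[of G U] by blast
  have R: "?R v = ?R w \<longleftrightarrow> joined G ?A v w" if "v \<in> ?V" "w \<in> ?V" for v w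
    using representative_eq_iff[OF assms(1) _ that] by blast
  have inner: "inner_arcs G U \<subseteq> ?A" "inner_arcs G (?V - U) \<subseteq> ?A"
    by (auto simp: inner_arcs_def coboundary_def)
  have "joined G ?A v w \<longleftrightarrow> (v \<in> U \<longleftrightarrow> w \<in> U)" if vw: "v \<in> ?V" "w \<in> ?V" for v w
  proof
    assume J: "joined G ?A v w"
    have "coboundary G U \<inter> ?A = {}" "coboundary G (- U) \<inter> ?A = {}"
      by (auto simp: coboundary_Compl)
    then show "v \<in> U \<longleftrightarrow> w \<in> U"
      using joinedD[OF J, of U] joinedD[OF J, of "- U"] by auto
  next
    assume "v \<in> U \<longleftrightarrow> w \<in> U"
    then have "joined G (inner_arcs G U) v w \<or> joined G (inner_arcs G (?V - U)) v w"
      using assms(2) vw unfolding simple_side_iff[OF assms(1)] by blast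
    then show "joined G ?A v w" using joined_mono inner by metis
  qed
  then have R: "?R v = ?R w \<longleftrightarrow> (v \<in> U \<longleftrightarrow> w \<in> U)" if "v \<in> ?V" "w \<in> ?V" for v w
    using R that by simp
  define f where "f x = (if x \<in> ?R ` U then a else b)" for x
  have f: "f (?R w) = (if w \<in> U then a else b)" if "w \<in> ?V" for w
  proof -
    have "?R w \<in> ?R ` U \<longleftrightarrow> w \<in> U"
    proof
      assume "?R w \<in> ?R ` U"
      then obtain u where "u \<in> U" "?R w = ?R u" by blast
      then show "w \<in> U" using R[OF that, of u] U(1) by blast
    qed blast
    then show ?thesis by (simp add: f_def)
  qed
  have "bij_betw f (?R ` ?V) {a, b}"
  proof (rule bij_betw_imageI)
    show "inj_on f (?R ` ?V)"
    proof (rule inj_onI)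
      fix x y assume "x \<in> ?R ` ?V" "y \<in> ?R ` ?V" and eq: "f x = f y"
      then obtain v w where vw: "v \<in> ?V" "w \<in> ?V" "x = ?R v" "y = ?R w" by blast
      then show "x = y" using eq f assms(3) R by (auto split: if_splits)
    qed
    obtain u w where uw: "u \<in> U" "w \<in> ?V" "w \<notin> U" using U by blast
    then have "u \<in> ?V" using U by blast
    then have "a \<in> f ` ?R ` ?V" "b \<in> f ` ?R ` ?V"
      using f[of u] f[of w] uw by (metis (full_types) imageI)+
    moreover have "f ` ?R ` ?V \<subseteq> {a, b}" using f by auto
    ultimately show "f ` ?R ` ?V = {a, b}" by blast
  qed
  moreover have "tail (bond a b G U) e = f (?R (tail G e))" "head (bond a b G U) e = f (?R (head G e))"
    if "e \<in> ?C" for e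
    using that f assms(1) coboundary_subset by (auto simp: wf_digraph_def coboundary_def)
  ultimately show ?thesis
    unfolding fourientation_isomorphic_def M
    by (intro exI[of _ f] exI[of _ id])
      (simp add: arcs induced_order_def induced_fourientation_def edge_orientations_def)
qed

lemma ordered_oriented_graph_cut_minor:
  assumes "ordered_oriented_graph G r"
  shows "ordered_oriented_graph (cut_minor G Cu) (induced_order (cut_minor G Cu) r)"
  unfolding cut_minor_def by (rule ordered_oriented_graph_contract[OF assms]) blast

lemma induced_fourientation_in: "induced_fourientation H \<O> \<in> fourientations H"
  by (simp add: induced_fourientation_def fourientations_def)

text \<open>The representatives chosen in \<open>cut_minor\<close> are unknown; invariance under
  isomorphism trades them for the fixed vertices \<open>a\<close> and \<open>b\<close>.\<close>

lemma cut_property_iff_bonds: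
  assumes "cut_property P" "ordered_oriented_graph G r" "\<O> \<in> fourientations G" "a \<noteq> b"
  shows "P G r \<O> \<longleftrightarrow> (\<forall>U. simple_side G U \<longrightarrow> bond_good P a b G r \<O> U)"
proof -
  note G = ordered_oriented_graphD[OF assms(2)]
  have "P (cut_minor G {U, verts G - U}) (induced_order (cut_minor G {U, verts G - U}) r)
               (induced_fourientation (cut_minor G {U, verts G - U}) \<O>) \<longleftrightarrow> bond_good P a b G r \<O> U"
    if U: "simple_side G U" for U
  proof -
    have U': "U \<subset> verts G" "U \<noteq> {}" using U by (simp_all add: simple_side_def)
    show ?thesis
      unfolding bond_good_def
      using assms(1) cut_minor_isomorphic_bond[OF G(2) U assms(4)]
        ordered_oriented_graph_bond[OF assms(2) U'] ordered_oriented_graph_cut_minor[OF assms(2)]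
        induced_fourientation_in
      unfolding cut_property_def fourientation_property_def by blast
  qed
  then show ?thesis
    using assms(1-3) unfolding cut_property_def simple_cut_iff by metis
qed

section \<open>Simple cuts under contraction or deletion of one edge\<close>

lemma representative_arc_mem_iff:
  assumes "wf_digraph G" "e \<in> arcs G" "e \<notin> coboundary G U" "U \<subseteq> verts G" "v \<in> verts G"
  shows "representative G {e} v \<in> representative G {e} ` U \<longleftrightarrow> v \<in> U"
proof
  assume "representative G {e} v \<in> representative G {e} ` U"
  then obtain u where u: "u \<in> U" "representative G {e} u = representative G {e} v"
    by (metis imageE)
  then have "joined G {e} u v"
    using representative_eq_iff[OF assms(1), of "{e}" u v] assms(2,4,5) by auto
  then show "v \<in> U" using joinedD u(1) assms(3) by (metis Int_insert_right_if0 inf_bot_right)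
qed blast

lemma connected_induce_contract_arc:
  assumes "wf_digraph G" "e \<in> arcs G" "e \<notin> coboundary G U" "U \<subseteq> verts G"
  shows "Digraph_Component.connected (contract G {e} \<restriction> (representative G {e} ` U)) \<longleftrightarrow>
    Digraph_Component.connected (G \<restriction> U)"
proof -
  let ?H = "contract G {e}" and ?R = "representative G {e}"
  have wf: "wf_digraph ?H" using assms(1) by (auto simp: wf_digraph_def)
  have sub: "?R ` U \<subseteq> verts ?H" using assms(4) by auto
  have inner: "inner_arcs ?H (?R ` U) = inner_arcs G U - {e}"
    using representative_arc_mem_iff[OF assms] assms(1)
    by (auto simp: inner_arcs_def wf_digraph_def)
  have "joined G (insert e (inner_arcs G U - {e})) v w \<longleftrightarrow> joined G (inner_arcs G U) v w"
    if vw: "v \<in> U" "w \<in> U" for v w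
  proof (cases "e \<in> inner_arcs G U")
    case True
    then show ?thesis by (simp add: insert_absorb)
  next
    case False
    \<comment> \<open>An edge off the cut and not inside \<open>U\<close> has both ends outside
      \<open>U\<close>. It cannot help to join vertices of \<open>U\<close>, since every test set
      may be intersected with \<open>U\<close>.\<close>
    then have out: "tail G e \<notin> U" "head G e \<notin> U"
      using assms(2,3) by (auto simp: inner_arcs_def coboundary_def)
    show ?thesis
    proof
      assume J: "joined G (insert e (inner_arcs G U - {e})) v w"
      show "joined G (inner_arcs G U) v w"
        unfolding joined_def
      proof (intro allI impI, elim conjE)
        fix S assume S: "v \<in> S" "coboundary G S \<inter> inner_arcs G U = {}"
        then have "coboundary G (S \<inter> U) \<inter> insert e (inner_arcs G U - {e}) = {}"
          using out by (auto simp: coboundary_def inner_arcs_def)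
        then show "w \<in> S" using joinedD[OF J, of "S \<inter> U"] S(1) vw(1) by blast
      qed
    qed (use False joined_mono in \<open>metis Diff_insert_absorb Diff_empty insert_Diff_single subset_insertI\<close>)
  qed
  moreover have "joined ?H (inner_arcs G U - {e}) (?R v) (?R w) \<longleftrightarrow>
      joined G (insert e (inner_arcs G U - {e})) v w" if "v \<in> U" "w \<in> U" for v w
    using joined_contract[OF assms(1), of "{e}" "inner_arcs G U - {e}" v w] that assms(2,4)
    by (auto simp: inner_arcs_def)
  ultimately show ?thesis
    unfolding connected_induce_subgraph_iff[OF wf sub] connected_induce_subgraph_iff[OF assms(1,4)] inner
    by simp
qed

text \<open>The bonds are equal as records, not merely isomorphic. For this reason
  \<open>bond\<close> assigns the default \<open>b\<close> to edges off the cut: there the tails and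
  heads in the graph and in the contraction could differ.\<close>

lemma simple_side_contract_arc:
  assumes "wf_digraph G" "e \<in> arcs G" "e \<notin> coboundary G U" "U \<subseteq> verts G"
  shows "simple_side (contract G {e}) (representative G {e} ` U) \<longleftrightarrow> simple_side G U"
    and "bond a b (contract G {e}) (representative G {e} ` U) = bond a b G U"
proof -
  let ?R = "representative G {e}"
  note mem = representative_arc_mem_iff[OF assms]
  have c: "e \<notin> coboundary G (verts G - U)"
    using assms(3) coboundary_Diff_verts[OF assms(1)] by simp
  have diff: "?R ` verts G - ?R ` U = ?R ` (verts G - U)"
    using mem by auto
  have "?R ` U \<subset> ?R ` verts G \<longleftrightarrow> U \<subset> verts G"
    using mem assms(4) by blast
  then show "simple_side (contract G {e}) (?R ` U) \<longleftrightarrow> simple_side G U"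
    unfolding simple_side_def
    using connected_induce_contract_arc[OF assms]
      connected_induce_contract_arc[OF assms(1,2) c] by (auto simp: diff)
  have "coboundary (contract G {e}) (?R ` U) = coboundary G U"
    using mem assms(1,3) by (auto simp: coboundary_def wf_digraph_def)
  moreover have "(f \<in> coboundary G U \<and> ?R (tail G f) \<in> ?R ` U) = (f \<in> coboundary G U \<and> tail G f \<in> U)"
    "(f \<in> coboundary G U \<and> ?R (head G f) \<in> ?R ` U) = (f \<in> coboundary G U \<and> head G f \<in> U)" for f
    using mem[of "tail G f"] mem[of "head G f"] assms(1) by (auto simp: coboundary_def wf_digraph_def)
  ultimately show "bond a b (contract G {e}) (?R ` U) = bond a b G U"
    by (simp only: bond_def contract_simps)
qed

lemma induced_induced:
  assumes "arcs B \<subseteq> arcs H"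
  shows "induced_order B (induced_order H r) = induced_order B r"
  using assms by (auto simp: induced_order_def)

lemma cut_property_contract_arc:
  assumes "cut_property P" "ordered_oriented_graph G r" "e \<in> arcs G"
    "\<O> \<subseteq> (arcs G - {e}) \<times> UNIV" "a \<noteq> b"
  shows "P (contract G {e}) (induced_order (contract G {e}) r) \<O> \<longleftrightarrow>
    (\<forall>U. simple_side G U \<and> e \<notin> coboundary G U \<longrightarrow> bond_good P a b G r \<O> U)"
proof -
  let ?H = "contract G {e}" and ?R = "representative G {e}"
  note G = ordered_oriented_graphD[OF assms(2)]
  have H: "ordered_oriented_graph ?H (induced_order ?H r)"
    using ordered_oriented_graph_contract[OF assms(2)] assms(3) by blast
  have eq: "bond_good P a b ?H (induced_order ?H r) \<O> (?R ` U) \<longleftrightarrow> bond_good P a b G r \<O> U"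
    if "e \<notin> coboundary G U" "U \<subseteq> verts G" for U
  proof -
    have "arcs (bond a b G U) \<subseteq> arcs ?H" using that(1) coboundary_subset[of G U] by auto
    then show ?thesis
      unfolding bond_good_def simple_side_contract_arc(2)[OF G(2) assms(3) that]
      by (simp only: induced_induced)
  qed
  have "\<O> \<in> fourientations ?H"
    using assms(4) by (simp add: fourientations_def edge_orientations_def)
  then have "P ?H (induced_order ?H r) \<O> \<longleftrightarrow>
      (\<forall>U'. simple_side ?H U' \<longrightarrow> bond_good P a b ?H (induced_order ?H r) \<O> U')"
    using cut_property_iff_bonds[OF assms(1) H _ assms(5)] by simp
  also have "\<dots> \<longleftrightarrow> (\<forall>U. simple_side G U \<and> e \<notin> coboundary G U \<longrightarrow> bond_good P a b G r \<O> U)"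
  proof (intro iffI allI impI; (elim conjE)?)
    fix U assume *: "\<forall>U'. simple_side ?H U' \<longrightarrow> bond_good P a b ?H (induced_order ?H r) \<O> U'"
      and U: "simple_side G U" "e \<notin> coboundary G U"
    then have "U \<subseteq> verts G" by (auto simp: simple_side_def)
    then show "bond_good P a b G r \<O> U"
      using * eq simple_side_contract_arc(1)[OF G(2) assms(3) U(2)] U by blast
  next
    fix U' assume *: "\<forall>U. simple_side G U \<and> e \<notin> coboundary G U \<longrightarrow> bond_good P a b G r \<O> U"
      and U': "simple_side ?H U'"
    \<comment> \<open>The ends of \<open>e\<close> have the same representative, so the preimage of
      a side of the contraction never separates them.\<close>
    define U where "U = {v \<in> verts G. ?R v \<in> U'}"
    have "?R (tail G e) = ?R (head G e)"
      using representative_eq_iff[OF G(2), of "{e}" "tail G e" "head G e"] G(2) assms(3)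
        joined_arc[of e "{e}" G] by (simp add: wf_digraph_def)
    then have e: "e \<notin> coboundary G U" using G(2) by (auto simp: U_def coboundary_def wf_digraph_def)
    have "U' \<subseteq> ?R ` verts G" using U' by (auto simp: simple_side_def)
    then have "?R ` U = U'" by (auto simp: U_def)
    moreover have "U \<subseteq> verts G" by (auto simp: U_def)
    ultimately show "bond_good P a b ?H (induced_order ?H r) \<O> U'"
      using * eq[OF e] simple_side_contract_arc(1)[OF G(2) assms(3) e] e U' by metis
  qed
  finally show ?thesis .
qed

lemma bond_good_irrelevant:
  assumes "e \<notin> coboundary G U"
  shows "bond_good P a b G r (\<O> \<union> {e} \<times> S) U \<longleftrightarrow> bond_good P a b G r \<O> U"
proof -
  have "induced_fourientation (bond a b G U) (\<O> \<union> {e} \<times> S) = induced_fourientation (bond a b G U) \<O>"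
    using assms by (auto simp: induced_fourientation_def edge_orientations_def)
  then show ?thesis by (simp add: bond_good_def)
qed

text \<open>Bonds avoiding \<open>e\<close> do not see the state \<open>S\<close> and together
  amount to goodness of the contraction. The state enters only through the bonds that contain
  \<open>e\<close>.\<close>

lemma cut_property_split_arc:
  assumes "cut_property P" "ordered_oriented_graph G r" "e \<in> arcs G"
    "\<O> \<subseteq> (arcs G - {e}) \<times> UNIV" "a \<noteq> b"
  shows "P G r (\<O> \<union> {e} \<times> S) \<longleftrightarrow>
    P (contract G {e}) (induced_order (contract G {e}) r) \<O> \<and>
    (\<forall>U. simple_side G U \<and> e \<in> coboundary G U \<longrightarrow> bond_good P a b G r (\<O> \<union> {e} \<times> S) U)"
proof -
  have "\<O> \<union> {e} \<times> S \<in> fourientations G"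
    using assms(3,4) by (auto simp: fourientations_def edge_orientations_def)
  then show ?thesis
    using cut_property_iff_bonds[OF assms(1,2) _ assms(5)] cut_property_contract_arc[OF assms]
      bond_good_irrelevant by metis
qed

lemma obtain_distinct:
  obtains a b :: "'v::infinite" where "a \<noteq> b"
  using infinite_UNIV by (metis (full_types) UNIV_eq_I finite.emptyI finite_insert singletonI)

text \<open>A loop lies in no coboundary, so it affects neither the simple sides nor any bond,
  whatever its state.\<close>

lemma cut_property_loop:
  fixes P :: "('v::infinite, 'e::infinite) fproperty"
  assumes "cut_property P" "ordered_oriented_graph G r" "loop G e" "\<O> \<subseteq> (arcs G - {e}) \<times> UNIV"
  shows "P G r (\<O> \<union> {e} \<times> S) \<longleftrightarrow>
    P (pre_digraph.del_arc G e) (induced_order (pre_digraph.del_arc G e) r) \<O>"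
proof -
  obtain a b :: 'v where ab: "a \<noteq> b" by (rule obtain_distinct)
  let ?H = "pre_digraph.del_arc G e"
  note G = ordered_oriented_graphD[OF assms(2)]
  have e: "e \<in> arcs G" and cob: "\<And>U. e \<notin> coboundary G U" "\<not> isthmus G e"
    using assms(3) isthmus_not_loop[OF G(2)] by (auto simp: loop_def coboundary_def)
  note H = ordered_oriented_graph_del_arc[OF assms(2) cob(2)]
  have cob_eq: "coboundary ?H U = coboundary G U" for U
    using cob by (simp add: coboundary_del_arc)
  have "joined G (A - {e}) v w = joined G A v w" for A v w
  proof -
    have "coboundary G U \<inter> (A - {e}) = coboundary G U \<inter> A" for U using cob(1)[of U] by blast
    then show ?thesis by (simp add: joined_def)
  qed
  moreover have "inner_arcs ?H U = inner_arcs G U - {e}" for U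
    by (auto simp: inner_arcs_def pre_digraph.del_arc_simps)
  ultimately have "simple_side ?H U \<longleftrightarrow> simple_side G U" for U
    unfolding simple_side_iff[OF G(2)] simple_side_iff[OF ordered_oriented_graphD(2)[OF H]]
    by (simp add: joined_del_arc pre_digraph.del_arc_simps)
  moreover have "bond_good P a b ?H (induced_order ?H r) \<O> U \<longleftrightarrow> bond_good P a b G r (\<O> \<union> {e} \<times> S) U" for U
  proof -
    have "bond a b ?H U = bond a b G U"
      by (simp add: bond_def cob_eq pre_digraph.del_arc_simps)
    moreover have "arcs (bond a b G U) \<subseteq> arcs ?H"
      using coboundary_subset[of ?H U] by (simp add: cob_eq)
    ultimately show ?thesis
      unfolding bond_good_irrelevant[OF cob(1)] by (simp add: bond_good_def induced_induced)
  qed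
  moreover have "\<O> \<in> fourientations ?H" "\<O> \<union> {e} \<times> S \<in> fourientations G"
    using assms(4) e by (auto simp: fourientations_def edge_orientations_def pre_digraph.del_arc_simps)
  ultimately show ?thesis
    using cut_property_iff_bonds[OF assms(1) _ _ ab] assms(2) H by metis
qed

section \<open>Consequences of T1 and T2 for cut properties\<close>

lemma source_opp [simp]: "source G (f, opp s) = target G (f, s)"
  by (cases s) simp_all

lemma target_opp [simp]: "target G (f, opp s) = source G (f, s)"
  by (cases s) simp_all

lemma opp_opp [simp]: "opp (opp s) = s"
  by (cases s) simp_all

lemma coboundary_source_target:
  assumes "f \<in> arcs G"
  shows "f \<in> coboundary G U \<longleftrightarrow> (source G (f, s) \<in> U \<longleftrightarrow> target G (f, s) \<notin> U)"
  using assms by (cases s) (auto simp: coboundary_def)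

text \<open>No orientation in \<open>\<O>\<close> enters \<open>W\<close>: the condition of a
  potential cut, stated for an arbitrary set so that it also makes sense for a complement in the
  whole vertex type.\<close>

definition blocked_side :: "('v, 'e) pre_digraph \<Rightarrow> ('e \<times> sign) set \<Rightarrow> 'v set \<Rightarrow> bool" where
  "blocked_side G \<O> W \<longleftrightarrow> (\<forall>f\<in>coboundary G W. \<forall>s. source G (f, s) \<in> W \<longrightarrow> (f, opp s) \<notin> \<O>)"

text \<open>A bond has only the directed cuts ({a}, {b}) and ({b}, {a}). The one that T1 declares
  potential pulls back to \<open>U\<close> or to \<open>- U\<close>, which have the same
  coboundary.\<close>

lemma bond_bad_imp_blocked_side:
  assumes "Tutte_cut_property P" "ordered_oriented_graph G r" "U \<subset> verts G" "U \<noteq> {}" "a \<noteq> b"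
    "\<not> bond_good P a b G r \<O> U"
  obtains W where "coboundary G W = coboundary G U" "blocked_side G \<O> W"
proof -
  let ?B = "bond a b G U"
  obtain D where D: "potential_cut ?B (induced_fourientation ?B \<O>) D"
    using assms(1,6) ordered_oriented_graph_bond[OF assms(2-4)] induced_fourientation_in
    unfolding Tutte_cut_property_def bond_good_def by blast
  then obtain T where T: "T \<subset> {a, b}" "T \<noteq> {}" "{fst D, snd D} = {T, {a, b} - T}"
    unfolding potential_cut_def directed_cut_def is_cut_iff by auto
  then have "T = {a} \<or> T = {b}" by auto
  then have D_cases: "D = ({a}, {b}) \<or> D = ({b}, {a})"
    using T(3) assms(5) by (cases D) (auto simp: doubleton_eq_iff)
  have src: "source ?B (f, s) = (if source G (f, s) \<in> U then a else b)"
    "target ?B (f, s) = (if target G (f, s) \<in> U then a else b)" if "f \<in> coboundary G U" for f s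
    using that by (cases s; simp)+
  have no: "(f, opp s) \<notin> \<O>" if f: "f \<in> coboundary G U" "source ?B (f, s) \<in> fst D" for f s
  proof -
    have "target ?B (f, s) \<in> snd D"
      using f src[OF f(1), of s] D_cases assms(5) coboundary_source_target[of f G U s] coboundary_subset[of G U]
      by (auto split: if_splits)
    then have "(f, s) \<in> directed_cut_orientations ?B D"
      using f by (simp add: directed_cut_orientations_def edge_orientations_def)
    then have "(f, opp s) \<notin> induced_fourientation ?B \<O>"
      using D unfolding potential_cut_def by blast
    then show ?thesis using f(1) by (simp add: induced_fourientation_def edge_orientations_def)
  qed
  show thesis
  proof (cases "D = ({a}, {b})")
    case True
    then have "blocked_side G \<O> U"
      using no src by (simp add: blocked_side_def)
    then show thesis using that by blast
  next
    case False
    then have "blocked_side G \<O> (- U)"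
      using no src D_cases assms(5) by (simp add: blocked_side_def coboundary_Compl)
    then show thesis using that coboundary_Compl by metis
  qed
qed

text \<open>Whichever side \<open>W\<close> T1 would provide for a bond through \<open>e\<close>,
  one of the two orientations of \<open>e\<close> enters it.\<close>

lemma Tutte_cut_bioriented:
  fixes P :: "('v::infinite, 'e::infinite) fproperty"
  assumes "Tutte_cut_property P" "ordered_oriented_graph G r" "e \<in> arcs G"
    "\<O> \<subseteq> (arcs G - {e}) \<times> UNIV"
  shows "P G r (\<O> \<union> {e} \<times> UNIV) \<longleftrightarrow>
    P (contract G {e}) (induced_order (contract G {e}) r) \<O>"
proof -
  obtain a b :: 'v where ab: "a \<noteq> b" by (rule obtain_distinct)
  have "bond_good P a b G r (\<O> \<union> {e} \<times> UNIV) U" if U: "simple_side G U" "e \<in> coboundary G U" for U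
  proof (rule ccontr)
    assume bad: "\<not> bond_good P a b G r (\<O> \<union> {e} \<times> UNIV) U"
    have U': "U \<subset> verts G" "U \<noteq> {}" using U by (simp_all add: simple_side_def)
    obtain W where W: "coboundary G W = coboundary G U" "blocked_side G (\<O> \<union> {e} \<times> UNIV) W"
      by (rule bond_bad_imp_blocked_side[OF assms(1,2) U' ab bad])
    have "source G (e, Plus) \<in> W \<or> source G (e, Minus) \<in> W"
      using U(2) unfolding W(1)[symmetric] by (auto simp: coboundary_def)
    then show False
      using W U(2) unfolding blocked_side_def by blast
  qed
  then show ?thesis
    using cut_property_split_arc[OF _ assms(2-4) ab] assms(1) unfolding Tutte_cut_property_def by blast
qed

text \<open>With the bioriented state identified with \<open>q\<close>, T2(b) turns into a dichotomy
  between the minors. The last conclusion keeps the direction in which \<open>e\<close> crosses the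
  blocked side; this is what later contradicts a directed cycle through \<open>e\<close>.\<close>

lemma Tutte_cut_ordinary:
  fixes P :: "('v::infinite, 'e::infinite) fproperty"
  assumes "Tutte_cut_property P" "ordered_oriented_graph G r" "ordinary_arc G e" "maximum_edge G r e"
    "\<O> \<subseteq> (arcs G - {e}) \<times> UNIV"
  defines "p \<equiv> P (pre_digraph.del_arc G e) (induced_order (pre_digraph.del_arc G e) r) \<O>"
    and "q \<equiv> P (contract G {e}) (induced_order (contract G {e}) r) \<O>"
  shows "P G r (\<O> \<union> {e} \<times> {}) \<longleftrightarrow> p"
    and "P G r (\<O> \<union> {e} \<times> UNIV) \<longleftrightarrow> q"
    and "p \<Longrightarrow> P G r (\<O> \<union> {e} \<times> {s})"
    and "\<not> p \<Longrightarrow> q \<Longrightarrow> P G r (\<O> \<union> {e} \<times> {Plus}) \<noteq> P G r (\<O> \<union> {e} \<times> {Minus})"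
    and "P G r (\<O> \<union> {e} \<times> S) \<Longrightarrow> q"
    and "q \<Longrightarrow> \<not> P G r (\<O> \<union> {e} \<times> {s}) \<Longrightarrow>
      \<exists>W. blocked_side G (\<O> \<union> {e} \<times> {s}) W \<and> source G (e, s) \<in> W \<and> target G (e, s) \<notin> W"
proof -
  obtain a b :: 'v where ab: "a \<noteq> b" by (rule obtain_distinct)
  have e: "e \<in> arcs G" "\<not> isthmus G e" "\<not> loop G e" using assms(3) by (simp_all add: ordinary_arc_def)
  have cut: "cut_property P" using assms(1) by (simp add: Tutte_cut_property_def)
  note split = cut_property_split_arc[OF cut assms(2) e(1) assms(5) ab]
  have "\<O> \<in> fourientations (pre_digraph.del_arc G e)"
    using assms(5) by (simp add: fourientations_def edge_orientations_def pre_digraph.del_arc_simps)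
  then have T2: "p \<longrightarrow> P G r (\<O> \<union> {(e, Plus)}) \<and> P G r (\<O> \<union> {(e, Minus)})"
    "\<not> p \<and> P G r (\<O> \<union> {(e, Plus), (e, Minus)}) \<longrightarrow>
      P G r (\<O> \<union> {(e, Plus)}) \<noteq> P G r (\<O> \<union> {(e, Minus)})"
    "p \<longleftrightarrow> P G r \<O>"
    using assms(1,2,4) e unfolding Tutte_cut_property_def Let_def p_def by blast+
  have UNIV: "{e} \<times> UNIV = {(e, Plus), (e, Minus)}"
    using sign.exhaust by auto
  show "P G r (\<O> \<union> {e} \<times> {}) \<longleftrightarrow> p" using T2(3) by simp
  show bi: "P G r (\<O> \<union> {e} \<times> UNIV) \<longleftrightarrow> q"
    unfolding q_def by (rule Tutte_cut_bioriented[OF assms(1,2) e(1) assms(5)])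
  show "P G r (\<O> \<union> {e} \<times> {s})" if p using T2(1) that by (cases s) simp_all
  show "P G r (\<O> \<union> {e} \<times> {Plus}) \<noteq> P G r (\<O> \<union> {e} \<times> {Minus})" if "\<not> p" q
    using T2(2) that bi unfolding UNIV by simp
  show q if "P G r (\<O> \<union> {e} \<times> S)"
    using that unfolding split q_def by simp
  assume q and bad: "\<not> P G r (\<O> \<union> {e} \<times> {s})"
  then obtain U where U: "simple_side G U" "e \<in> coboundary G U"
    and Ub: "\<not> bond_good P a b G r (\<O> \<union> {e} \<times> {s}) U"
    unfolding split q_def by blast
  have U': "U \<subset> verts G" "U \<noteq> {}" using U by (simp_all add: simple_side_def)
  obtain W where W: "coboundary G W = coboundary G U" "blocked_side G (\<O> \<union> {e} \<times> {s}) W"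
    by (rule bond_bad_imp_blocked_side[OF assms(1,2) U' ab Ub])
  have eW: "e \<in> coboundary G W" using U(2) W(1) by simp
  \<comment> \<open>The orientation \<open>(e, s)\<close> is present and nothing present enters
    \<open>W\<close>, so \<open>(e, s)\<close> can only leave it.\<close>
  have "source G (e, opp s) \<notin> W"
    using W(2) eW unfolding blocked_side_def by (metis UnCI opp_opp SigmaI singletonI)
  then have "target G (e, s) \<notin> W" by simp
  moreover from this have "source G (e, s) \<in> W"
    using eW coboundary_source_target[OF e(1)] by blast
  ultimately show "\<exists>W. blocked_side G (\<O> \<union> {e} \<times> {s}) W \<and> source G (e, s) \<in> W \<and> target G (e, s) \<notin> W"
    using W(2) by blast
qed

section \<open>Isthmuses and cut properties\<close>

definition isthmus_good :: "('v, 'e) fproperty \<Rightarrow> sign set \<Rightarrow> bool" where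
  "isthmus_good P S \<longleftrightarrow> (\<forall>G r e. ordered_oriented_graph G r \<longrightarrow> card (verts G) = 2 \<longrightarrow> arcs G = {e} \<longrightarrow>
     P G r ({e} \<times> S))"

text \<open>Covers the single isthmus and the single loop at once; the last assumption keeps the two
  kinds apart. The vertex map sends tail to tail and every other vertex to the head.\<close>

lemma fourientation_isomorphic_single_arc:
  assumes "ordered_oriented_graph G r" "ordered_oriented_graph G' r'"
    "arcs G = {e}" "arcs G' = {e'}" "verts G = {tail G e, head G e}" "verts G' = {tail G' e', head G' e'}"
    "tail G e = head G e \<longleftrightarrow> tail G' e' = head G' e'"
  shows "fourientation_isomorphic G r ({e} \<times> S) G' r' ({e'} \<times> S)"
proof -
  let ?f = "\<lambda>v. if v = tail G e then tail G' e' else head G' e'"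
  have "bij_betw ?f (verts G) (verts G')"
    using assms(7) unfolding assms(5,6) by (intro bij_betw_imageI) (auto simp: inj_on_def)
  moreover have "bij_betw (\<lambda>_. e') {e} {e'}" by (simp add: bij_betw_def)
  moreover have "(e, e) \<notin> r" "(e', e') \<notin> r'"
    using assms(1,2) by (auto simp: ordered_oriented_graph_def irrefl_def)
  ultimately show ?thesis
    unfolding fourientation_isomorphic_def assms(3,4)
    using assms(7) by (intro exI[of _ ?f] exI[of _ "\<lambda>_. e'"]) (simp, metis)
qed

lemma single_arc_verts:
  assumes "ordered_oriented_graph G r" "arcs G = {e}"
  shows "verts G = {tail G e, head G e}"
proof -
  note G = ordered_oriented_graphD[OF assms(1)]
  have th: "tail G e \<in> verts G" "head G e \<in> verts G"
    using assms(2) G(2) by (simp_all add: wf_digraph_def)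
  have "coboundary G {tail G e, head G e} = {}"
    using assms(2) by (auto simp: coboundary_def)
  then have "verts G \<subseteq> {tail G e, head G e}"
    using connected_coboundary_nonempty[OF G(2,3), of "tail G e" "{tail G e, head G e}"] th by blast
  then show ?thesis using th by blast
qed

lemma single_arc_fourientation:
  "arcs G = {e} \<Longrightarrow> {e} \<times> S \<in> fourientations G"
  by (auto simp: fourientations_def edge_orientations_def)

lemma isthmus_good_iff:
  fixes P :: "('v::infinite, 'e::infinite) fproperty"
  assumes "fourientation_property P" "ordered_oriented_graph G r" "card (verts G) = 2" "arcs G = {e}"
  shows "P G r ({e} \<times> S) \<longleftrightarrow> isthmus_good P S"
proof
  assume good: "P G r ({e} \<times> S)"
  show "isthmus_good P S"
    unfolding isthmus_good_def
  proof (intro allI impI)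
    fix G' :: "('v, 'e) pre_digraph" and r' e' assume G': "ordered_oriented_graph G' r'" "card (verts G') = 2" "arcs G' = {e'}"
    have "tail G e \<noteq> head G e" "tail G' e' \<noteq> head G' e'"
      using assms(3) G'(2) single_arc_verts[OF assms(2,4)] single_arc_verts[OF G'(1,3)]
      by (auto simp: card_2_iff)
    then have "fourientation_isomorphic G r ({e} \<times> S) G' r' ({e'} \<times> S)"
      using single_arc_verts[OF assms(2,4)] single_arc_verts[OF G'(1,3)] assms(2,4) G'(1,3)
      by (intro fourientation_isomorphic_single_arc) auto
    then show "P G' r' ({e'} \<times> S)"
      using good assms(1,2) G'(1) single_arc_fourientation[OF assms(4)] single_arc_fourientation[OF G'(3)]
      unfolding fourientation_property_def by blast
  qed
qed (use assms in \<open>auto simp: isthmus_good_def\<close>)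

lemma bad_isthmus_set_iff:
  assumes "S \<in> {{}, {Minus}, {Plus}}"
  shows "S \<in> bad_isthmus_set P \<longleftrightarrow> \<not> isthmus_good P S"
  using assms unfolding bad_isthmus_set_def isthmus_good_def by blast

text \<open>If \<open>A\<close> split into two nonempty parts with no edge between them,
  connectivity of the graph would give both parts a cut edge. The only cut edge is \<open>e\<close>,
  which has just one end in \<open>A\<close>.\<close>

lemma isthmus_coboundary_simple_side:
  assumes "wf_digraph G" "Digraph_Component.connected G" "A \<subset> verts G" "A \<noteq> {}" "coboundary G A = {e}"
  shows "simple_side G A"
proof -
  have "joined G (inner_arcs G A) u w" if A: "A \<subset> verts G" "coboundary G A = {e}" and uw: "u \<in> A" "w \<in> A" for A u w
    unfolding joined_def
  proof (intro allI impI, elim conjE, rule ccontr)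
    fix S assume S: "u \<in> S" "coboundary G S \<inter> inner_arcs G A = {}" "w \<notin> S"
    have "coboundary G (S \<inter> A) \<subseteq> coboundary G A" "coboundary G (A - S) \<subseteq> coboundary G A"
      using S(2) by (auto simp: coboundary_def inner_arcs_def)
    moreover have "coboundary G (S \<inter> A) \<noteq> {}" "coboundary G (A - S) \<noteq> {}"
      using connected_coboundary_nonempty[OF assms(1,2), of u "S \<inter> A" w]
        connected_coboundary_nonempty[OF assms(1,2), of w "A - S" u] S uw A(1) by auto
    ultimately have "e \<in> coboundary G (S \<inter> A)" "e \<in> coboundary G (A - S)" "e \<in> coboundary G A"
      using A(2) by auto
    then show False by (auto simp: coboundary_def)
  qed
  moreover have "verts G - A \<subset> verts G" "coboundary G (verts G - A) = {e}"
    using assms(3-5) coboundary_Diff_verts[OF assms(1)] by blast+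
  ultimately show ?thesis
    unfolding simple_side_iff[OF assms(1)] using assms(3-5) by blast
qed

text \<open>Each side of the cut is connected without \<open>e\<close>, so it lies on one side of
  \<open>A\<close>, and \<open>e\<close> places the two sides on different ones. Thus an edge
  crossing \<open>U\<close> crosses \<open>A\<close>, and only \<open>e\<close> does.\<close>

lemma simple_side_isthmus:
  assumes "wf_digraph G" "coboundary G A = {e}" "simple_side G U" "e \<in> coboundary G U"
  shows "coboundary G U = {e}"
proof -
  note U = assms(3)[unfolded simple_side_iff[OF assms(1)]]
  have "v \<in> A \<longleftrightarrow> w \<in> A" if "joined G (inner_arcs G W) v w" "coboundary G W = coboundary G U" for v w W
  proof -
    have "e \<notin> inner_arcs G W" using assms(4) that(2) by (auto simp: coboundary_def inner_arcs_def set_eq_iff)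
    then have "coboundary G A \<inter> inner_arcs G W = {}" "coboundary G (- A) \<inter> inner_arcs G W = {}"
      using assms(2) by (auto simp: coboundary_Compl)
    then show ?thesis
      using joinedD[OF that(1), of A] joinedD[OF that(1), of "- A"] by blast
  qed
  then have *: "v \<in> A \<longleftrightarrow> w \<in> A" if "v \<in> U \<and> w \<in> U \<or> v \<in> verts G - U \<and> w \<in> verts G - U" for v w
    using U that coboundary_Diff_verts[OF assms(1), of U] by metis
  have "f = e" if f: "f \<in> coboundary G U" for f
  proof -
    have "f \<in> coboundary G A"
    proof -
      have th: "tail G f \<in> verts G" "head G f \<in> verts G" "tail G e \<in> verts G" "head G e \<in> verts G"
        using assms(1,4) f by (auto simp: coboundary_def wf_digraph_def)
      have eA: "tail G e \<in> A \<longleftrightarrow> head G e \<notin> A" using assms(2) by (auto simp: coboundary_def)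
      have eU: "tail G e \<in> U \<longleftrightarrow> head G e \<notin> U" using assms(4) by (auto simp: coboundary_def)
      have fU: "tail G f \<in> U \<longleftrightarrow> head G f \<notin> U" using f by (auto simp: coboundary_def)
      have "tail G f \<in> A \<longleftrightarrow> head G f \<notin> A"
        using *[of "tail G f" "tail G e"] *[of "head G f" "head G e"]
          *[of "tail G f" "head G e"] *[of "head G f" "tail G e"] th eA eU fU by blast
      then show ?thesis using f by (simp add: coboundary_def)
    qed
    then show ?thesis using assms(2) by simp
  qed
  then show ?thesis using assms(4) by blast
qed

text \<open>{e} is a simple cut and the only one through \<open>e\<close>, and its bond is the graph
  consisting of a single isthmus.\<close>

lemma Tutte_cut_isthmus:
  fixes P :: "('v::infinite, 'e::infinite) fproperty"
  assumes "Tutte_cut_property P" "ordered_oriented_graph G r" "isthmus G e"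
    "\<O> \<subseteq> (arcs G - {e}) \<times> UNIV"
  shows "P G r (\<O> \<union> {e} \<times> S) \<longleftrightarrow>
    P (contract G {e}) (induced_order (contract G {e}) r) \<O> \<and> isthmus_good P S"
proof -
  note G = ordered_oriented_graphD[OF assms(2)]
  have e: "e \<in> arcs G" using isthmus_not_loop[OF G(2) assms(3)] by simp
  obtain a b :: 'v where ab: "a \<noteq> b" by (rule obtain_distinct)
  have cut: "cut_property P" using assms(1) by (simp add: Tutte_cut_property_def)
  obtain A where A: "A \<subset> verts G" "A \<noteq> {}" "coboundary G A = {e}"
    using assms(3) isthmus_iff[OF G(2)] by metis
  have "bond_good P a b G r (\<O> \<union> {e} \<times> S) U \<longleftrightarrow> isthmus_good P S"
    if U: "simple_side G U" "e \<in> coboundary G U" for U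
  proof -
    have C: "coboundary G U = {e}"
      by (rule simple_side_isthmus[OF G(2) A(3) U])
    have "induced_fourientation (bond a b G U) (\<O> \<union> {e} \<times> S) = {e} \<times> S"
      using assms(4) by (auto simp: induced_fourientation_def edge_orientations_def C)
    then show ?thesis
      using isthmus_good_iff[OF _ ordered_oriented_graph_bond[OF assms(2)]] cut ab U(1) C
      by (simp add: bond_good_def cut_property_def simple_side_def)
  qed
  moreover have "simple_side G A" by (rule isthmus_coboundary_simple_side[OF G(2,3) A])
  ultimately show ?thesis
    using cut_property_split_arc[OF cut assms(2) e assms(4) ab] A(3) by blast
qed

text \<open>The reason why \<open>m\<close> enters \<open>isthmus_weight\<close> without an
  indicator: a bioriented isthmus leaves no potential cut, so T1 applies.\<close>

lemma isthmus_good_bioriented: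
  fixes P :: "('v::infinite, 'e::infinite) fproperty"
  assumes "Tutte_cut_property P"
  shows "isthmus_good P UNIV"
  unfolding isthmus_good_def
proof (intro allI impI)
  fix G :: "('v, 'e) pre_digraph" and r e
  assume G: "ordered_oriented_graph G r" "card (verts G) = 2" "arcs G = {e}"
  have "\<not> potential_cut G ({e} \<times> UNIV) D" for D
  proof
    assume D: "potential_cut G ({e} \<times> UNIV) D"
    then obtain T where T: "T \<subset> verts G" "T \<noteq> {}" "{fst D, snd D} = {T, verts G - T}"
      unfolding potential_cut_def directed_cut_def is_cut_iff by auto
    have "(tail G e \<in> T) \<noteq> (head G e \<in> T)"
      using T(1,2) single_arc_verts[OF G(1,3)] by auto
    moreover have "tail G e \<in> verts G" "head G e \<in> verts G"
      using single_arc_verts[OF G(1,3)] by auto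
    ultimately have "\<exists>s. source G (e, s) \<in> fst D \<and> target G (e, s) \<in> snd D"
      using T(3) by (cases "tail G e \<in> fst D") (auto simp: doubleton_eq_iff intro: exI[of _ Plus] exI[of _ Minus])
    then show False
      using D G(3) by (auto simp: potential_cut_def directed_cut_orientations_def edge_orientations_def)
  qed
  then show "P G r ({e} \<times> UNIV)"
    using assms G(1) single_arc_fourientation[OF G(3)] unfolding Tutte_cut_property_def by blast
qed

section \<open>Cycle properties\<close>

text \<open>No edge of \<open>C\<close> is a bridge of the subgraph with edge set \<open>C\<close>.
  The formulation by cuts carries over to minors by computing coboundaries alone.\<close>

definition bridgeless :: "('v, 'e) pre_digraph \<Rightarrow> 'e set \<Rightarrow> bool" where
  "bridgeless G C \<longleftrightarrow> C \<subseteq> arcs G \<and> (\<forall>U f. coboundary G U \<inter> C \<noteq> {f})"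

text \<open>
  The edge sets of simple cycles are the circuits of the cycle matroid, here the minimal nonempty
  edge sets that no cut meets in exactly one edge (\<open>circuit_iff_simple_cycle\<close> below).
\<close>

definition circuit :: "('v, 'e) pre_digraph \<Rightarrow> 'e set \<Rightarrow> bool" where
  "circuit G C \<longleftrightarrow> C \<noteq> {} \<and> bridgeless G C \<and> (\<forall>B. B \<subset> C \<longrightarrow> B \<noteq> {} \<longrightarrow> \<not> bridgeless G B)"

section \<open>Circuits are the edge sets of simple cycles\<close>

lemma cyclic_crossing:
  fixes p :: "nat \<Rightarrow> bool"
  assumes "i < n" "p i" "\<not> p (Suc i mod n)"
  shows "\<exists>j<n. \<not> p j \<and> p (Suc j mod n)"
proof (rule ccontr)
  assume no: "\<not> (\<exists>j<n. \<not> p j \<and> p (Suc j mod n))"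
  have "\<not> p ((Suc i + t) mod n)" for t
  proof (induction t)
    case 0
    then show ?case using assms(3) by simp
  next
    case (Suc t)
    have "(Suc i + t) mod n < n" using assms(1) by simp
    then have "\<not> p (Suc ((Suc i + t) mod n) mod n)" using Suc no by blast
    then show ?case by (simp add: mod_Suc_eq)
  qed
  \<comment> \<open>From position \<open>Suc i\<close>, another \<open>n - 1\<close> steps complete
    the round and return to \<open>i\<close>.\<close>
  from this[of "n - 1"] show False using assms(1,2) by simp
qed

lemma is_cycle_coboundary:
  assumes "is_cycle G Cy" "i < length Cy"
  shows "snd (Cy ! i) \<in> coboundary G U \<longleftrightarrow>
    (fst (Cy ! i) \<in> U) \<noteq> (fst (Cy ! (Suc i mod length Cy)) \<in> U)"
proof -
  have "{tail G (snd (Cy ! i)), head G (snd (Cy ! i))} = {fst (Cy ! i), fst (Cy ! (Suc i mod length Cy))}"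
    "snd (Cy ! i) \<in> arcs G"
    using assms by (auto simp: is_cycle_def)
  then show ?thesis by (auto simp: coboundary_def doubleton_eq_iff)
qed

lemma is_cycle_bridgeless:
  assumes "is_cycle G Cy"
  shows "bridgeless G (cycle_edges Cy)"
  unfolding bridgeless_def
proof (intro conjI allI notI)
  show "cycle_edges Cy \<subseteq> arcs G" using assms by (simp add: is_cycle_def cycle_edges_def)
  fix U f assume f: "coboundary G U \<inter> cycle_edges Cy = {f}"
  then have "f \<in> set (map snd Cy)" by (auto simp: cycle_edges_def)
  then obtain i where i: "i < length Cy" "f = snd (Cy ! i)" by (auto simp: in_set_conv_nth)
  let ?p = "\<lambda>i. fst (Cy ! i) \<in> U"
  have "?p i \<noteq> ?p (Suc i mod length Cy)"
    using is_cycle_coboundary[OF assms i(1), of U] f i(2) by blast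
  \<comment> \<open>The crossing lemma is used for \<open>?p\<close> or for its negation, according
    to the side of position \<open>i\<close>. It yields a crossing in the opposite direction, hence
    at another position and, edges being distinct, at another edge.\<close>
  then obtain j where j: "j < length Cy" "?p j \<noteq> ?p i" "?p j \<noteq> ?p (Suc j mod length Cy)"
    using cyclic_crossing[of i "length Cy" ?p] cyclic_crossing[of i "length Cy" "\<lambda>i. \<not> ?p i"] i(1)
    by (cases "?p i") auto
  have "snd (Cy ! j) \<in> coboundary G U \<inter> cycle_edges Cy"
    using is_cycle_coboundary[OF assms j(1), of U] j by (auto simp: cycle_edges_def)
  then have "snd (Cy ! j) = snd (Cy ! i)" using f i(2) by simp
  moreover have "distinct (map snd Cy)" using assms by (simp add: is_cycle_def)
  ultimately have "i = j" using i(1) j(1) by (simp add: distinct_conv_nth) blast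
  then show False using j(2) by simp
qed

text \<open>The vertices strictly after position \<open>i\<close> up to position \<open>j\<close> span an arc of the cycle; only the
  edges at positions \<open>i\<close> and \<open>j\<close> leave it.\<close>

lemma simple_cycle_two_edge_cut:
  assumes "simple_cycle G Cy" "i < j" "j < length Cy"
  obtains U where "coboundary G U \<inter> cycle_edges Cy = {snd (Cy ! i), snd (Cy ! j)}"
proof -
  let ?n = "length Cy"
  have cy: "is_cycle G Cy" and dist: "distinct (map fst Cy)"
    using assms(1) by (simp_all add: simple_cycle_def)
  define U where "U = (\<lambda>t. fst (Cy ! t)) ` {i<..j}"
  have U: "fst (Cy ! t) \<in> U \<longleftrightarrow> i < t \<and> t \<le> j" if "t < ?n" for t
  proof
    assume "fst (Cy ! t) \<in> U"
    then obtain s where s: "i < s" "s \<le> j" "fst (Cy ! t) = fst (Cy ! s)" by (auto simp: U_def)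
    moreover have "s < ?n" using s assms(3) by simp
    ultimately have "t = s" using dist that nth_eq_iff_index_eq[OF dist, of t s] by simp
    then show "i < t \<and> t \<le> j" using s by simp
  qed (auto simp: U_def)
  have cob: "snd (Cy ! t) \<in> coboundary G U \<longleftrightarrow> t = i \<or> t = j" if t: "t < ?n" for t
  proof (cases "Suc t = ?n")
    case True
    moreover have "0 < ?n" using assms(3) by linarith
    ultimately have "Suc t mod ?n = 0" "0 < ?n" by simp_all
    then show ?thesis
      using is_cycle_coboundary[OF cy t, of U] U[OF t] U[of 0] assms(2,3) True by auto
  next
    case False
    then have "Suc t mod ?n = Suc t" "Suc t < ?n" using t by auto
    then show ?thesis
      using is_cycle_coboundary[OF cy t, of U] U[OF t] U[of "Suc t"] assms(2,3) by auto
  qed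
  have "coboundary G U \<inter> cycle_edges Cy = {snd (Cy ! i), snd (Cy ! j)}"
  proof (intro equalityI subsetI)
    fix f assume "f \<in> coboundary G U \<inter> cycle_edges Cy"
    then obtain t where "t < ?n" "f = snd (Cy ! t)" "f \<in> coboundary G U"
      by (auto simp: cycle_edges_def in_set_conv_nth)
    then show "f \<in> {snd (Cy ! i), snd (Cy ! j)}" using cob by auto
  next
    fix f assume "f \<in> {snd (Cy ! i), snd (Cy ! j)}"
    then show "f \<in> coboundary G U \<inter> cycle_edges Cy"
      using cob assms(2,3) by (auto simp: cycle_edges_def)
  qed
  then show thesis using that by blast
qed

text \<open>If a nonempty part \<open>B\<close> contains \<open>f\<close> and misses
  \<open>e\<close>, the cut that meets the cycle in exactly \<open>f\<close> and \<open>e\<close>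
  meets \<open>B\<close> in \<open>f\<close> alone.\<close>

lemma simple_cycle_circuit:
  assumes "simple_cycle G Cy"
  shows "circuit G (cycle_edges Cy)"
  unfolding circuit_def
proof (intro conjI allI impI notI)
  have cy: "is_cycle G Cy" using assms by (simp add: simple_cycle_def)
  show "bridgeless G (cycle_edges Cy)" by (rule is_cycle_bridgeless[OF cy])
  show False if "cycle_edges Cy = {}" using that cy by (simp add: is_cycle_def cycle_edges_def)
  fix B assume B: "B \<subset> cycle_edges Cy" "B \<noteq> {}" "bridgeless G B"
  then obtain f e where fe: "f \<in> B" "e \<in> cycle_edges Cy" "e \<notin> B" by blast
  then have "f \<in> set (map snd Cy)" "e \<in> set (map snd Cy)"
    using B(1) by (auto simp: cycle_edges_def)
  then obtain i j where ij: "i < length Cy" "j < length Cy" "f = snd (Cy ! i)" "e = snd (Cy ! j)"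
    unfolding in_set_conv_nth by auto
  then have "i \<noteq> j" using fe by auto
  obtain U where "coboundary G U \<inter> cycle_edges Cy = {f, e}"
  proof (cases "i < j")
    case True
    then show thesis using simple_cycle_two_edge_cut[OF assms True ij(2)] that ij by metis
  next
    case False
    then have "j < i" using \<open>i \<noteq> j\<close> by simp
    then show thesis
      using simple_cycle_two_edge_cut[OF assms _ ij(1)] that ij by (metis insert_commute)
  qed
  then have "coboundary G U \<inter> B = {f}" using fe B(1) by blast
  then show False using B(3) by (simp add: bridgeless_def)
qed

text \<open>Without loops in \<open>C\<close>, a walk can always go on along an edge different from
  the one just used. Since \<open>C\<close> is finite, some vertex repeats, and the first repetition
  closes a simple cycle.\<close>

lemma bridgeless_contains_simple_cycle:
  assumes "bridgeless G C" "C \<noteq> {}" "finite C"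
  obtains Cy where "simple_cycle G Cy" "cycle_edges Cy \<subseteq> C"
proof (cases "\<exists>f\<in>C. tail G f = head G f")
  case True
  then obtain f where f: "f \<in> C" "tail G f = head G f" by blast
  then have "simple_cycle G [(tail G f, f)]" "cycle_edges [(tail G f, f)] \<subseteq> C"
    using assms(1) by (auto simp: simple_cycle_def is_cycle_def cycle_edges_def bridgeless_def)
  then show thesis using that by blast
next
  case False
  define ends where "ends f = {tail G f, head G f}" for f
  \<comment> \<open>A pair means leaving the vertex along the edge. With \<open>w\<close> the other
    end, the edge crosses the cut around {w}, and bridgelessness supplies a second edge of
    \<open>C\<close> at \<open>w\<close>.\<close>
  have "\<exists>y. (snd y \<in> C \<and> fst y \<in> ends (snd y)) \<and> (ends (snd x) = {fst x, fst y} \<and> snd y \<noteq> snd x)"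
    if x: "snd x \<in> C \<and> fst x \<in> ends (snd x)" for x
  proof -
    obtain w where w: "ends (snd x) = {fst x, w}"
      using x unfolding ends_def by (metis insert_commute insert_iff singletonD)
    have "snd x \<in> coboundary G {w} \<inter> C"
      using x w False assms(1)
      by (auto simp: ends_def coboundary_def bridgeless_def doubleton_eq_iff)
    moreover have "coboundary G {w} \<inter> C \<noteq> {snd x}"
      using assms(1) by (simp add: bridgeless_def)
    ultimately obtain f where "f \<in> coboundary G {w} \<inter> C" "f \<noteq> snd x" by blast
    then show ?thesis
      using w by (intro exI[of _ "(w, f)"]) (auto simp: ends_def coboundary_def)
  qed
  moreover have "\<exists>x. snd x \<in> C \<and> fst x \<in> ends (snd x)"
    using assms(2) by (auto simp: ends_def)
  ultimately obtain s where s: "\<And>n. snd (s n) \<in> C" "\<And>n. ends (snd (s n)) = {fst (s n), fst (s (Suc n))}"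
    "\<And>n. snd (s (Suc n)) \<noteq> snd (s n)"
    using dependent_nat_choice[of "\<lambda>_ x. snd x \<in> C \<and> fst x \<in> ends (snd x)"
        "\<lambda>_ x y. ends (snd x) = {fst x, fst y} \<and> snd y \<noteq> snd x"] by metis
  define v where "v n = fst (s n)" for n
  define a where "a n = snd (s n)" for n
  have ends: "ends (a n) = {v n, v (Suc n)}" "a n \<in> C" "a (Suc n) \<noteq> a n" for n
    using s by (simp_all add: v_def a_def)
  have "range v \<subseteq> tail G ` C \<union> head G ` C"
  proof
    fix x assume "x \<in> range v"
    then obtain n where "x = v n" by blast
    then have "x \<in> ends (a n)" "a n \<in> C" using ends by auto
    then show "x \<in> tail G ` C \<union> head G ` C" by (auto simp: ends_def)
  qed
  then have "finite (range v)" using assms(3) finite_subset by blast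
  then have "\<not> inj v" using finite_imageD infinite_UNIV_nat by blast
  then have ex: "\<exists>j i. i < j \<and> v i = v j"
    unfolding inj_def by (metis linorder_neqE_nat)
  define j where "j = (LEAST j. \<exists>i<j. v i = v j)"
  have "\<exists>i<j. v i = v j" unfolding j_def by (rule LeastI_ex) (use ex in blast)
  then obtain i where i: "i < j" "v i = v j" by blast
  have least: "v x \<noteq> v y" if "x < y" "y < j" for x y
    using not_less_Least[of y "\<lambda>j. \<exists>i<j. v i = v j"] that unfolding j_def by blast
  then have inj: "inj_on v {i..<j}"
    by (intro inj_onI) (metis atLeastLessThan_iff linorder_neqE_nat)
  \<comment> \<open>A repeated edge would be traversed backwards, since its starting vertices
    differ. Minimality of \<open>j\<close> then forces the two uses to be consecutive, contrary to
    the choice of the walk.\<close>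
  have inj_a: "inj_on a {i..<j}"
  proof -
    have "a x \<noteq> a y" if xy: "x < y" "y < j" for x y
    proof
      assume eq: "a x = a y"
      then have "{v x, v (Suc x)} = {v y, v (Suc y)}" using ends(1) by metis
      then have "v (Suc x) = v y" using least[OF xy] by (auto simp: doubleton_eq_iff)
      then have "Suc x = y" using least[of "Suc x" y] xy by (cases "Suc x = y") auto
      then show False using eq ends(3)[of x] by simp
    qed
    then show ?thesis by (intro inj_onI) (metis atLeastLessThan_iff linorder_neqE_nat)
  qed
  define Cy where "Cy = map s [i..<j]"
  have len: "length Cy = j - i" by (simp add: Cy_def)
  have nth: "fst (Cy ! t) = v (i + t)" "snd (Cy ! t) = a (i + t)" if "t < length Cy" for t
    using that by (simp_all add: Cy_def v_def a_def)
  have fst_next: "fst (Cy ! (Suc t mod length Cy)) = v (i + Suc t)" if t: "t < length Cy" for t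
  proof (cases "Suc t = length Cy")
    case True
    then have "i + Suc t = j" using len i(1) by simp
    then show ?thesis using True nth[of 0] i len by simp
  next
    case False
    then have "Suc t < length Cy" using t by simp
    then show ?thesis using nth[of "Suc t"] by simp
  qed
  have maps: "map fst Cy = map v [i..<j]" "map snd Cy = map a [i..<j]"
    by (simp_all add: Cy_def v_def a_def)
  have "is_cycle G Cy"
    unfolding is_cycle_def
  proof (intro conjI allI impI)
    show "Cy \<noteq> []" using len i(1) by auto
    show "set (map snd Cy) \<subseteq> arcs G"
      using ends(2) assms(1) unfolding maps by (auto simp: bridgeless_def)
    show "distinct (map snd Cy)" unfolding maps using inj_a by (simp add: distinct_map)
    fix t assume t: "t < length Cy"
    show "{tail G (snd (Cy ! t)), head G (snd (Cy ! t))} = {fst (Cy ! t), fst (Cy ! (Suc t mod length Cy))}"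
      using ends(1)[of "i + t"] unfolding fst_next[OF t] nth[OF t] ends_def by simp
  qed
  moreover have "distinct (map fst Cy)" unfolding maps using inj by (simp add: distinct_map)
  moreover have "cycle_edges Cy \<subseteq> C" unfolding cycle_edges_def maps using ends(2) by auto
  ultimately show thesis using that by (simp add: simple_cycle_def)
qed

lemma circuit_iff_simple_cycle:
  assumes "finite (arcs G)"
  shows "circuit G C \<longleftrightarrow> (\<exists>Cy. simple_cycle G Cy \<and> cycle_edges Cy = C)"
proof
  assume C: "circuit G C"
  then have "finite C" using assms finite_subset by (auto simp: circuit_def bridgeless_def)
  then obtain Cy where Cy: "simple_cycle G Cy" "cycle_edges Cy \<subseteq> C"
    using C bridgeless_contains_simple_cycle unfolding circuit_def by metis
  have "bridgeless G (cycle_edges Cy)" "cycle_edges Cy \<noteq> {}"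
    using simple_cycle_circuit[OF Cy(1)] by (simp_all add: circuit_def)
  then have "cycle_edges Cy = C" using C Cy(2) unfolding circuit_def by blast
  then show "\<exists>Cy. simple_cycle G Cy \<and> cycle_edges Cy = C" using Cy(1) by blast
qed (use simple_cycle_circuit in blast)

text \<open>A circuit is connected: if a cut missed \<open>C\<close> with edges of \<open>C\<close>
  on both sides, the part inside \<open>U\<close> would be bridgeless, as its intersections with
  cuts are those of \<open>C\<close> with cuts of the form \<open>S \<inter> U\<close>. Minimality
  excludes this.\<close>

lemma circuit_one_side:
  assumes "circuit G C" "coboundary G U \<inter> C = {}" "f \<in> C" "g \<in> C"
  shows "tail G f \<in> U \<longleftrightarrow> tail G g \<in> U"
proof (rule ccontr)
  assume ne: "\<not> ?thesis"
  let ?B = "{h \<in> C. tail G h \<in> U}"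
  have C: "C \<subseteq> arcs G" using assms(1) by (simp add: circuit_def bridgeless_def)
  then have th: "tail G h \<in> U \<longleftrightarrow> head G h \<in> U" if "h \<in> C" for h
    using that assms(2) by (auto simp: coboundary_def)
  have "coboundary G S \<inter> ?B = coboundary G (S \<inter> U) \<inter> C" for S
    using th by (auto simp: coboundary_def)
  then have "bridgeless G ?B"
    using assms(1) C by (auto simp: circuit_def bridgeless_def)
  moreover have "?B \<subset> C" "?B \<noteq> {}" using ne assms(3,4) by blast+
  ultimately show False using assms(1) unfolding circuit_def by blast
qed

section \<open>Cycle minors and deletion\<close>

definition edge_subgraph :: "('v, 'e) pre_digraph \<Rightarrow> 'e set \<Rightarrow> ('v, 'e) pre_digraph" where
  "edge_subgraph G C = \<lparr>verts = tail G ` C \<union> head G ` C, arcs = C, tail = tail G, head = head G\<rparr>"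

lemma edge_subgraph_simps [simp]:
  "verts (edge_subgraph G C) = tail G ` C \<union> head G ` C" "arcs (edge_subgraph G C) = C"
  "tail (edge_subgraph G C) = tail G" "head (edge_subgraph G C) = head G"
  by (simp_all add: edge_subgraph_def)

lemma ordered_oriented_graph_circuit:
  assumes "ordered_oriented_graph G r" "circuit G C"
  shows "ordered_oriented_graph (edge_subgraph G C) (induced_order (edge_subgraph G C) r)"
proof -
  note G = ordered_oriented_graphD[OF assms(1)]
  have C: "C \<subseteq> arcs G" "C \<noteq> {}" using assms(2) by (auto simp: circuit_def bridgeless_def)
  then have fin: "fin_digraph (edge_subgraph G C)"
    using finite_subset[OF C(1) G(4)] by (simp add: fin_digraph_def fin_digraph_axioms_def wf_digraph_def)
  have "coboundary (edge_subgraph G C) U \<noteq> {}" if U: "U \<subset> tail G ` C \<union> head G ` C" "U \<noteq> {}" for U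
  proof
    assume "coboundary (edge_subgraph G C) U = {}"
    moreover have "coboundary (edge_subgraph G C) U = coboundary G U \<inter> C"
      using C(1) by (auto simp: coboundary_def)
    ultimately have e: "coboundary G U \<inter> C = {}" by simp
    have th: "tail G h \<in> U \<longleftrightarrow> head G h \<in> U" if "h \<in> C" for h
      using that e C(1) by (auto simp: coboundary_def)
    have side: "(\<forall>f\<in>C. tail G f \<in> U) \<or> (\<forall>f\<in>C. tail G f \<notin> U)"
      using circuit_one_side[OF assms(2) e] by blast
    obtain u w where "u \<in> U" "u \<in> tail G ` C \<union> head G ` C" "w \<in> tail G ` C \<union> head G ` C" "w \<notin> U"
      using U by blast
    then show False using th side by auto
  qed
  then have "Digraph_Component.connected (edge_subgraph G C)"
    using C(2) fin by (subst connected_iff_coboundary) (simp_all add: fin_digraph_def)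
  then show ?thesis
    using C(1) fin by (intro ordered_oriented_graph_induced[OF assms(1)]) simp_all
qed

definition cycle_good ::
    "('v, 'e) fproperty \<Rightarrow> ('v, 'e) pre_digraph \<Rightarrow> 'e rel \<Rightarrow> ('e \<times> sign) set \<Rightarrow> 'e set \<Rightarrow> bool" where
  "cycle_good Q G r \<O> C \<longleftrightarrow> Q (edge_subgraph G C) (induced_order (edge_subgraph G C) r)
     (induced_fourientation (edge_subgraph G C) \<O>)"

lemma cycle_property_iff_circuits:
  assumes "cycle_property Q" "ordered_oriented_graph G r" "\<O> \<in> fourientations G"
  shows "Q G r \<O> \<longleftrightarrow> (\<forall>C. circuit G C \<longrightarrow> cycle_good Q G r \<O> C)"
proof -
  have "cycle_minor G Cy = edge_subgraph G (cycle_edges Cy)" for Cy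
    by (simp add: cycle_minor_def edge_subgraph_def)
  then show ?thesis
    using assms circuit_iff_simple_cycle[OF ordered_oriented_graphD(4)[OF assms(2)]]
    unfolding cycle_property_def cycle_good_def by metis
qed

lemma bridgeless_del_arc: "bridgeless (pre_digraph.del_arc G e) C \<longleftrightarrow> bridgeless G C \<and> e \<notin> C"
proof (cases "e \<in> C")
  case True
  then show ?thesis by (auto simp: bridgeless_def pre_digraph.del_arc_simps)
next
  case False
  then have "coboundary (pre_digraph.del_arc G e) U \<inter> C = coboundary G U \<inter> C" for U
    by (auto simp: coboundary_del_arc)
  then show ?thesis using False by (auto simp: bridgeless_def pre_digraph.del_arc_simps)
qed

lemma circuit_del_arc: "circuit (pre_digraph.del_arc G e) C \<longleftrightarrow> circuit G C \<and> e \<notin> C"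
  unfolding circuit_def bridgeless_del_arc by blast

lemma cycle_good_irrelevant:
  assumes "e \<notin> C"
  shows "cycle_good Q G r (\<O> \<union> {e} \<times> S) C \<longleftrightarrow> cycle_good Q G r \<O> C"
proof -
  have "induced_fourientation (edge_subgraph G C) (\<O> \<union> {e} \<times> S) = induced_fourientation (edge_subgraph G C) \<O>"
    using assms by (auto simp: induced_fourientation_def edge_orientations_def)
  then show ?thesis by (simp add: cycle_good_def)
qed

text \<open>Dual to the splitting for cuts. A circuit avoiding \<open>e\<close> spans literally the
  same subgraph before and after deletion, so no normal form in the manner of \<open>bond\<close> is
  needed.\<close>

lemma cycle_property_split_arc:
  assumes "cycle_property Q" "ordered_oriented_graph G r" "e \<in> arcs G" "\<not> isthmus G e"
    "\<O> \<subseteq> (arcs G - {e}) \<times> UNIV"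
  shows "Q G r (\<O> \<union> {e} \<times> S) \<longleftrightarrow>
    Q (pre_digraph.del_arc G e) (induced_order (pre_digraph.del_arc G e) r) \<O> \<and>
    (\<forall>C. circuit G C \<and> e \<in> C \<longrightarrow> cycle_good Q G r (\<O> \<union> {e} \<times> S) C)"
proof -
  let ?H = "pre_digraph.del_arc G e"
  have "\<O> \<in> fourientations ?H" "\<O> \<union> {e} \<times> S \<in> fourientations G"
    using assms(3,5) by (auto simp: fourientations_def edge_orientations_def pre_digraph.del_arc_simps)
  moreover have "cycle_good Q ?H (induced_order ?H r) \<O> C \<longleftrightarrow> cycle_good Q G r (\<O> \<union> {e} \<times> S) C"
    if "circuit ?H C" for C
  proof -
    have C: "e \<notin> C" "C \<subseteq> arcs ?H"
      using that circuit_del_arc[of G e C] by (simp_all add: circuit_def bridgeless_def)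
    moreover have "edge_subgraph ?H C = edge_subgraph G C"
      by (simp add: edge_subgraph_def pre_digraph.del_arc_simps)
    ultimately show ?thesis
      unfolding cycle_good_irrelevant[OF C(1)] by (simp add: cycle_good_def induced_induced)
  qed
  ultimately show ?thesis
    using cycle_property_iff_circuits[OF assms(1)] assms(2) ordered_oriented_graph_del_arc[OF assms(2,4)]
      circuit_del_arc by metis
qed

section \<open>Consequences of T1 and T2 for cycle properties\<close>

lemma directed_cycle_not_blocked:
  assumes "directed_cycle G D" "set (map snd D) \<subseteq> \<O>" "(e, s) \<in> set (map snd D)"
    "blocked_side G \<O> W" "source G (e, s) \<in> W" "target G (e, s) \<notin> W"
  shows False
proof -
  let ?n = "length D"
  obtain i where i: "i < ?n" "snd (D ! i) = (e, s)"
    using assms(3) unfolding in_set_conv_nth by auto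
  let ?p = "\<lambda>j. fst (D ! j) \<in> W"
  have st: "source G (snd (D ! j)) = fst (D ! j)" "target G (snd (D ! j)) = fst (D ! (Suc j mod ?n))"
    if "j < ?n" for j
    using assms(1) that by (simp_all add: directed_cycle_def)
  have "?p i" "\<not> ?p (Suc i mod ?n)"
    using st[OF i(1)] i(2) assms(5,6) by simp_all
  then obtain j where j: "j < ?n" "\<not> ?p j" "?p (Suc j mod ?n)"
    using cyclic_crossing[OF i(1), of ?p] by blast
  obtain f t where ft: "snd (D ! j) = (f, t)" by (cases "snd (D ! j)") simp
  then have mem: "(f, t) \<in> set (map snd D)" using j(1) by (metis length_map nth_map nth_mem)
  then have "(f, t) \<in> edge_orientations G" using assms(1) unfolding directed_cycle_def by blast
  then have "f \<in> arcs G" by (simp add: edge_orientations_def)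
  moreover have "source G (f, t) \<notin> W" "target G (f, t) \<in> W"
    using st[OF j(1)] j ft by simp_all
  ultimately have "f \<in> coboundary G W" "source G (f, opp t) \<in> W"
    using coboundary_source_target[of f G W t] by simp_all
  then have "(f, t) \<notin> \<O>" using assms(4) unfolding blocked_side_def by fastforce
  then show False using mem assms(2) by blast
qed

lemma source_target_ends: "{source G a, target G a} = {tail G (fst a), head G (fst a)}"
  by (cases a; cases "snd a") auto

lemma directed_cycle_bridgeless:
  assumes "directed_cycle G D"
  shows "bridgeless G (fst ` set (map snd D))"
proof -
  let ?Cy = "map (\<lambda>x. (fst x, fst (snd x))) D"
  have edges: "map snd ?Cy = map (fst \<circ> snd) D" by simp
  have D: "D \<noteq> []" "set (map snd D) \<subseteq> edge_orientations G" "distinct (map (fst \<circ> snd) D)"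
    using assms by (simp_all add: directed_cycle_def)
  have "{tail G (snd (?Cy ! i)), head G (snd (?Cy ! i))} = {fst (?Cy ! i), fst (?Cy ! (Suc i mod length ?Cy))}"
    if "i < length ?Cy" for i
  proof -
    have "i < length D" using that by simp
    moreover from this have "0 < length D" by linarith
    ultimately have i: "i < length D" "Suc i mod length D < length D" by simp_all
    have "source G (snd (D ! i)) = fst (D ! i)" "target G (snd (D ! i)) = fst (D ! (Suc i mod length D))"
      using assms i(1) by (simp_all add: directed_cycle_def)
    then show ?thesis
      using source_target_ends[of G "snd (D ! i)"] i by simp
  qed
  moreover have "set (map snd ?Cy) \<subseteq> arcs G"
    using D(2) by (auto simp: edge_orientations_def)
  ultimately have "is_cycle G ?Cy"
    using D(1,3) unfolding is_cycle_def edges by simp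
  moreover have "cycle_edges ?Cy = fst ` set (map snd D)"
    by (simp add: cycle_edges_def image_image)
  ultimately show ?thesis using is_cycle_bridgeless by metis
qed

text \<open>The directed cycle from T1 need not be simple, but its edges form a nonempty bridgeless
  subset of the circuit \<open>C\<close>. By minimality it runs through every edge of
  \<open>C\<close>.\<close>

lemma cycle_bad_imp_directed_cycle:
  assumes "Tutte_cycle_property Q" "ordered_oriented_graph G r" "circuit G C" "\<not> cycle_good Q G r \<O> C"
  obtains D where "directed_cycle G D" "set (map snd D) \<subseteq> \<O>" "fst ` set (map snd D) = C"
proof -
  let ?H = "edge_subgraph G C"
  have C: "C \<subseteq> arcs G" using assms(3) by (simp add: circuit_def bridgeless_def)
  obtain D where D: "potential_cycle ?H (induced_fourientation ?H \<O>) D"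
    using assms(1,4) ordered_oriented_graph_circuit[OF assms(2,3)] induced_fourientation_in
    unfolding Tutte_cycle_property_def cycle_good_def by blast
  have "source ?H a = source G a" "target ?H a = target G a" for a
    by (cases a; cases "snd a"; simp)+
  then have dc: "directed_cycle G D" and sub: "set (map snd D) \<subseteq> C \<times> UNIV"
    using D C unfolding potential_cycle_def directed_cycle_def edge_orientations_def
    by (simp_all del: set_map) blast+
  have "set (map snd D) \<subseteq> \<O>"
    using D unfolding potential_cycle_def induced_fourientation_def by blast
  moreover have "fst ` set (map snd D) = C"
  proof (rule ccontr)
    assume "fst ` set (map snd D) \<noteq> C"
    then have "fst ` set (map snd D) \<subset> C" using sub by auto
    moreover have "fst ` set (map snd D) \<noteq> {}" using dc by (simp add: directed_cycle_def)
    ultimately show False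
      using directed_cycle_bridgeless[OF dc] assms(3) unfolding circuit_def by blast
  qed
  ultimately show thesis using that dc by blast
qed

text \<open>A bad circuit through \<open>e\<close> would be traversed by a directed cycle using
  every one of its edges, but no orientation of \<open>e\<close> is available.\<close>

lemma Tutte_cycle_unoriented:
  assumes "Tutte_cycle_property Q" "ordered_oriented_graph G r" "e \<in> arcs G" "\<not> isthmus G e"
    "\<O> \<subseteq> (arcs G - {e}) \<times> UNIV"
  shows "Q G r (\<O> \<union> {e} \<times> {}) \<longleftrightarrow>
    Q (pre_digraph.del_arc G e) (induced_order (pre_digraph.del_arc G e) r) \<O>"
proof -
  have "cycle_good Q G r (\<O> \<union> {e} \<times> {}) C" if C: "circuit G C" "e \<in> C" for C
  proof (rule ccontr)
    assume bad: "\<not> cycle_good Q G r (\<O> \<union> {e} \<times> {}) C"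
    obtain D where "directed_cycle G D" "set (map snd D) \<subseteq> \<O> \<union> {e} \<times> {}" "fst ` set (map snd D) = C"
      by (rule cycle_bad_imp_directed_cycle[OF assms(1,2) C(1) bad])
    then show False using C(2) assms(5) by fastforce
  qed
  then show ?thesis
    using cycle_property_split_arc[OF _ assms(2-5), of Q "{}"] assms(1)
    unfolding Tutte_cycle_property_def by blast
qed

text \<open>The minors exchange their origin compared with the cut case: T2(c) ties the contraction
  to the bioriented state, T1 the deletion to the unoriented one. The states attached to the two
  minors remain the same, so the two cases can be combined.\<close>

lemma Tutte_cycle_ordinary:
  assumes "Tutte_cycle_property Q" "ordered_oriented_graph G r" "ordinary_arc G e" "maximum_edge G r e"
    "\<O> \<subseteq> (arcs G - {e}) \<times> UNIV"
  defines "p \<equiv> Q (pre_digraph.del_arc G e) (induced_order (pre_digraph.del_arc G e) r) \<O>"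
    and "q \<equiv> Q (contract G {e}) (induced_order (contract G {e}) r) \<O>"
  shows "Q G r (\<O> \<union> {e} \<times> UNIV) \<longleftrightarrow> q"
    and "Q G r (\<O> \<union> {e} \<times> {}) \<longleftrightarrow> p"
    and "q \<Longrightarrow> Q G r (\<O> \<union> {e} \<times> {s})"
    and "\<not> q \<Longrightarrow> p \<Longrightarrow> Q G r (\<O> \<union> {e} \<times> {Plus}) \<noteq> Q G r (\<O> \<union> {e} \<times> {Minus})"
    and "Q G r (\<O> \<union> {e} \<times> S) \<Longrightarrow> p"
    and "p \<Longrightarrow> \<not> Q G r (\<O> \<union> {e} \<times> {s}) \<Longrightarrow>
      \<exists>D. directed_cycle G D \<and> set (map snd D) \<subseteq> \<O> \<union> {e} \<times> {s} \<and> (e, s) \<in> set (map snd D)"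
proof -
  have e: "e \<in> arcs G" "\<not> isthmus G e" "\<not> loop G e" using assms(3) by (simp_all add: ordinary_arc_def)
  have cyc: "cycle_property Q" using assms(1) by (simp add: Tutte_cycle_property_def)
  note split = cycle_property_split_arc[OF cyc assms(2) e(1,2) assms(5)]
  have "\<O> \<in> fourientations (contract G {e})"
    using assms(5) by (simp add: fourientations_def edge_orientations_def)
  then have T2: "q \<longrightarrow> Q G r (\<O> \<union> {(e, Plus)}) \<and> Q G r (\<O> \<union> {(e, Minus)})"
    "\<not> q \<and> Q G r \<O> \<longrightarrow> Q G r (\<O> \<union> {(e, Plus)}) \<noteq> Q G r (\<O> \<union> {(e, Minus)})"
    "q \<longleftrightarrow> Q G r (\<O> \<union> {(e, Plus), (e, Minus)})"
    using assms(1,2,4) e unfolding Tutte_cycle_property_def Let_def q_def by blast+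
  have UNIV: "{e} \<times> UNIV = {(e, Plus), (e, Minus)}"
    using sign.exhaust by auto
  show "Q G r (\<O> \<union> {e} \<times> UNIV) \<longleftrightarrow> q" using T2(3) by (simp add: UNIV)
  show un: "Q G r (\<O> \<union> {e} \<times> {}) \<longleftrightarrow> p"
    unfolding p_def by (rule Tutte_cycle_unoriented[OF assms(1,2) e(1,2) assms(5)])
  show "Q G r (\<O> \<union> {e} \<times> {s})" if q using T2(1) that by (cases s) simp_all
  show "Q G r (\<O> \<union> {e} \<times> {Plus}) \<noteq> Q G r (\<O> \<union> {e} \<times> {Minus})" if "\<not> q" p
    using T2(2) that un by simp
  show p if "Q G r (\<O> \<union> {e} \<times> S)"
    using that unfolding split p_def by simp
  assume p and bad: "\<not> Q G r (\<O> \<union> {e} \<times> {s})"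
  then obtain C where C: "circuit G C" "e \<in> C"
    and Cb: "\<not> cycle_good Q G r (\<O> \<union> {e} \<times> {s}) C"
    unfolding split p_def by blast
  obtain D where D: "directed_cycle G D" "set (map snd D) \<subseteq> \<O> \<union> {e} \<times> {s}" "fst ` set (map snd D) = C"
    by (rule cycle_bad_imp_directed_cycle[OF assms(1,2) C(1) Cb])
  have "e \<in> fst ` set (map snd D)" using D(3) C(2) by simp
  then obtain t where t: "(e, t) \<in> set (map snd D)" by (metis imageE prod.collapse)
  \<comment> \<open>Only one orientation of \<open>e\<close> is present, so the cycle uses
    \<open>e\<close> in this direction.\<close>
  then have "t = s" using D(2) assms(5) by blast
  then show "\<exists>D. directed_cycle G D \<and> set (map snd D) \<subseteq> \<O> \<union> {e} \<times> {s} \<and> (e, s) \<in> set (map snd D)"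
    using D t by blast
qed

section \<open>Loops and isthmuses for cycle properties\<close>

definition loop_good :: "('v, 'e) fproperty \<Rightarrow> sign set \<Rightarrow> bool" where
  "loop_good Q S \<longleftrightarrow> (\<forall>G r e. ordered_oriented_graph G r \<longrightarrow> card (verts G) = 1 \<longrightarrow> arcs G = {e} \<longrightarrow>
     Q G r ({e} \<times> S))"

lemma loop_good_iff:
  fixes Q :: "('v::infinite, 'e::infinite) fproperty"
  assumes "fourientation_property Q" "ordered_oriented_graph G r" "card (verts G) = 1" "arcs G = {e}"
  shows "Q G r ({e} \<times> S) \<longleftrightarrow> loop_good Q S"
proof
  assume good: "Q G r ({e} \<times> S)"
  show "loop_good Q S"
    unfolding loop_good_def
  proof (intro allI impI)
    fix G' :: "('v, 'e) pre_digraph" and r' e'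
    assume G': "ordered_oriented_graph G' r'" "card (verts G') = 1" "arcs G' = {e'}"
    have "tail G e = head G e" "tail G' e' = head G' e'"
      using assms(3) G'(2) single_arc_verts[OF assms(2,4)] single_arc_verts[OF G'(1,3)]
      by (auto simp: card_1_singleton_iff doubleton_eq_iff)
    then have "fourientation_isomorphic G r ({e} \<times> S) G' r' ({e'} \<times> S)"
      using single_arc_verts[OF assms(2,4)] single_arc_verts[OF G'(1,3)] assms(2,4) G'(1,3)
      by (intro fourientation_isomorphic_single_arc) auto
    then show "Q G' r' ({e'} \<times> S)"
      using good assms(1,2) G'(1) single_arc_fourientation[OF assms(4)] single_arc_fourientation[OF G'(3)]
      unfolding fourientation_property_def by blast
  qed
qed (use assms in \<open>auto simp: loop_good_def\<close>)

lemma bad_loop_set_iff: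
  assumes "S \<in> {{Minus}, {Plus}, {Minus, Plus}}"
  shows "S \<in> bad_loop_set Q \<longleftrightarrow> \<not> loop_good Q S"
  using assms unfolding bad_loop_set_def loop_good_def by blast

text \<open>The reason why \<open>l\<close> enters \<open>loop_weight\<close> without an
  indicator.\<close>

lemma loop_good_unoriented:
  fixes Q :: "('v::infinite, 'e::infinite) fproperty"
  assumes "Tutte_cycle_property Q"
  shows "loop_good Q {}"
  unfolding loop_good_def
proof (intro allI impI)
  fix G :: "('v, 'e) pre_digraph" and r e
  assume G: "ordered_oriented_graph G r" "card (verts G) = 1" "arcs G = {e}"
  have "\<not> potential_cycle G ({e} \<times> {}) D" for D
    by (auto simp: potential_cycle_def directed_cycle_def)
  then show "Q G r ({e} \<times> {})"
    using assms G(1) single_arc_fourientation[OF G(3)] unfolding Tutte_cycle_property_def by blast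
qed

text \<open>No cut contains a loop, so {e} is bridgeless; by minimality it is the only circuit
  through \<open>e\<close>, and its minor is the graph consisting of a single loop.\<close>

lemma Tutte_cycle_loop:
  assumes "Tutte_cycle_property Q" "ordered_oriented_graph G r" "loop G e"
    "\<O> \<subseteq> (arcs G - {e}) \<times> UNIV"
  shows "Q G r (\<O> \<union> {e} \<times> S) \<longleftrightarrow>
    Q (pre_digraph.del_arc G e) (induced_order (pre_digraph.del_arc G e) r) \<O> \<and> loop_good Q S"
proof -
  note G = ordered_oriented_graphD[OF assms(2)]
  have e: "e \<in> arcs G" "tail G e = head G e" "\<not> isthmus G e"
    using assms(3) isthmus_not_loop[OF G(2)] by (auto simp: loop_def)
  have cyc: "cycle_property Q" using assms(1) by (simp add: Tutte_cycle_property_def)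
  have "bridgeless G {e}" using e by (auto simp: bridgeless_def coboundary_def)
  then have circ: "circuit G C \<and> e \<in> C \<longleftrightarrow> C = {e}" for C
    unfolding circuit_def by (cases "C = {e}") blast+
  then have circ_e: "circuit G {e}" by blast
  have "induced_fourientation (edge_subgraph G {e}) (\<O> \<union> {e} \<times> S) = {e} \<times> S"
    using assms(4) by (auto simp: induced_fourientation_def edge_orientations_def)
  then have "cycle_good Q G r (\<O> \<union> {e} \<times> S) {e} \<longleftrightarrow> loop_good Q S"
    using loop_good_iff[OF _ ordered_oriented_graph_circuit[OF assms(2) circ_e]] cyc e(2)
    by (simp add: cycle_good_def cycle_property_def)
  then show ?thesis
    unfolding cycle_property_split_arc[OF cyc assms(2) e(1,3) assms(4)] circ by blast
qed

lemma bridgeless_contract_isthmus: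
  assumes "wf_digraph G" "isthmus G e"
  shows "bridgeless (contract G {e}) C \<longleftrightarrow> bridgeless G C"
proof -
  let ?H = "contract G {e}" and ?R = "representative G {e}"
  obtain A where A: "coboundary G A = {e}"
    using assms isthmus_iff by metis
  have e: "e \<in> arcs G" using isthmus_not_loop[OF assms] by simp
  show ?thesis
  proof
    assume H: "bridgeless ?H C"
    then have C: "C \<subseteq> arcs G" "e \<notin> C" by (auto simp: bridgeless_def)
    have avoid: "coboundary G U \<inter> C \<noteq> {f}" if U: "e \<notin> coboundary G U" for U f
    proof -
      let ?U = "U \<inter> verts G"
      have eq: "coboundary G ?U = coboundary G U"
        using assms(1) by (auto simp: coboundary_def wf_digraph_def)
      have mem: "?R v \<in> ?R ` ?U \<longleftrightarrow> v \<in> U" if "v \<in> verts G" for v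
        using representative_arc_mem_iff[OF assms(1) e, of ?U v] U that unfolding eq by simp
      have "coboundary ?H (?R ` ?U) \<inter> C = coboundary G U \<inter> C"
        using mem C assms(1) by (auto simp: coboundary_def wf_digraph_def)
      then show ?thesis using H unfolding bridgeless_def by metis
    qed
    have "coboundary G U \<inter> C \<noteq> {f}" for U f
    proof (cases "e \<in> coboundary G U")
      case True
      \<comment> \<open>adding the cut \<open>{e}\<close> modulo 2 removes \<open>e\<close> from the cut and changes nothing on \<open>C\<close>\<close>
      let ?U = "(U - A) \<union> (A - U)"
      have "h \<in> coboundary G ?U \<longleftrightarrow> (h \<in> coboundary G U) \<noteq> (h \<in> coboundary G A)" for h
        by (auto simp: coboundary_def)
      then have "coboundary G ?U \<inter> C = coboundary G U \<inter> C" "e \<notin> coboundary G ?U"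
        using A True C(2) by auto
      then show ?thesis using avoid[of ?U f] by simp
    qed (rule avoid)
    then show "bridgeless G C" using C(1) by (simp add: bridgeless_def)
  next
    assume B: "bridgeless G C"
    then have "coboundary G A \<inter> C \<noteq> {e}" by (simp add: bridgeless_def)
    then have "e \<notin> C" using A by auto
    then have "coboundary ?H U \<inter> C = coboundary G {v. ?R v \<in> U} \<inter> C" for U
      unfolding coboundary_contract by blast
    then show "bridgeless ?H C" using B \<open>e \<notin> C\<close> by (auto simp: bridgeless_def)
  qed
qed

text \<open>A circuit avoids the isthmus and lies on one side of it. Contraction merges only the two
  ends of \<open>e\<close>, which lie on different sides, so it is injective on the vertices of the
  circuit and yields an isomorphic cycle minor.\<close>

lemma Tutte_cycle_isthmus:
  assumes "Tutte_cycle_property Q" "ordered_oriented_graph G r" "isthmus G e"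
    "\<O> \<subseteq> (arcs G - {e}) \<times> UNIV"
  shows "Q G r (\<O> \<union> {e} \<times> S) \<longleftrightarrow> Q (contract G {e}) (induced_order (contract G {e}) r) \<O>"
proof -
  let ?H = "contract G {e}" and ?R = "representative G {e}"
  note G = ordered_oriented_graphD[OF assms(2)]
  have e: "e \<in> arcs G" using isthmus_not_loop[OF G(2) assms(3)] by simp
  have H: "ordered_oriented_graph ?H (induced_order ?H r)"
    using ordered_oriented_graph_contract[OF assms(2)] e by blast
  obtain A where A: "coboundary G A = {e}"
    using assms(3) isthmus_iff[OF G(2)] by metis
  have cyc: "cycle_property Q" using assms(1) by (simp add: Tutte_cycle_property_def)
  have circ: "circuit ?H C \<longleftrightarrow> circuit G C" for C
    unfolding circuit_def bridgeless_contract_isthmus[OF G(2) assms(3)] ..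
  have "cycle_good Q ?H (induced_order ?H r) \<O> C \<longleftrightarrow> cycle_good Q G r (\<O> \<union> {e} \<times> S) C"
    if C: "circuit G C" for C
  proof -
    have "coboundary G A \<inter> C \<noteq> {e}" using C by (simp add: circuit_def bridgeless_def)
    then have eC: "e \<notin> C" and AC: "coboundary G A \<inter> C = {}" using A by auto
    have CG: "C \<subseteq> arcs G" using C by (simp add: circuit_def bridgeless_def)
    have verts: "tail G ` C \<union> head G ` C \<subseteq> verts G" using CG G(2) by (auto simp: wf_digraph_def)
    have "tail G f \<in> A \<longleftrightarrow> head G f \<in> A" if "f \<in> C" for f
      using that AC CG by (auto simp: coboundary_def)
    then have side: "u \<in> A \<longleftrightarrow> w \<in> A" if "u \<in> tail G ` C \<union> head G ` C" "w \<in> tail G ` C \<union> head G ` C" for u w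
      using that circuit_one_side[OF C AC] by blast
    have "inj_on ?R (tail G ` C \<union> head G ` C)"
    proof (rule inj_onI)
      fix u w assume uw: "u \<in> tail G ` C \<union> head G ` C" "w \<in> tail G ` C \<union> head G ` C" "?R u = ?R w"
      then have "joined G {e} u w"
        using representative_eq_iff[OF G(2), of "{e}" u w] verts e by blast
      then have "u = w \<or> {u, w} = {tail G e, head G e}" using joined_singleton[OF e] by blast
      moreover have "(tail G e \<in> A) \<noteq> (head G e \<in> A)" using A by (auto simp: coboundary_def)
      ultimately show "u = w" using side[OF uw(1,2)] by (auto simp: doubleton_eq_iff)
    qed
    then have "bij_betw ?R (tail G ` C \<union> head G ` C) (?R ` (tail G ` C \<union> head G ` C))"
      by (rule inj_on_imp_bij_betw)
    then have "fourientation_isomorphic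
        (edge_subgraph G C) (induced_order (edge_subgraph G C) r) (induced_fourientation (edge_subgraph G C) \<O>)
        (edge_subgraph ?H C) (induced_order (edge_subgraph ?H C) (induced_order ?H r))
        (induced_fourientation (edge_subgraph ?H C) \<O>)"
      unfolding fourientation_isomorphic_def using eC CG
      by (intro exI[of _ ?R] exI[of _ id])
        (auto simp: image_Un image_image induced_order_def induced_fourientation_def edge_orientations_def)
    then show ?thesis
      unfolding cycle_good_irrelevant[OF eC]
      using cyc ordered_oriented_graph_circuit[OF assms(2) C] ordered_oriented_graph_circuit[OF H] C circ
        induced_fourientation_in
      unfolding cycle_good_def cycle_property_def fourientation_property_def by metis
  qed
  moreover have "\<O> \<in> fourientations ?H" "\<O> \<union> {e} \<times> S \<in> fourientations G"
    using assms(4) e by (auto simp: fourientations_def edge_orientations_def)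
  ultimately show ?thesis
    using cycle_property_iff_circuits[OF cyc] assms(2) H circ by metis
qed

section \<open>Counting good fourientations\<close>

lemma UNIV_sign: "(UNIV :: sign set) = {Plus, Minus}"
  using sign.exhaust by auto

lemma potential_crossing_exclusive:
  fixes P Q :: "('v::infinite, 'e::infinite) fproperty"
  assumes "Tutte_cut_property P" "Tutte_cycle_property Q"
    "ordered_oriented_graph G r" "ordinary_arc G e" "maximum_edge G r e" "\<O> \<subseteq> (arcs G - {e}) \<times> UNIV"
    "P (contract G {e}) (induced_order (contract G {e}) r) \<O>"
    "Q (pre_digraph.del_arc G e) (induced_order (pre_digraph.del_arc G e) r) \<O>"
  shows "P G r (\<O> \<union> {e} \<times> {s}) \<or> Q G r (\<O> \<union> {e} \<times> {s})"
  using Tutte_cut_ordinary(6)[OF assms(1,3-7), of s] Tutte_cycle_ordinary(6)[OF assms(2-6,8), of s]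
    directed_cycle_not_blocked by metis

section \<open>Weighted sums over the states of one edge\<close>

definition state_weight :: "'a::comm_ring_1 \<Rightarrow> 'a \<Rightarrow> 'a \<Rightarrow> sign set \<Rightarrow> 'a" where
  "state_weight k l m S = (if S = {} then l else if S = UNIV then m else k)"

lemma state_weight_simps:
  "state_weight k l m {} = l" "state_weight k l m {s} = k" "state_weight k l m UNIV = m"
  unfolding state_weight_def UNIV_sign by auto

lemma weight_eq_prod:
  fixes k l m :: "'a::comm_monoid_mult"
  assumes "finite (arcs G)"
  shows "k ^ card (oriented_edges G \<O>) * l ^ card (unoriented_edges G \<O>) * m ^ card (bioriented_edges G \<O>) =
    (\<Prod>f\<in>arcs G. if f \<in> oriented_edges G \<O> then k else if f \<in> unoriented_edges G \<O> then l else m)"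
    (is "_ = prod ?w _")
proof -
  let ?A = "oriented_edges G \<O>" and ?B = "unoriented_edges G \<O>" and ?C = "bioriented_edges G \<O>"
  have arcs: "arcs G = ?A \<union> ?B \<union> ?C" and disj: "?A \<inter> ?B = {}" "(?A \<union> ?B) \<inter> ?C = {}"
    by (auto simp: oriented_edges_def unoriented_edges_def bioriented_edges_def)
  have fin: "finite ?A" "finite ?B" "finite ?C"
    using assms unfolding oriented_edges_def unoriented_edges_def bioriented_edges_def by simp_all
  have "prod ?w (arcs G) = prod ?w ?A * prod ?w ?B * prod ?w ?C"
    using fin disj by (subst arcs) (simp add: prod.union_disjoint)
  also have "prod ?w ?A = (\<Prod>f\<in>?A. k)" by (intro prod.cong) simp_all
  also have "prod ?w ?B = (\<Prod>f\<in>?B. l)" using disj by (intro prod.cong) auto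
  also have "prod ?w ?C = (\<Prod>f\<in>?C. m)" using disj by (intro prod.cong) auto
  finally show ?thesis by simp
qed

lemma weight_eq_state_weights:
  assumes "finite (arcs G)"
  shows "k ^ card (oriented_edges G \<O>) * l ^ card (unoriented_edges G \<O>) * m ^ card (bioriented_edges G \<O>) =
    (\<Prod>f\<in>arcs G. state_weight k l m (\<O> `` {f}))"
proof -
  have "(if f \<in> oriented_edges G \<O> then k else if f \<in> unoriented_edges G \<O> then l else m) =
      state_weight k l m (\<O> `` {f})" if "f \<in> arcs G" for f
  proof -
    have "\<O> `` {f} = {} \<longleftrightarrow> (f, Plus) \<notin> \<O> \<and> (f, Minus) \<notin> \<O>"
      by (auto simp: set_eq_iff) (metis sign.exhaust)
    moreover have "\<O> `` {f} = UNIV \<longleftrightarrow> (f, Plus) \<in> \<O> \<and> (f, Minus) \<in> \<O>"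
      unfolding UNIV_sign by (auto simp: set_eq_iff) (metis sign.exhaust)
    ultimately show ?thesis
      using that by (auto simp: state_weight_def oriented_edges_def unoriented_edges_def)
  qed
  then show ?thesis unfolding weight_eq_prod[OF assms] by (intro prod.cong) simp_all
qed

text \<open>An indicator replaces the restriction to good fourientations, so that the graph and its
  minors can be summed over a common index set and compared term by term.\<close>

lemma weight_sum_eq:
  assumes "finite (arcs G)"
  shows "weight_sum good G r k l m =
    (\<Sum>\<O>\<in>Pow (arcs G \<times> UNIV). (\<Prod>f\<in>arcs G. state_weight k l m (\<O> `` {f})) * of_bool (good G r \<O>))"
proof -
  have "finite (Pow (arcs G \<times> (UNIV :: sign set)))"
    using assms by (simp add: UNIV_sign)
  then show ?thesis
    unfolding weight_sum_def weight_eq_state_weights[OF assms] good_fourientations_def fourientations_def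
      edge_orientations_def
    by (intro sum.mono_neutral_cong_left) auto
qed

lemma weight_sum_split_arc:
  assumes "finite (arcs G)" "e \<in> arcs G"
  shows "weight_sum good G r k l m =
    (\<Sum>\<O>\<in>Pow ((arcs G - {e}) \<times> UNIV). (\<Prod>f\<in>arcs G - {e}. state_weight k l m (\<O> `` {f})) *
      (l * of_bool (good G r (\<O> \<union> {e} \<times> {})) + k * of_bool (good G r (\<O> \<union> {e} \<times> {Plus})) +
       k * of_bool (good G r (\<O> \<union> {e} \<times> {Minus})) + m * of_bool (good G r (\<O> \<union> {e} \<times> UNIV))))"
proof -
  let ?A = "(arcs G - {e}) \<times> (UNIV :: sign set)"
  define F where "F \<O> = (\<Prod>f\<in>arcs G. state_weight k l m (\<O> `` {f})) * of_bool (good G r \<O>)" for \<O>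
  let ?w = "\<lambda>\<O>. \<Prod>f\<in>arcs G - {e}. state_weight k l m (\<O> `` {f})"
  have A: "arcs G \<times> (UNIV :: sign set) = insert (e, Plus) (insert (e, Minus) ?A)"
    using assms(2) by (auto simp: UNIV_sign)
  have fin: "finite ?A" using assms(1) by (simp add: UNIV_sign)
  have w: "(\<Prod>f\<in>arcs G. state_weight k l m ((\<O> \<union> {e} \<times> S) `` {f})) = state_weight k l m S * ?w \<O>"
    if "\<O> \<in> Pow ?A" for \<O> S
  proof -
    have "(\<O> \<union> {e} \<times> S) `` {e} = S" using that by auto
    moreover have "(\<O> \<union> {e} \<times> S) `` {f} = \<O> `` {f}" if "f \<in> arcs G - {e}" for f
      using that by auto
    ultimately show ?thesis
      unfolding prod.remove[OF assms] by simp
  qed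
  have ins: "insert (e, Minus) \<O> = \<O> \<union> {e} \<times> {Minus}" "insert (e, Plus) \<O> = \<O> \<union> {e} \<times> {Plus}"
    "insert (e, Plus) (insert (e, Minus) \<O>) = \<O> \<union> {e} \<times> UNIV" for \<O>
    by (auto simp: UNIV_sign)
  have "weight_sum good G r k l m = sum F (Pow (insert (e, Plus) (insert (e, Minus) ?A)))"
    unfolding weight_sum_eq[OF assms(1)] A F_def ..
  \<comment> \<open>The two orientations of \<open>e\<close> are split off in turn, which produces
    its four states.\<close>
  also have "\<dots> = (\<Sum>\<O>\<in>Pow ?A. F \<O> + F (insert (e, Plus) \<O>) +
      (F (insert (e, Minus) \<O>) + F (insert (e, Plus) (insert (e, Minus) \<O>))))"
    using fin by (subst sum_Pow_insert; (subst sum_Pow_insert)?) auto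
  also have "\<dots> = (\<Sum>\<O>\<in>Pow ?A. F (\<O> \<union> {e} \<times> {}) + F (\<O> \<union> {e} \<times> {Plus}) +
      (F (\<O> \<union> {e} \<times> {Minus}) + F (\<O> \<union> {e} \<times> UNIV)))"
    by (simp only: ins[symmetric] Sigma_empty2 Un_empty_right)
  also have "\<dots> = (\<Sum>\<O>\<in>Pow ?A. ?w \<O> *
      (l * of_bool (good G r (\<O> \<union> {e} \<times> {})) + k * of_bool (good G r (\<O> \<union> {e} \<times> {Plus})) +
       k * of_bool (good G r (\<O> \<union> {e} \<times> {Minus})) + m * of_bool (good G r (\<O> \<union> {e} \<times> UNIV))))"
    by (intro sum.cong refl) (simp only: w F_def state_weight_simps distrib_left mult_ac add_ac)
  finally show ?thesis .
qed

lemma weight_sum_minor: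
  assumes "finite (arcs G)" "arcs H = arcs G - {e}"
  shows "weight_sum good H r k l m =
    (\<Sum>\<O>\<in>Pow ((arcs G - {e}) \<times> UNIV).
      (\<Prod>f\<in>arcs G - {e}. state_weight k l m (\<O> `` {f})) * of_bool (good H r \<O>))"
  using assms weight_sum_eq[of H] by simp

section \<open>The recurrence and the counting formula\<close>

lemma Tutte_cut_cycle_no_arcs:
  assumes "Tutte_cut_property P" "Tutte_cycle_property Q" "ordered_oriented_graph G r" "arcs G = {}"
  shows "P G r {}" "Q G r {}"
proof -
  have O: "{} \<in> fourientations G" by (simp add: fourientations_def)
  obtain v where v: "verts G = {v}"
    using Tutte_polynomial_no_arcs(2)[OF assms(3,4)] by (auto simp: card_1_singleton_iff)
  have "\<not> potential_cut G {} D" for D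
    unfolding potential_cut_def directed_cut_def is_cut_iff v by auto
  then show "P G r {}" using assms(1,3) O unfolding Tutte_cut_property_def by blast
  have "\<not> potential_cycle G {} D" for D
    by (auto simp: potential_cycle_def directed_cycle_def)
  then show "Q G r {}" using assms(2,3) O unfolding Tutte_cycle_property_def by blast
qed

text \<open>The clearing bounds fit the minors: contraction of a non-loop lowers
  \<open>n - 1\<close> by one and keeps the cyclomatic number, deletion of a non-isthmus does the
  reverse. In the isthmus and loop cases the shifted bound goes with the extra variable, in the
  ordinary case with a spare denominator.\<close>

lemma weight_sum_eq_eval2_cleared:
  fixes P Q good :: "('v::infinite, 'e::infinite) fproperty" and k l m :: "'a::comm_ring_1"
  assumes "Tutte_cut_property P" "Tutte_cycle_property Q"
    and good: "good = (\<lambda>G r \<O>. P G r \<O> \<and> Q G r \<O>)"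
    and "ordered_oriented_graph G r"
  shows "weight_sum good G r k l m =
    eval2_cleared (card (verts G) - 1) (card (arcs G) + 1 - card (verts G)) (Tutte_polynomial G)
      (isthmus_weight (bad_isthmus_set P) k l m) (k + m) (loop_weight (bad_loop_set Q) k l m) (k + l)"
    (is "_ = eval2_cleared _ _ _ ?x _ ?y _")
  using assms(4)
proof (induction rule: minor_induct)
  case (empty G r)
  have "Pow (arcs G \<times> (UNIV :: sign set)) = {{}}" using empty(2) by simp
  then have "weight_sum good G r k l m = 1"
    using Tutte_cut_cycle_no_arcs[OF assms(1,2) empty] weight_sum_eq[of G good r k l m] empty(2)
    by (simp add: good)
  then show ?case
    using Tutte_polynomial_no_arcs[OF empty] empty(2) by (simp add: eval2_cleared_1)
next
  case (isthmus G r e)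
  let ?H = "contract G {e}"
  note G = ordered_oriented_graphD[OF isthmus(1)]
  note e = isthmus_not_loop[OF G(2) isthmus(2)]
  note n = card_verts_contract_arc[OF G(1) e(2,1)]
  have arcs: "arcs ?H = arcs G - {e}" "card (arcs G) = Suc (card (arcs ?H))"
    using card_Suc_Diff1[OF G(4) e(2)] by simp_all
  have H: "ordered_oriented_graph ?H (induced_order ?H r)"
    using ordered_oriented_graph_contract[OF isthmus(1)] e(2) by blast
  have pos: "card (verts ?H) > 0"
    using ordered_oriented_graphD(2,3,5)[OF H] connected_iff_joined by (metis card_gt_0_iff)
  have x: "?x = of_bool (isthmus_good P {Plus}) * k + of_bool (isthmus_good P {Minus}) * k +
      of_bool (isthmus_good P {}) * l + m"
    unfolding isthmus_weight_def by (simp add: bad_isthmus_set_iff)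
  have "weight_sum good G r k l m = ?x * weight_sum good ?H (induced_order ?H r) k l m"
    unfolding weight_sum_split_arc[OF G(4) e(2)] weight_sum_minor[OF G(4) arcs(1)] sum_distrib_left
  proof (intro sum.cong refl)
    fix \<O> assume "\<O> \<in> Pow ((arcs G - {e}) \<times> (UNIV :: sign set))"
    then have "\<O> \<subseteq> (arcs G - {e}) \<times> UNIV" by simp
    then have *: "good G r (\<O> \<union> {e} \<times> S) \<longleftrightarrow> good ?H (induced_order ?H r) \<O> \<and> isthmus_good P S" for S
      using Tutte_cut_isthmus[OF assms(1) isthmus(1,2)] Tutte_cycle_isthmus[OF assms(2) isthmus(1,2)]
      unfolding good by blast
    show "(\<Prod>f\<in>arcs G - {e}. state_weight k l m (\<O> `` {f})) *
      (l * of_bool (good G r (\<O> \<union> {e} \<times> {})) + k * of_bool (good G r (\<O> \<union> {e} \<times> {Plus})) +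
       k * of_bool (good G r (\<O> \<union> {e} \<times> {Minus})) + m * of_bool (good G r (\<O> \<union> {e} \<times> UNIV))) =
      ?x * ((\<Prod>f\<in>arcs G - {e}. state_weight k l m (\<O> `` {f})) * of_bool (good ?H (induced_order ?H r) \<O>))"
      unfolding x * using isthmus_good_bioriented[OF assms(1)]
      by (cases "good ?H (induced_order ?H r) \<O>") (simp_all add: algebra_simps)
  qed
  also have "\<dots> = ?x * eval2_cleared (card (verts ?H) - 1) (card (arcs ?H) + 1 - card (verts ?H))
      (Tutte_polynomial ?H) ?x (k + m) ?y (k + l)"
    unfolding isthmus(3) ..
  also have "\<dots> = eval2_cleared (Suc (card (verts ?H) - 1)) (card (arcs ?H) + 1 - card (verts ?H))
      (Tutte_polynomial G) ?x (k + m) ?y (k + l)"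
    unfolding Tutte_polynomial_isthmus[OF isthmus(1,2)] eval2_cleared_mult_x ..
  also have "Suc (card (verts ?H) - 1) = card (verts G) - 1" using n pos by simp
  also have "card (arcs ?H) + 1 - card (verts ?H) = card (arcs G) + 1 - card (verts G)"
    using n arcs(2) by simp
  finally show ?case .
next
  case (loop G r e)
  let ?H = "pre_digraph.del_arc G e"
  note G = ordered_oriented_graphD[OF loop(1)]
  have e: "e \<in> arcs G" using loop(2) by (simp add: loop_def)
  have arcs: "arcs ?H = arcs G - {e}" "card (arcs G) = Suc (card (arcs ?H))"
    using card_Suc_Diff1[OF G(4) e] by (simp_all add: pre_digraph.del_arc_simps)
  have n: "card (verts ?H) = card (verts G)" by (simp add: pre_digraph.del_arc_simps)
  have "\<not> isthmus G e" using loop(2) isthmus_not_loop[OF G(2)] by blast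
  note le = Tutte_polynomial_degrees(1)[OF ordered_oriented_graph_del_arc[OF loop(1) this]]
  have y: "?y = of_bool (loop_good Q {Plus}) * k + of_bool (loop_good Q {Minus}) * k + l +
      of_bool (loop_good Q UNIV) * m"
    unfolding loop_weight_def UNIV_sign by (simp add: bad_loop_set_iff insert_commute)
  have "weight_sum good G r k l m = ?y * weight_sum good ?H (induced_order ?H r) k l m"
    unfolding weight_sum_split_arc[OF G(4) e] weight_sum_minor[OF G(4) arcs(1)] sum_distrib_left
  proof (intro sum.cong refl)
    fix \<O> assume "\<O> \<in> Pow ((arcs G - {e}) \<times> (UNIV :: sign set))"
    then have "\<O> \<subseteq> (arcs G - {e}) \<times> UNIV" by simp
    then have *: "good G r (\<O> \<union> {e} \<times> S) \<longleftrightarrow> good ?H (induced_order ?H r) \<O> \<and> loop_good Q S" for S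
      using cut_property_loop[OF _ loop(1,2)] Tutte_cycle_loop[OF assms(2) loop(1,2)] assms(1)
      unfolding good Tutte_cut_property_def by blast
    show "(\<Prod>f\<in>arcs G - {e}. state_weight k l m (\<O> `` {f})) *
      (l * of_bool (good G r (\<O> \<union> {e} \<times> {})) + k * of_bool (good G r (\<O> \<union> {e} \<times> {Plus})) +
       k * of_bool (good G r (\<O> \<union> {e} \<times> {Minus})) + m * of_bool (good G r (\<O> \<union> {e} \<times> UNIV))) =
      ?y * ((\<Prod>f\<in>arcs G - {e}. state_weight k l m (\<O> `` {f})) * of_bool (good ?H (induced_order ?H r) \<O>))"
      unfolding y * using loop_good_unoriented[OF assms(2)]
      by (cases "good ?H (induced_order ?H r) \<O>") (simp_all add: algebra_simps)
  qed
  also have "\<dots> = ?y * eval2_cleared (card (verts ?H) - 1) (card (arcs ?H) + 1 - card (verts ?H))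
      (Tutte_polynomial ?H) ?x (k + m) ?y (k + l)"
    unfolding loop(3) ..
  also have "\<dots> = eval2_cleared (card (verts ?H) - 1) (Suc (card (arcs ?H) + 1 - card (verts ?H)))
      (Tutte_polynomial G) ?x (k + m) ?y (k + l)"
    unfolding Tutte_polynomial_loop[OF loop(1,2)] eval2_cleared_mult_y ..
  \<comment> \<open>Exact only because the cyclomatic number of the deletion is not truncated, which
    \<open>le\<close> provides.\<close>
  also have "Suc (card (arcs ?H) + 1 - card (verts ?H)) = card (arcs G) + 1 - card (verts G)"
    using n arcs(2) le by simp
  finally show ?case unfolding n .
next
  case (ordinary G r e)
  let ?C = "contract G {e}" and ?D = "pre_digraph.del_arc G e"
  note G = ordered_oriented_graphD[OF ordinary(1)]
  have e: "e \<in> arcs G" "\<not> isthmus G e" "\<not> loop G e" using ordinary(2) by (simp_all add: ordinary_arc_def)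
  note n = card_verts_contract_arc[OF G(1) e(1,3)]
  have arcs: "arcs ?C = arcs G - {e}" "arcs ?D = arcs G - {e}"
    by (simp_all add: pre_digraph.del_arc_simps)
  have cardC: "card (arcs G) = Suc (card (arcs ?C))" and cardD: "card (arcs G) = Suc (card (arcs ?D))"
    using card_Suc_Diff1[OF G(4) e(1)] unfolding arcs by simp_all
  have nD: "card (verts ?D) = card (verts G)" by (simp add: pre_digraph.del_arc_simps)
  have C: "ordered_oriented_graph ?C (induced_order ?C r)"
    using ordered_oriented_graph_contract[OF ordinary(1)] e(1) by blast
  note D = ordered_oriented_graph_del_arc[OF ordinary(1) e(2)]
  have pos: "card (verts ?C) > 0"
    using ordered_oriented_graphD(2,3,5)[OF C] connected_iff_joined by (metis card_gt_0_iff)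
  have "weight_sum good G r k l m = (k + m) * weight_sum good ?C (induced_order ?C r) k l m +
      (k + l) * weight_sum good ?D (induced_order ?D r) k l m"
    unfolding weight_sum_split_arc[OF G(4) e(1)] weight_sum_minor[OF G(4) arcs(1)]
      weight_sum_minor[OF G(4) arcs(2)] sum_distrib_left sum.distrib[symmetric]
  proof (intro sum.cong refl)
    fix \<O> assume "\<O> \<in> Pow ((arcs G - {e}) \<times> (UNIV :: sign set))"
    then have sub: "\<O> \<subseteq> (arcs G - {e}) \<times> UNIV" by simp
    note cut = Tutte_cut_ordinary[OF assms(1) ordinary(1-3) sub]
    note cyc = Tutte_cycle_ordinary[OF assms(2) ordinary(1-3) sub]
    note excl = potential_crossing_exclusive[OF assms(1,2) ordinary(1-3) sub]
    let ?pC = "P ?C (induced_order ?C r) \<O>" and ?pD = "P ?D (induced_order ?D r) \<O>"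
      and ?qC = "Q ?C (induced_order ?C r) \<O>" and ?qD = "Q ?D (induced_order ?D r) \<O>"
    let ?P = "\<lambda>S. P G r (\<O> \<union> {e} \<times> S)" and ?Q = "\<lambda>S. Q G r (\<O> \<union> {e} \<times> S)"
    \<comment> \<open>After the unoriented and bioriented terms are matched with the minors, the
      claim is that the number of jointly good orientations is [?pC and ?qC] +
      [?pD and ?qD].\<close>
    have "l * of_bool (?P {} \<and> ?Q {}) + k * of_bool (?P {Plus} \<and> ?Q {Plus}) +
        k * of_bool (?P {Minus} \<and> ?Q {Minus}) + m * of_bool (?P UNIV \<and> ?Q UNIV) =
      (k + m) * of_bool (?pC \<and> ?qC) + (k + l) * of_bool (?pD \<and> ?qD)"
    proof -
      \<comment> \<open>For the cut property the unoriented state is good when the deletion is, and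
        any good state makes the contraction good. For the cycle property the same holds with the
        bioriented state and the minors exchanged.\<close>
      have "?pD \<Longrightarrow> ?pC" "?qC \<Longrightarrow> ?qD"
        using cut(1,5) cyc(1,5) by blast+
      then consider "?pC" "?pD" "?qC" "?qD" | "?pC" "?pD" "\<not> ?qC" "?qD" | "?pC" "\<not> ?pD" "?qC" "?qD"
        | "?pC" "\<not> ?pD" "\<not> ?qC" "?qD" | "\<not> ?pC" "\<not> ?pD" | "\<not> ?qC" "\<not> ?qD"
        by blast
      then show ?thesis
      proof cases
        case 1
        then show ?thesis using cut(1-3) cyc(1-3) by (simp add: algebra_simps)
      next
        case 2
        then show ?thesis using cut(1-3) cyc(1,2,4) by (cases "?Q {Plus}") (simp_all add: algebra_simps)
      next
        case 3
        then show ?thesis using cut(1,2,4) cyc(1-3) by (cases "?P {Plus}") (simp_all add: algebra_simps)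
      next
        case 4
        then have "\<not> (?P {Plus} \<and> ?Q {Plus})" "\<not> (?P {Minus} \<and> ?Q {Minus})"
          using cut(4) cyc(4) excl by blast+
        then show ?thesis using 4 cut(1,2) cyc(1,2) by auto
      next
        case 5
        then have "\<not> ?P S" for S using cut(5) by blast
        then show ?thesis using 5 by (simp only: simp_thms of_bool_eq mult_zero_right add_0)
      next
        case 6
        then have "\<not> ?Q S" for S using cyc(5) by blast
        then show ?thesis using 6 by (simp only: simp_thms of_bool_eq mult_zero_right add_0)
      qed
    qed
    then show "(\<Prod>f\<in>arcs G - {e}. state_weight k l m (\<O> `` {f})) *
      (l * of_bool (good G r (\<O> \<union> {e} \<times> {})) + k * of_bool (good G r (\<O> \<union> {e} \<times> {Plus})) +
       k * of_bool (good G r (\<O> \<union> {e} \<times> {Minus})) + m * of_bool (good G r (\<O> \<union> {e} \<times> UNIV))) =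
      (k + m) * ((\<Prod>f\<in>arcs G - {e}. state_weight k l m (\<O> `` {f})) * of_bool (good ?C (induced_order ?C r) \<O>)) +
      (k + l) * ((\<Prod>f\<in>arcs G - {e}. state_weight k l m (\<O> `` {f})) * of_bool (good ?D (induced_order ?D r) \<O>))"
      unfolding good by (simp only: distrib_left mult.left_commute)
  qed
  also have "\<dots> =
      (k + m) * eval2_cleared (card (verts ?C) - 1) (card (arcs ?C) + 1 - card (verts ?C))
        (Tutte_polynomial ?C) ?x (k + m) ?y (k + l) +
      (k + l) * eval2_cleared (card (verts ?D) - 1) (card (arcs ?D) + 1 - card (verts ?D))
        (Tutte_polynomial ?D) ?x (k + m) ?y (k + l)"
    unfolding ordinary(4,5) ..
  \<comment> \<open>The coefficients are absorbed as spare denominators, which brings both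
    evaluations to the bounds of \<open>G\<close>.\<close>
  also have "\<dots> =
      eval2_cleared (Suc (card (verts ?C) - 1)) (card (arcs ?C) + 1 - card (verts ?C))
        (Tutte_polynomial ?C) ?x (k + m) ?y (k + l) +
      eval2_cleared (card (verts ?D) - 1) (Suc (card (arcs ?D) + 1 - card (verts ?D)))
        (Tutte_polynomial ?D) ?x (k + m) ?y (k + l)"
    unfolding eval2_cleared_Suc_left[OF Tutte_polynomial_degrees(2)[OF C]]
      eval2_cleared_Suc_right[OF Tutte_polynomial_degrees(3)[OF D]] ..
  also have "Suc (card (verts ?C) - 1) = card (verts G) - 1" using n pos by simp
  also have "card (arcs ?C) + 1 - card (verts ?C) = card (arcs G) + 1 - card (verts G)"
    using n cardC by simp
  also have "Suc (card (arcs ?D) + 1 - card (verts ?D)) = card (arcs G) + 1 - card (verts G)"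
    using cardD nD Tutte_polynomial_degrees(1)[OF D] by simp
  finally show ?case
    unfolding nD Tutte_polynomial_ordinary[OF ordinary(1,2)] eval2_cleared_add .
qed

text \<open>Colours are chosen independently edge by edge, so the colourings of one fourientation
  form a product set whose size is its weight.\<close>

lemma card_good_klm_fourientations:
  assumes "finite (arcs G)"
  shows "int (card {(\<O>, c) \<in> klm_fourientations G k l m. good G r \<O>}) =
    weight_sum good G r (int k) (int l) (int m)"
proof -
  let ?B = "\<lambda>\<O>. \<Pi>\<^sub>E e\<in>arcs G. if e \<in> oriented_edges G \<O> then {..<k}
          else if e \<in> unoriented_edges G \<O> then {..<l} else {..<m}"
  have fin: "finite (good_fourientations good G r)"
    using assms by (simp add: good_fourientations_def fourientations_def edge_orientations_def UNIV_sign)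
  have card: "card (?B \<O>) = k ^ card (oriented_edges G \<O>) * l ^ card (unoriented_edges G \<O>) *
      m ^ card (bioriented_edges G \<O>)" for \<O>
    unfolding weight_eq_prod[OF assms] card_PiE[OF assms] by (intro prod.cong) simp_all
  have "{(\<O>, c) \<in> klm_fourientations G k l m. good G r \<O>} = (SIGMA \<O> : good_fourientations good G r. ?B \<O>)"
    by (auto simp: klm_fourientations_def good_fourientations_def)
  moreover have "finite (?B \<O>)" for \<O>
    using assms by (intro finite_PiE) auto
  ultimately show ?thesis
    using fin by (simp add: card_SigmaI card weight_sum_def)
qed

text \<open>Three readings of one identity. The field version has the quotients as written and needs
  nonzero denominators. The ring version covers all values and, over a polynomial ring, gives the
  identity of polynomials. The last one counts colourings. The subtraction in \<open>g\<close> is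
  exact because a connected graph has at most one vertex more than edges.\<close>

theorem theorem2p13:
  fixes P Q good :: "('v::infinite, 'e::infinite) fproperty"
    and G :: "('v, 'e) pre_digraph" and r :: "'e rel"
    and X Y :: "sign set set" and n g :: nat
  assumes "Tutte_cut_property P" and "Tutte_cycle_property Q"
    and "good = (\<lambda>G r \<O>. P G r \<O> \<and> Q G r \<O>)"
    and "X = bad_isthmus_set P" and "Y = bad_loop_set Q"
    and "ordered_oriented_graph G r"
    and "n = card (verts G)" and "g = card (arcs G) + 1 - n"
  shows
    "(\<forall>k l m :: 'a::field. k + m \<noteq> 0 \<and> k + l \<noteq> 0 \<longrightarrow>
        weight_sum good G r k l m =
          (k + m) ^ (n - 1) * (k + l) ^ g *
          eval2 (Tutte_polynomial G)
            (isthmus_weight X k l m / (k + m)) (loop_weight Y k l m / (k + l))) \<and>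
     (\<forall>k l m :: 'b::comm_ring_1.
        weight_sum good G r k l m =
          eval2_cleared (n - 1) g (Tutte_polynomial G)
            (isthmus_weight X k l m) (k + m) (loop_weight Y k l m) (k + l)) \<and>
     (\<forall>k l m :: nat.
        int (card {(\<O>, c) \<in> klm_fourientations G k l m. good G r \<O>}) =
          eval2_cleared (n - 1) g (Tutte_polynomial G)
            (isthmus_weight X (int k) (int l) (int m)) (int k + int m)
            (loop_weight Y (int k) (int l) (int m)) (int k + int l))"
proof (intro conjI allI impI)
  note main = weight_sum_eq_eval2_cleared[OF assms(1-3,6), folded assms(4,5,7), folded assms(8)]
  show "weight_sum good G r k l m = (k + m) ^ (n - 1) * (k + l) ^ g *
      eval2 (Tutte_polynomial G) (isthmus_weight X k l m / (k + m)) (loop_weight Y k l m / (k + l))"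
    if "k + m \<noteq> 0 \<and> k + l \<noteq> 0" for k l m :: 'a
    unfolding main
    using that Tutte_polynomial_degrees(2,3)[OF assms(6)] unfolding assms(7,8)
    by (intro eval2_cleared_eq) simp_all
  show "weight_sum good G r k l m = eval2_cleared (n - 1) g (Tutte_polynomial G)
      (isthmus_weight X k l m) (k + m) (loop_weight Y k l m) (k + l)" for k l m :: 'b
    by (rule main)
  show "int (card {(\<O>, c) \<in> klm_fourientations G k l m. good G r \<O>}) =
      eval2_cleared (n - 1) g (Tutte_polynomial G)
        (isthmus_weight X (int k) (int l) (int m)) (int k + int m)
        (loop_weight Y (int k) (int l) (int m)) (int k + int l)" for k l m
    unfolding card_good_klm_fourientations[OF ordered_oriented_graphD(4)[OF assms(6)]] by (rule main)
qed

end
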